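(* Let $C=\begin{bmatrix}C_{11}&C_{12}\\C_{21}&C_{22}\end{bmatrix}\in\mathbb{C}^{n\times n}$, with $C_{11}\in\mathbb{C}^{k\times k}$, be semi-sectorial and let $C\slash_{11}=C_{22}-C_{21}C_{11}^{\dagger}C_{12}$ be the generalized Schur complement of $C_{11}$ in $C$, where $\dagger$ denotes the Moore-Penrose generalized inverse. Denote $r=\mathrm{rank}(C)$ and $\hat r=\mathrm{rank}(C\slash_{11})$. If $\mathcal{R}(C_{12})\subset\mathcal{R}(C_{11})$ and $\mathcal{R}(C_{21}^* )\subset\mathcal{R}(C_{11}^* )$, then $C\slash_{11}$ is semi-sectorial and (with the phases of $C\slash_{11}$ selected compatibly with those of $C$, i.e. in $[\underline{\phi}(C),\overline{\phi}(C)]$) $$\phi_j(C)\geq\phi_j(C\slash_{11})\geq\phi_{r-\hat r+j}(C),\qquad j=1,\dots,\hat r.$$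
   Context: $\mathcal{R}(\cdot)$ denotes the range of a matrix. For $C\in\mathbb{C}^{n\times n}$, the numerical range is $W(C)=\{x^*Cx:\|x\|=1\}$ and the angular numerical range is $W'(C)=\{x^*Cx:x\in\mathbb{C}^n,x\neq0\}$, a convex cone. The field angle $\delta(C)$ is the angle subtended by $W'(C)$ if $W'(C)$ contains no line through the origin, $\pi$ if it contains exactly one line through the origin, and $2\pi$ if it is all of $\mathbb{C}$. $C$ is sectorial if $0\notin W(C)$, quasi-sectorial if $\delta(C)<\pi$, and semi-sectorial if $\delta(C)\leq\pi$. The zero matrix is quasi-sectorial and has no phases. Phases. A sectorial $C$ can be written $C=T^*DT$ with $T$ nonsingular and $D$ diagonal unitary, the diagonal entries of $D$ being unique up to permutation and lying in an arc of length less than $\pi$; the phases $\overline{\phi}(C)=\phi_1(C)\geq\dots\geq\phi_n(C)=\underline{\phi}(C)$ are the arguments of the diagonal entries of $D$, selected so that $\overline{\phi}(C)-\underline{\phi}(C)<\pi$. A quasi-sectorial $C$ of rank $r$ has a decomposition $C=U\begin{bmatrix}0&0\\0&C_s\end{bmatrix}U^*$ with $U$ unitary and $C_s\in\mathbb{C}^{r\times r}$ sectorial; its $r$ phases are those of $C_s$. A semi-sectorial $C$ of rank $r$ with $\delta(C)=\pi$ is of one of two kinds. (i) Rotated Hermitian: $W(C)$ is a straight segment with the origin in its relative interior, $C=T^*\mathrm{diag}\{0_{n-r},e^{j(\theta_0+\pi/2)}I,e^{j(\theta_0-\pi/2)}I\}T$ with $T$ nonsingular, and its phases are the corresponding copies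 of $\theta_0+\pi/2$ and $\theta_0-\pi/2$. (ii) Otherwise $C=T^*\,\mathrm{diag}\{0_{n-r},D,E\}\,T$ with $T$ nonsingular, $D=\mathrm{diag}\{e^{j\theta_1},\dots,e^{j\theta_m}\}$, $\theta_0+\pi/2\geq\theta_1\geq\cdots\geq\theta_m\geq\theta_0-\pi/2$, and $E$ block diagonal with $(r-m)/2$ blocks $e^{j\theta_0}\begin{bmatrix}1&2\\0&1\end{bmatrix}$; its phases are $\theta_1,\dots,\theta_m$ together with $(r-m)/2$ copies of each of $\theta_0+\pi/2$ and $\theta_0-\pi/2$. So a semi-sectorial matrix of rank $r$ has $r$ phases, ordered $\overline{\phi}(C)=\phi_1(C)\geq\dots\geq\phi_r(C)=\underline{\phi}(C)$. Phases are determined only up to the choice of the phase center $\gamma(C)=[\overline{\phi}(C)+\underline{\phi}(C)]/2$ ($=\theta_0$ when $\delta(C)=\pi$), which is determined modulo $2\pi$ (modulo $\pi$ in the rotated Hermitian case). *)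

theory Defs
  imports
    "HOL-Analysis.Line_Segment"
    "Jordan_Normal_Form.Schur_Decomposition"
    "Jordan_Normal_Form.DL_Rank"
begin

abbreviation mat_rank :: "complex mat \<Rightarrow> nat" where
  "mat_rank A \<equiv> vec_space.rank (dim_row A) A"

abbreviation mat_range :: "complex mat \<Rightarrow> complex vec set" where
  "mat_range A \<equiv> vec_space.col_space (dim_row A) A"

text \<open>The four Penrose conditions; the matrix they determine exists and is unique for every
  complex matrix.\<close>

definition moore_penrose :: "complex mat \<Rightarrow> complex mat" where
  "moore_penrose A = (THE X. X \<in> carrier_mat (dim_col A) (dim_row A) \<and>
     A * X * A = A \<and> X * A * X = X \<and>
     mat_adjoint (A * X) = A * X \<and> mat_adjoint (X * A) = X * A)"

definition schur_complement ::
  "complex mat \<Rightarrow> complex mat \<Rightarrow> complex mat \<Rightarrow> complex mat \<Rightarrow> complex mat" where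
  "schur_complement C11 C12 C21 C22 = C22 - C21 * moore_penrose C11 * C12"


section \<open>Numerical range and field angle\<close>

text \<open>\<open>conjugate x \<bullet> (C *\<^sub>v x)\<close> is $x^* C x$, and \<open>conjugate x \<bullet> x = 1\<close> says
  $\|x\| = 1$.\<close>

definition numerical_range :: "complex mat \<Rightarrow> complex set" where
  "numerical_range C =
     {conjugate x \<bullet> (C *\<^sub>v x) | x. x \<in> carrier_vec (dim_row C) \<and> conjugate x \<bullet> x = 1}"

definition angular_numerical_range :: "complex mat \<Rightarrow> complex set" where
  "angular_numerical_range C =
     {conjugate x \<bullet> (C *\<^sub>v x) | x. x \<in> carrier_vec (dim_row C) \<and> x \<noteq> 0\<^sub>v (dim_row C)}"

definition line_through_0 :: "complex set \<Rightarrow> bool" where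
  "line_through_0 L \<longleftrightarrow> (\<exists>z. z \<noteq> 0 \<and> L = range (\<lambda>t. of_real t * z))"

text \<open>The angle subtended by a convex cone that contains no line through the origin: the largest
  (as a supremum, since the cone need not be closed) angle in $[0,\pi]$ between two of its nonzero
  elements. The element 0 is inserted for cones without nonzero elements.\<close>

definition subtended_angle :: "complex set \<Rightarrow> real" where
  "subtended_angle K =
     Sup (insert 0 {\<bar>Arg (z / w)\<bar> | z w. z \<in> K \<and> w \<in> K \<and> z \<noteq> 0 \<and> w \<noteq> 0})"

text \<open>As $W'(C)$ is a convex cone, two distinct lines through the origin in it force it to be the
  whole plane, so the last branch is the case of no line.\<close>

definition field_angle :: "complex mat \<Rightarrow> real" where
  "field_angle C =
     (let K = angular_numerical_range C in
      if K = UNIV then 2 * pi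
      else if \<exists>!L. line_through_0 L \<and> L \<subseteq> K then pi
      else subtended_angle K)"

definition sectorial :: "complex mat \<Rightarrow> bool" where
  "sectorial C \<longleftrightarrow> square_mat C \<and> 0 \<notin> numerical_range C"

definition quasi_sectorial :: "complex mat \<Rightarrow> bool" where
  "quasi_sectorial C \<longleftrightarrow> square_mat C \<and> field_angle C < pi"

definition semi_sectorial :: "complex mat \<Rightarrow> bool" where
  "semi_sectorial C \<longleftrightarrow> square_mat C \<and> field_angle C \<le> pi"

definition rotated_hermitian :: "complex mat \<Rightarrow> bool" where
  "rotated_hermitian C \<longleftrightarrow>
     (\<exists>a b. numerical_range C = closed_segment a b \<and> 0 \<in> open_segment a b)"


section \<open>Phases\<close>

text \<open>Phases are determined only up to the choice of the phase center, so they are rendered as a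
  relation: \<open>phases C \<phi>s\<close> says that \<open>\<phi>s\<close>, in descending order, is an admissible selection of the
  phases of \<open>C\<close>. The list is indexed from 0, so $\phi_j(C)$ is \<open>\<phi>s ! (j - 1)\<close>.\<close>

definition cis_diag :: "real list \<Rightarrow> complex mat" where
  "cis_diag \<phi>s = mat_diag (length \<phi>s) (\<lambda>i. cis (\<phi>s ! i))"

definition sectorial_phases :: "complex mat \<Rightarrow> real list \<Rightarrow> bool" where
  "sectorial_phases C \<phi>s \<longleftrightarrow>
     sectorial C \<and> length \<phi>s = dim_row C \<and> sorted_wrt (\<ge>) \<phi>s \<and>
     (\<phi>s \<noteq> [] \<longrightarrow> hd \<phi>s - last \<phi>s < pi) \<and>
     (\<exists>T \<in> carrier_mat (dim_row C) (dim_row C). invertible_mat T \<and>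
        C = mat_adjoint T * cis_diag \<phi>s * T)"

definition quasi_sectorial_phases :: "complex mat \<Rightarrow> real list \<Rightarrow> bool" where
  "quasi_sectorial_phases C \<phi>s \<longleftrightarrow>
     quasi_sectorial C \<and>
     (let n = dim_row C; r = mat_rank C in
      \<exists>U \<in> carrier_mat n n. \<exists>Cs \<in> carrier_mat r r.
        mat_adjoint U * U = 1\<^sub>m n \<and>
        C = U * diag_block_mat [0\<^sub>m (n - r) (n - r), Cs] * mat_adjoint U \<and>
        sectorial_phases Cs \<phi>s)"

definition rotated_hermitian_phases :: "complex mat \<Rightarrow> real list \<Rightarrow> bool" where
  "rotated_hermitian_phases C \<phi>s \<longleftrightarrow>
     square_mat C \<and> field_angle C = pi \<and> rotated_hermitian C \<and>
     (let n = dim_row C; r = mat_rank C in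
      \<exists>T \<in> carrier_mat n n. \<exists>\<theta>0 p q.
        invertible_mat T \<and> p + q = r \<and>
        \<phi>s = replicate p (\<theta>0 + pi / 2) @ replicate q (\<theta>0 - pi / 2) \<and>
        C = mat_adjoint T * diag_block_mat [0\<^sub>m (n - r) (n - r), cis_diag \<phi>s] * T)"

definition E_block :: "real \<Rightarrow> complex mat" where
  "E_block \<theta>0 = cis \<theta>0 \<cdot>\<^sub>m mat_of_rows_list 2 [[1, 2], [0, 1]]"

text \<open>Below, \<open>q\<close> is the number $(r - m)/2$ of $2 \times 2$ blocks, where \<open>m\<close> is the length
  of \<open>\<theta>s\<close>.\<close>

definition non_rotated_hermitian_phases :: "complex mat \<Rightarrow> real list \<Rightarrow> bool" where
  "non_rotated_hermitian_phases C \<phi>s \<longleftrightarrow>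
     square_mat C \<and> field_angle C = pi \<and> \<not> rotated_hermitian C \<and>
     (let n = dim_row C; r = mat_rank C in
      \<exists>T \<in> carrier_mat n n. \<exists>\<theta>0 \<theta>s q.
        invertible_mat T \<and> length \<theta>s + 2 * q = r \<and>
        sorted_wrt (\<ge>) \<theta>s \<and> set \<theta>s \<subseteq> {\<theta>0 - pi / 2 .. \<theta>0 + pi / 2} \<and>
        \<phi>s = replicate q (\<theta>0 + pi / 2) @ \<theta>s @ replicate q (\<theta>0 - pi / 2) \<and>
        C = mat_adjoint T *
              diag_block_mat ([0\<^sub>m (n - r) (n - r), cis_diag \<theta>s] @ replicate q (E_block \<theta>0)) * T)"

definition phases :: "complex mat \<Rightarrow> real list \<Rightarrow> bool" where
  "phases C \<phi>s \<longleftrightarrow>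
     quasi_sectorial_phases C \<phi>s \<or> rotated_hermitian_phases C \<phi>s \<or>
     non_rotated_hermitian_phases C \<phi>s"

text \<open>A selection \<open>\<psi>s\<close> of the phases of \<open>S\<close> inside the interval
  $[\underline\phi(C), \overline\phi(C)]$ given by the selection \<open>\<phi>s\<close> of the phases of \<open>C\<close>.
  If \<open>\<phi>s\<close> is empty, \<open>\<psi>s\<close> has to be empty.\<close>

definition compatible_phases :: "real list \<Rightarrow> complex mat \<Rightarrow> real list \<Rightarrow> bool" where
  "compatible_phases \<phi>s S \<psi>s \<longleftrightarrow>
     phases S \<psi>s \<and> (\<forall>\<psi> \<in> set \<psi>s. \<phi>s \<noteq> [] \<and> last \<phi>s \<le> \<psi> \<and> \<psi> \<le> hd \<phi>s)"

end

theory Submission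
  imports Defs "Jordan_Normal_Form.Spectral_Radius"
begin

text \<open>If \<open>C12 = C11 Y\<close> and \<open>V = [-Y; I]\<close>, then \<open>C V = [0; S]\<close>, hence \<open>S = V\<^sup>* C V\<close> is a compression
  of \<open>C\<close>. In particular \<open>W'(S) \<subseteq> W'(C)\<close>, and since the field angle is at most \<open>\<pi>\<close> exactly when \<open>W'\<close> is
  not the whole plane, \<open>S\<close> is semi-sectorial. For generic \<open>\<alpha>\<close> the number of phases above (below) \<open>\<alpha>\<close> is
  the positive (negative) index of inertia of the Hermitian form \<open>Im (e\<^sup>-\<^sup>i\<^sup>\<alpha> x\<^sup>* C x)\<close>, which does not increase
  under compression; this gives both inequalities. A compatible selection of phases of \<open>S\<close> exists because
  \<open>W'(S)\<close> lies in the cone spanned by the phases of \<open>C\<close>: the accretive matrix obtained by rotating \<open>S\<close> is brought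
  to its canonical form by splitting off one block at a time.\<close>

section \<open>Complex matrices and their quadratic forms\<close>

text \<open>The three clauses that define \<open>phases\<close> have different shapes, so all are
  brought to one congruence form: zeros, unimodular diagonal entries, E blocks. Estimates are made
  on that form. The sign of \<open>sin (\<phi> - \<alpha>)\<close> tells on which side of \<alpha>
  the phase \<phi> lies only if the two differ by less than pi. A common window of length at most pi
  ensures this for every \<alpha> strictly inside it, and such a window is what compatibility
  provides. Genericity of \<alpha> keeps the E blocks nondegenerate: such a block then has one
  positive and one negative direction, matching its two phases \<theta> + pi/2 and \<theta> - pi/2,
  of which one lies on each side. Existence of a compatible selection is the harder half, because
  the canonical form of the compression has to be constructed, not merely compared. The form of
  \<open>C\<close> lies in a closed sector of half-angle at most pi/2, and so does that of
  \<open>S\<close>. The obstacle is the extreme case of a half-plane: only there can E blocks occur,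
  and there the kind of phases has to be decided from the field angle and the numerical
  range.\<close>

lemma mult_assoc_dim:
  "dim_col A = dim_row B \<Longrightarrow> dim_col B = dim_row D \<Longrightarrow> (A * B) * D = A * (B * (D :: complex mat))"
  by (rule assoc_mult_mat[of A "dim_row A" "dim_row B" B "dim_col B" D "dim_col D"]) auto

text \<open>Like its matrix counterpart, stated with equations between dimensions in place of
  carrier sets, which the simplifier can discharge while rewriting.\<close>

lemma mult_vec_assoc_dim:
  "dim_col A = dim_row B \<Longrightarrow> dim_col B = dim_vec v \<Longrightarrow> (A * B) *\<^sub>v v = A *\<^sub>v (B *\<^sub>v (v :: complex vec))"
  by (rule assoc_mult_mat_vec[of A "dim_row A" "dim_row B" B "dim_col B"]) (auto intro: carrier_vecI)

lemma dim_mat_adjoint [simp]: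
  "dim_row (mat_adjoint A) = dim_col A" "dim_col (mat_adjoint A) = dim_row A"
  unfolding mat_adjoint_def by auto

lemma mat_adjoint_carrier [simp]: "A \<in> carrier_mat n m \<Longrightarrow> mat_adjoint A \<in> carrier_mat m n"
  by (intro carrier_matI) auto

lemma index_mat_adjoint [simp]:
  "i < dim_col A \<Longrightarrow> j < dim_row A \<Longrightarrow> mat_adjoint A $$ (i, j) = conjugate (A $$ (j, i))"
  unfolding mat_adjoint_def by (auto simp: mat_of_rows_index)

lemma mat_adjoint_adjoint [simp]: "mat_adjoint (mat_adjoint A) = A"
  by (rule eq_matI) auto

lemma row_mat_adjoint: "i < dim_col A \<Longrightarrow> row (mat_adjoint A) i = conjugate (col A i)"
  by (rule eq_vecI) auto

lemma col_mat_adjoint: "i < dim_row A \<Longrightarrow> col (mat_adjoint A) i = conjugate (row A i)"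
  by (rule eq_vecI) auto

lemma mat_adjoint_mult:
  assumes "dim_col A = dim_row B"
  shows "mat_adjoint (A * B) = mat_adjoint B * mat_adjoint (A :: complex mat)"
proof (rule eq_matI)
  fix i j assume "i < dim_row (mat_adjoint B * mat_adjoint A)" "j < dim_col (mat_adjoint B * mat_adjoint A)"
  then show "mat_adjoint (A * B) $$ (i, j) = (mat_adjoint B * mat_adjoint A) $$ (i, j)"
    using assms by (simp add: row_mat_adjoint col_mat_adjoint scalar_prod_def mult.commute)
qed auto

lemma mat_adjoint_one [simp]: "mat_adjoint (1\<^sub>m n) = (1\<^sub>m n :: complex mat)"
  by (rule eq_matI) auto

lemma mat_adjoint_zero [simp]: "mat_adjoint (0\<^sub>m n m) = (0\<^sub>m m n :: complex mat)"
  by (rule eq_matI) auto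

lemma mat_adjoint_smult: "mat_adjoint (c \<cdot>\<^sub>m A) = cnj c \<cdot>\<^sub>m mat_adjoint (A :: complex mat)"
  by (rule eq_matI) auto

lemma mat_adjoint_four_block:
  assumes "A \<in> carrier_mat a b" "B \<in> carrier_mat a d" "D \<in> carrier_mat c b" "E \<in> carrier_mat c d"
  shows "mat_adjoint (four_block_mat A B D E)
    = four_block_mat (mat_adjoint A) (mat_adjoint D) (mat_adjoint B) (mat_adjoint (E :: complex mat))"
  using assms by (intro eq_matI) auto

abbreviation cprod :: "complex vec \<Rightarrow> complex vec \<Rightarrow> complex" where
  "cprod x y \<equiv> conjugate x \<bullet> y"

definition qf :: "complex mat \<Rightarrow> complex vec \<Rightarrow> complex" where
  "qf A x = cprod x (A *\<^sub>v x)"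

lemma cprod_adjoint:
  assumes "dim_vec x = dim_row A" "dim_vec y = dim_col A"
  shows "cprod x (A *\<^sub>v y) = cprod (mat_adjoint A *\<^sub>v x) y"
proof -
  have "cprod x (A *\<^sub>v y) = (\<Sum>i<dim_row A. \<Sum>j<dim_col A. cnj (x $ i) * A $$ (i,j) * y $ j)"
    using assms by (simp add: scalar_prod_def sum_distrib_left mult.assoc atLeast0LessThan)
  also have "\<dots> = (\<Sum>j<dim_col A. \<Sum>i<dim_row A. cnj (x $ i) * A $$ (i,j) * y $ j)"
    by (rule sum.swap)
  also have "\<dots> = cprod (mat_adjoint A *\<^sub>v x) y"
    using assms by (simp add: scalar_prod_def sum_distrib_left sum_distrib_right ac_simps row_mat_adjoint atLeast0LessThan)
  finally show ?thesis .
qed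

lemma cprod_commute: "dim_vec x = dim_vec y \<Longrightarrow> cprod x y = cnj (cprod y x)"
  by (simp add: scalar_prod_def mult.commute)

lemma cprod_self: "cprod x x = of_real (\<Sum>i<dim_vec x. (cmod (x $ i))\<^sup>2)"
  unfolding scalar_prod_def by (simp add: atLeast0LessThan complex_norm_square mult.commute del: of_real_power)

lemma cprod_self_ge_0: "0 \<le> Re (cprod x x)"
  unfolding cprod_self by (auto intro: sum_nonneg)

lemma cprod_self_real: "cprod x x = of_real (Re (cprod x x))"
  unfolding cprod_self by simp

lemma cprod_self_eq_0: "cprod x x = 0 \<longleftrightarrow> x = 0\<^sub>v (dim_vec x)"
proof -
  have "cprod x x = 0 \<longleftrightarrow> (\<Sum>i<dim_vec x. (cmod (x $ i))\<^sup>2) = 0"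
    unfolding cprod_self by (metis of_real_eq_0_iff)
  also have "\<dots> \<longleftrightarrow> (\<forall>i<dim_vec x. x $ i = 0)"
    by (subst sum_nonneg_eq_0_iff) auto
  also have "\<dots> \<longleftrightarrow> x = 0\<^sub>v (dim_vec x)" by (metis eq_vecI index_zero_vec)
  finally show ?thesis .
qed

lemma cprod_self_pos: "x \<noteq> 0\<^sub>v (dim_vec x) \<Longrightarrow> 0 < Re (cprod x x)"
  using cprod_self_eq_0[of x] cprod_self_ge_0[of x] cprod_self_real[of x]
  by (metis less_eq_real_def of_real_0)

lemma cprod_smult: "dim_vec x = dim_vec y \<Longrightarrow> cprod (c \<cdot>\<^sub>v x) (d \<cdot>\<^sub>v y) = cnj c * d * cprod x y"
  unfolding scalar_prod_def by (simp add: sum_distrib_left ac_simps)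

lemma unit_multiple:
  assumes "x \<noteq> 0\<^sub>v (dim_vec x)"
  obtains c where "c \<noteq> 0" "cprod (c \<cdot>\<^sub>v x) (c \<cdot>\<^sub>v x) = 1"
proof -
  define r where "r = Re (cprod x x)"
  have r: "0 < r" "cprod x x = of_real r"
    unfolding r_def using cprod_self_pos[OF assms] cprod_self_real by auto
  define c where "c = complex_of_real (1 / sqrt r)"
  have "cprod (c \<cdot>\<^sub>v x) (c \<cdot>\<^sub>v x) = of_real ((1 / sqrt r)\<^sup>2 * r)"
    unfolding cprod_smult[OF refl] r(2) c_def
    by (simp only: complex_cnj_complex_of_real of_real_mult power2_eq_square)
  also have "\<dots> = 1" using r(1) by (simp add: power_divide)
  finally show ?thesis using that[of c] r(1) by (auto simp: c_def)
qed

text \<open>\<open>T\<close> may be rectangular: the identity serves compressions, among them the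
  passage from \<open>C\<close> to its Schur complement, as well as congruences.\<close>

lemma qf_congruence:
  assumes "dim_row T = dim_row B" "dim_col B = dim_row T" "dim_vec x = dim_col T"
  shows "qf (mat_adjoint T * B * T) x = qf B (T *\<^sub>v x)"
  unfolding qf_def using assms
  by (simp add: mult_vec_assoc_dim mult_assoc_dim cprod_adjoint[of x "mat_adjoint T"])

lemma qf_smult: "dim_vec x = dim_row A \<Longrightarrow> dim_col A = dim_row A \<Longrightarrow> qf (c \<cdot>\<^sub>m A) x = c * qf A x"
  unfolding qf_def by (simp add: scalar_prod_def sum_distrib_left ac_simps)

lemma qf_zero [simp]: "qf A (0\<^sub>v (dim_col A)) = 0"
  unfolding qf_def by (simp add: scalar_prod_def)

lemma qf_scale: "dim_vec x = dim_row A \<Longrightarrow> dim_col A = dim_row A \<Longrightarrow> qf A (c \<cdot>\<^sub>v x) = of_real ((cmod c)\<^sup>2) * qf A x"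
  unfolding qf_def complex_norm_square by (simp add: scalar_prod_def sum_distrib_left ac_simps)

lemma mult_mat_vec_scale: "dim_vec v = dim_col A \<Longrightarrow> A *\<^sub>v (c \<cdot>\<^sub>v v) = c \<cdot>\<^sub>v (A *\<^sub>v (v :: complex vec))"
  by (rule eq_vecI) (auto simp: scalar_prod_def sum_distrib_left ac_simps)

lemma mult_mat_vec_add: "dim_vec v = dim_col A \<Longrightarrow> dim_vec w = dim_col A \<Longrightarrow>
    A *\<^sub>v (v + w) = A *\<^sub>v v + A *\<^sub>v (w :: complex vec)"
  by (rule eq_vecI) (auto simp: scalar_prod_def sum.distrib algebra_simps)

lemma mult_mat_vec_zero [simp]: "A *\<^sub>v 0\<^sub>v (dim_col A) = 0\<^sub>v (dim_row (A :: complex mat))"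
  by (rule eq_vecI) auto

section \<open>Null vectors and inverses\<close>

lemma wide_matrix_kernel:
  fixes L :: "complex mat"
  assumes L: "L \<in> carrier_mat m p" and "m < p"
  obtains y where "y \<in> carrier_vec p" "y \<noteq> 0\<^sub>v p" "L *\<^sub>v y = 0\<^sub>v m"
proof -
  \<comment> \<open>Zero rows fill \<open>L\<close> up to a square matrix. Row \<open>m\<close> is
    one of them because \<open>m < p\<close>, so the unit vector there is a null vector of the
    transpose and the determinant vanishes.\<close>
  define M where "M = mat p p (\<lambda>(i,j). if i < m then L $$ (i,j) else 0)"
  have M: "M \<in> carrier_mat p p" by (simp add: M_def)
  have "transpose_mat M *\<^sub>v unit_vec p m = 0\<^sub>v p"
    using \<open>m < p\<close> L by (intro eq_vecI) (auto simp: M_def)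
  moreover have "unit_vec p m \<noteq> (0\<^sub>v p :: complex vec)"
    using \<open>m < p\<close> by simp
  ultimately have "det (transpose_mat M) = 0"
    using det_0_iff_vec_prod_zero_field[of "transpose_mat M" p] M
    by (metis transpose_carrier_mat unit_vec_carrier)
  then have "det M = 0" using det_transpose[OF M] by simp
  then obtain y where y: "y \<in> carrier_vec p" "y \<noteq> 0\<^sub>v p" "M *\<^sub>v y = 0\<^sub>v p"
    using det_0_iff_vec_prod_zero_field[OF M] by auto
  have "(L *\<^sub>v y) $ i = 0" if "i < m" for i
  proof -
    have "row M i = row L i" using that \<open>m < p\<close> L by (intro eq_vecI) (auto simp: M_def)
    then have "(L *\<^sub>v y) $ i = (M *\<^sub>v y) $ i" using that \<open>m < p\<close> L M by simp
    then show ?thesis using y(3) that \<open>m < p\<close> by simp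
  qed
  then have "L *\<^sub>v y = 0\<^sub>v m" using L by (intro eq_vecI) auto
  then show ?thesis using that y by blast
qed

lemma invertible_inverse:
  assumes "invertible_mat (T :: complex mat)" "T \<in> carrier_mat n n"
  obtains R where "R \<in> carrier_mat n n" "T * R = 1\<^sub>m n" "R * T = 1\<^sub>m n"
proof -
  obtain R where R: "inverts_mat T R" "inverts_mat R T" using assms unfolding invertible_mat_def by auto
  then have 1: "T * R = 1\<^sub>m n" "R * T = 1\<^sub>m (dim_row R)" unfolding inverts_mat_def using assms by auto
  have "dim_col (T * R) = n" "dim_col (R * T) = dim_row R" using 1 by auto
  then have "R \<in> carrier_mat n n" using assms by auto
  then show ?thesis using that 1 by auto
qed

lemma invertible_matI:
  assumes "T \<in> carrier_mat n n" "R \<in> carrier_mat n n" "R * T = (1\<^sub>m n :: complex mat)"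
  shows "invertible_mat T"
  using assms mat_mult_left_right_inverse[OF assms(2,1,3)]
  unfolding invertible_mat_def inverts_mat_def by auto

lemma injective_square_inverse:
  assumes T: "T \<in> carrier_mat n n" and inj: "\<And>x. x \<in> carrier_vec n \<Longrightarrow> T *\<^sub>v x = 0\<^sub>v n \<Longrightarrow> x = (0\<^sub>v n :: complex vec)"
  obtains R where "R \<in> carrier_mat n n" "T * R = 1\<^sub>m n" "R * T = 1\<^sub>m n"
proof -
  have "det T \<noteq> 0" using det_0_iff_vec_prod_zero_field[OF T] inj by auto
  then show ?thesis using det_non_zero_imp_unit[OF T] that
    unfolding Units_def ring_mat_def by auto
qed

section \<open>Matrices side by side and orthonormal extension\<close>

definition hcat :: "complex mat \<Rightarrow> complex mat \<Rightarrow> complex mat" where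
  "hcat X Z = mat (dim_row X) (dim_col X + dim_col Z)
     (\<lambda>(i,j). if j < dim_col X then X $$ (i,j) else Z $$ (i, j - dim_col X))"

lemma hcat_carrier [simp]: "X \<in> carrier_mat n a \<Longrightarrow> Z \<in> carrier_mat n b \<Longrightarrow> hcat X Z \<in> carrier_mat n (a + b)"
  unfolding hcat_def by auto

lemma dim_hcat [simp]: "dim_row (hcat X Z) = dim_row X" "dim_col (hcat X Z) = dim_col X + dim_col Z"
  unfolding hcat_def by auto

lemma col_hcat:
  assumes "dim_row Z = dim_row X" "j < dim_col X + dim_col Z"
  shows "col (hcat X Z) j = (if j < dim_col X then col X j else col Z (j - dim_col X))"
  using assms by (intro eq_vecI) (auto simp: hcat_def)

lemma mult_hcat: "dim_row Z = dim_row X \<Longrightarrow> A * hcat X Z = hcat (A * X) (A * Z)"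
  by (rule eq_matI) (auto simp: col_hcat, auto simp: hcat_def)

lemma adjoint_hcat_mult_hcat:
  assumes "dim_row Z = dim_row X" "dim_row Z' = dim_row X'"
  shows "mat_adjoint (hcat X Z) * hcat X' Z' = four_block_mat
     (mat_adjoint X * X') (mat_adjoint X * Z') (mat_adjoint Z * X') (mat_adjoint Z * Z')"
  using assms by (intro eq_matI) (auto simp: row_mat_adjoint col_hcat)

lemma hcat_mult_append:
  assumes "dim_row Z = dim_row X" "dim_vec a = dim_col X" "dim_vec b = dim_col Z"
  shows "hcat X Z *\<^sub>v (a @\<^sub>v b) = X *\<^sub>v a + Z *\<^sub>v b"
proof (rule eq_vecI)
  fix i assume i: "i < dim_vec (X *\<^sub>v a + Z *\<^sub>v b)"
  have "row (hcat X Z) i = row X i @\<^sub>v row Z i"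
    using i assms by (intro eq_vecI) (auto simp: hcat_def)
  moreover have "(row X i @\<^sub>v row Z i) \<bullet> (a @\<^sub>v b) = row X i \<bullet> a + row Z i \<bullet> b"
    by (rule scalar_prod_append) (use assms in \<open>auto intro: carrier_vecI\<close>)
  ultimately show "(hcat X Z *\<^sub>v (a @\<^sub>v b)) $ i = (X *\<^sub>v a + Z *\<^sub>v b) $ i"
    using i assms by simp
qed (use assms in auto)

lemma split_vec:
  assumes "v \<in> carrier_vec (a + b)"
  obtains x y where "x \<in> carrier_vec a" "y \<in> carrier_vec b" "v = x @\<^sub>v y"
  using assms vec_first_last_append[OF assms] vec_first_carrier vec_last_carrier by metis

text \<open>Gram-Schmidt without projections: a vector orthogonal to all columns of \<open>Y\<close>
  and \<open>Z\<close> is a null vector of a matrix with fewer rows than columns, and only has to be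
  normalized.\<close>

lemma orthonormal_complement:
  assumes Y: "(Y :: complex mat) \<in> carrier_mat n m" and "m + j \<le> n"
  shows "\<exists>Z \<in> carrier_mat n j. mat_adjoint Y * Z = 0\<^sub>m m j \<and> mat_adjoint Z * Z = 1\<^sub>m j"
  using assms(2)
proof (induction j)
  case 0
  show ?case by (rule bexI[of _ "0\<^sub>m n 0"]) (use Y in \<open>auto\<close>)
next
  case (Suc j)
  then obtain Z where Z: "Z \<in> carrier_mat n j" "mat_adjoint Y * Z = 0\<^sub>m m j" "mat_adjoint Z * Z = 1\<^sub>m j"
    by auto
  have "mat_adjoint (hcat Y Z) \<in> carrier_mat (m + j) n" using Y Z by simp
  then obtain w where w: "w \<in> carrier_vec n" "w \<noteq> 0\<^sub>v n" "mat_adjoint (hcat Y Z) *\<^sub>v w = 0\<^sub>v (m + j)"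
    using wide_matrix_kernel[of "mat_adjoint (hcat Y Z)" "m+j" n] Suc by auto
  obtain c where c: "cprod (c \<cdot>\<^sub>v w) (c \<cdot>\<^sub>v w) = 1" using unit_multiple[of w] w by auto
  define W where "W = mat_of_cols n [c \<cdot>\<^sub>v w]"
  have W: "W \<in> carrier_mat n 1" unfolding W_def by auto
  have colW: "col W 0 = c \<cdot>\<^sub>v w" unfolding W_def using w by simp
  have orth: "cprod (col (hcat Y Z) i) w = 0" if "i < m + j" for i
  proof -
    have "(mat_adjoint (hcat Y Z) *\<^sub>v w) $ i = cprod (col (hcat Y Z) i) w"
      using that Y Z by (simp add: row_mat_adjoint)
    then show ?thesis using w that by simp
  qed
  have YW: "mat_adjoint Y * W = 0\<^sub>m m 1"
  proof (rule eq_matI)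
    fix i k assume "i < dim_row (0\<^sub>m m 1 :: complex mat)" "k < dim_col (0\<^sub>m m 1 :: complex mat)"
    then show "(mat_adjoint Y * W) $$ (i, k) = 0\<^sub>m m 1 $$ (i, k)"
      using orth[of i] Y Z W w by (simp add: col_hcat row_mat_adjoint colW)
  qed (use Y W in auto)
  have ZW: "mat_adjoint Z * W = 0\<^sub>m j 1"
  proof (rule eq_matI)
    fix i k assume "i < dim_row (0\<^sub>m j 1 :: complex mat)" "k < dim_col (0\<^sub>m j 1 :: complex mat)"
    then show "(mat_adjoint Z * W) $$ (i, k) = 0\<^sub>m j 1 $$ (i, k)"
      using orth[of "m + i"] Y Z W w by (simp add: col_hcat row_mat_adjoint colW)
  qed (use Z W in auto)
  have "mat_adjoint W * W = 1\<^sub>m 1"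
    using W w c by (intro eq_matI) (auto simp: row_mat_adjoint colW)
  moreover have "mat_adjoint W * Z = 0\<^sub>m 1 j"
    using ZW W Z mat_adjoint_mult[of "mat_adjoint Z" W] by auto
  ultimately have "mat_adjoint (hcat Z W) * hcat Z W = 1\<^sub>m (Suc j)"
    using Z W ZW by (simp add: adjoint_hcat_mult_hcat)
  moreover have "mat_adjoint Y * hcat Z W = 0\<^sub>m m (Suc j)"
    using Z W YW by (simp add: mult_hcat) (auto simp: hcat_def)
  ultimately show ?case using Z W by (intro bexI[of _ "hcat Z W"]) auto
qed

section \<open>Block diagonal matrices and reduction by the kernel\<close>

definition bdiag :: "complex mat \<Rightarrow> complex mat \<Rightarrow> complex mat" where
  "bdiag A B = four_block_mat A (0\<^sub>m (dim_row A) (dim_col B)) (0\<^sub>m (dim_row B) (dim_col A)) B"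

lemma dim_bdiag [simp]:
  "dim_row (bdiag A B) = dim_row A + dim_row B" "dim_col (bdiag A B) = dim_col A + dim_col B"
  unfolding bdiag_def by auto

lemma bdiag_carrier [simp]:
  "A \<in> carrier_mat a b \<Longrightarrow> B \<in> carrier_mat c d \<Longrightarrow> bdiag A B \<in> carrier_mat (a + c) (b + d)"
  by (intro carrier_matI) auto

lemma diag_block_mat_Cons_bdiag: "diag_block_mat (A # As) = bdiag A (diag_block_mat As)"
  unfolding bdiag_def by (simp add: Let_def)

lemma diag_block_mat_append_bdiag:
  "diag_block_mat (As @ Bs) = bdiag (diag_block_mat As) (diag_block_mat Bs)"
  unfolding bdiag_def diag_block_mat_append Let_def ..

lemma bdiag_empty [simp]: "bdiag (0\<^sub>m 0 0) A = A" "bdiag A (0\<^sub>m 0 0) = A"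
  unfolding bdiag_def by (rule eq_matI; auto)+

lemma bdiag_mult:
  assumes "dim_col A = dim_row A'" "dim_col B = dim_row B'"
  shows "bdiag A B * bdiag A' B' = bdiag (A * A') (B * B')"
  unfolding bdiag_def using assms
  by (subst mult_four_block_mat[of A "dim_row A" "dim_col A" _ "dim_col B" _ "dim_row B" _ _ "dim_col A'" _ "dim_col B'"]) auto

lemma mat_adjoint_bdiag: "mat_adjoint (bdiag A B) = bdiag (mat_adjoint A) (mat_adjoint B)"
  unfolding bdiag_def
  by (subst mat_adjoint_four_block[of _ "dim_row A" "dim_col A" _ "dim_col B" _ "dim_row B"]) auto

lemma bdiag_one: "bdiag (1\<^sub>m a) (1\<^sub>m b) = 1\<^sub>m (a + b)"
  unfolding bdiag_def by simp

lemma bdiag_mult_append: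
  assumes "dim_vec a = dim_col A" "dim_vec b = dim_col B"
  shows "bdiag A B *\<^sub>v (a @\<^sub>v b) = (A *\<^sub>v a) @\<^sub>v (B *\<^sub>v b)"
proof -
  have "a \<in> carrier_vec (dim_col A)" "b \<in> carrier_vec (dim_col B)" using assms by (auto intro: carrier_vecI)
  then show ?thesis
    unfolding bdiag_def
    by (subst four_block_mat_mult_vec[of A "dim_row A" "dim_col A" _ "dim_col B" _ "dim_row B"]) auto
qed

lemma cprod_append:
  assumes "dim_vec a = dim_vec c" "dim_vec b = dim_vec d"
  shows "cprod (a @\<^sub>v b) (c @\<^sub>v d) = cprod a c + cprod b d"
proof -
  have "conjugate (a @\<^sub>v b) = conjugate a @\<^sub>v conjugate b" by (rule eq_vecI) auto
  moreover have "(conjugate a @\<^sub>v conjugate b) \<bullet> (c @\<^sub>v d) = cprod a c + cprod b d"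
    by (rule scalar_prod_append[of _ "dim_vec c" _ "dim_vec d"]) (use assms in \<open>auto intro: carrier_vecI\<close>)
  ultimately show ?thesis by simp
qed

lemma qf_bdiag:
  assumes "dim_vec a = dim_col A" "dim_vec b = dim_col B" "dim_row A = dim_col A" "dim_row B = dim_col B"
  shows "qf (bdiag A B) (a @\<^sub>v b) = qf A a + qf B b"
  unfolding qf_def using assms by (simp add: bdiag_mult_append cprod_append)

lemma append_vec_zero: "0\<^sub>v a @\<^sub>v 0\<^sub>v b = 0\<^sub>v (a + b)"
  by (rule eq_vecI) auto

lemma append_vec_eq_zero:
  assumes "dim_vec x = a" "dim_vec y = b"
  shows "x @\<^sub>v y = 0\<^sub>v (a + b) \<longleftrightarrow> x = 0\<^sub>v a \<and> y = 0\<^sub>v b"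
  unfolding append_vec_zero[symmetric]
  by (rule append_vec_eq[of _ a]) (use assms in \<open>auto intro: carrier_vecI\<close>)

text \<open>The diagonal entries of the Gram matrix are the squared norms of the columns.\<close>

lemma adjoint_mult_self_eq_0:
  fixes A :: "complex mat"
  assumes "mat_adjoint A * A = 0\<^sub>m (dim_col A) (dim_col A)"
  shows "A = 0\<^sub>m (dim_row A) (dim_col A)"
proof (rule eq_matI)
  fix i j assume "i < dim_row (0\<^sub>m (dim_row A) (dim_col A) :: complex mat)" "j < dim_col (0\<^sub>m (dim_row A) (dim_col A) :: complex mat)"
  then have ij: "i < dim_row A" "j < dim_col A" by auto
  have "(mat_adjoint A * A) $$ (j, j) = cprod (col A j) (col A j)" using ij by (simp add: row_mat_adjoint)
  then have "cprod (col A j) (col A j) = 0" using assms ij by simp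
  then have "col A j = 0\<^sub>v (dim_row A)" using cprod_self_eq_0[of "col A j"] by simp
  then have "col A j $ i = 0" using ij by simp
  then show "A $$ (i, j) = 0\<^sub>m (dim_row A) (dim_col A) $$ (i, j)" using ij by simp
qed auto

text \<open>\<open>X\<close> is a maximal orthonormal system in the kernel and \<open>Z\<close>
  completes it to a unitary matrix. A null vector of the compressed block would yield one more unit
  null vector of \<open>A\<close> orthogonal to \<open>X\<close>, against maximality. The kernel
  hypothesis is immediate for Hermitian matrices and follows from semidefiniteness for accretive
  ones.\<close>

lemma kernel_decomposition:
  assumes A: "A \<in> carrier_mat n n"
    and ker: "\<And>x. x \<in> carrier_vec n \<Longrightarrow> A *\<^sub>v x = 0\<^sub>v n \<Longrightarrow> mat_adjoint A *\<^sub>v x = 0\<^sub>v n"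
  obtains m X Z where "m \<le> n" "X \<in> carrier_mat n m" "Z \<in> carrier_mat n (n - m)"
    "mat_adjoint X * X = 1\<^sub>m m" "mat_adjoint X * Z = 0\<^sub>m m (n - m)" "mat_adjoint Z * X = 0\<^sub>m (n - m) m"
    "mat_adjoint Z * Z = 1\<^sub>m (n - m)"
    "A * X = 0\<^sub>m n m"
    "mat_adjoint (hcat X Z) * hcat X Z = 1\<^sub>m n" "hcat X Z * mat_adjoint (hcat X Z) = 1\<^sub>m n"
    "A = hcat X Z * bdiag (0\<^sub>m m m) (mat_adjoint Z * A * Z) * mat_adjoint (hcat X Z)"
    "\<And>c. c \<in> carrier_vec (n - m) \<Longrightarrow> (mat_adjoint Z * A * Z) *\<^sub>v c = 0\<^sub>v (n - m) \<Longrightarrow> c = 0\<^sub>v (n - m)"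
proof -
  define P where "P = (\<lambda>m. \<exists>X \<in> carrier_mat n m. mat_adjoint X * X = 1\<^sub>m m \<and> A * X = 0\<^sub>m n m)"
  have bound: "m \<le> n" if Pm: "P m" for m
  proof (rule ccontr)
    obtain X :: "complex mat" where X: "X \<in> carrier_mat n m" "mat_adjoint X * X = 1\<^sub>m m"
      using Pm unfolding P_def by blast
    assume "\<not> m \<le> n"
    then obtain y where y: "y \<in> carrier_vec m" "y \<noteq> 0\<^sub>v m" "X *\<^sub>v y = 0\<^sub>v n" using wide_matrix_kernel[OF X(1)] by auto
    have "y = (mat_adjoint X * X) *\<^sub>v y" using X y by simp
    also have "\<dots> = 0\<^sub>v m" using X(1) y(1,3) mult_mat_vec_zero[of "mat_adjoint X"] by (simp add: mult_vec_assoc_dim)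
    finally show False using y by simp
  qed
  have "P 0" unfolding P_def by (rule bexI[of _ "0\<^sub>m n 0"]) (use A in auto)
  then obtain m where m: "P m" "\<And>m'. P m' \<Longrightarrow> m' \<le> m"
    using Nat.ex_has_greatest_nat[of P 0 n] bound by blast
  from m(1) obtain X where X: "X \<in> carrier_mat n m" "mat_adjoint X * X = 1\<^sub>m m" "A * X = 0\<^sub>m n m"
    unfolding P_def by auto
  have mn: "m \<le> n" using bound[OF m(1)] .
  obtain Z where Z: "Z \<in> carrier_mat n (n - m)" "mat_adjoint X * Z = 0\<^sub>m m (n - m)" "mat_adjoint Z * Z = 1\<^sub>m (n - m)"
    using orthonormal_complement[OF X(1), of "n - m"] mn by auto
  have ZX: "mat_adjoint Z * X = 0\<^sub>m (n - m) m"
    using mat_adjoint_mult[of "mat_adjoint X" Z] X Z by simp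
  define U where "U = hcat X Z"
  have U: "U \<in> carrier_mat n n" using hcat_carrier[OF X(1) Z(1)] mn by (simp add: U_def)
  have UU: "mat_adjoint U * U = 1\<^sub>m n"
    unfolding U_def using X Z ZX mn by (simp add: adjoint_hcat_mult_hcat)
  have UU': "U * mat_adjoint U = 1\<^sub>m n"
    by (rule mat_mult_left_right_inverse[OF _ U UU]) (use U in simp)
  \<comment> \<open>In the basis \<open>hcat X Z\<close> the left block column vanishes by the
    choice of \<open>X\<close>. The kernel hypothesis is what removes the upper right block as
    well.\<close>
  have AX: "mat_adjoint A * X = 0\<^sub>m n m"
  proof (rule eq_matI)
    fix i j assume "i < dim_row (0\<^sub>m n m :: complex mat)" "j < dim_col (0\<^sub>m n m :: complex mat)"
    then have ij: "i < n" "j < m" by auto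
    have "A *\<^sub>v col X j = col (A * X) j" using A X(1) ij by (intro eq_vecI) auto
    also have "\<dots> = 0\<^sub>v n" unfolding X(3) using ij by (intro eq_vecI) auto
    finally have "mat_adjoint A *\<^sub>v col X j = 0\<^sub>v n" using ker X by auto
    then have "(mat_adjoint A *\<^sub>v col X j) $ i = 0" using ij by simp
    then show "(mat_adjoint A * X) $$ (i, j) = 0\<^sub>m n m $$ (i, j)" using ij A X(1) by simp
  qed (use A X in auto)
  have XA: "mat_adjoint X * A = 0\<^sub>m m n"
    using mat_adjoint_mult[of "mat_adjoint A" X] A X AX by simp
  define B where "B = mat_adjoint Z * A * Z"
  have B: "B \<in> carrier_mat (n - m) (n - m)" unfolding B_def using Z A by (intro carrier_matI) auto
  have AU: "A * U = hcat (0\<^sub>m n m) (A * Z)" unfolding U_def using X Z A by (simp add: mult_hcat)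
  have "mat_adjoint U * (A * U) = bdiag (0\<^sub>m m m) B"
    unfolding AU unfolding U_def bdiag_def B_def using X Z A XA
    by (simp add: adjoint_hcat_mult_hcat mult_assoc_dim[symmetric])
  then have "U * bdiag (0\<^sub>m m m) B * mat_adjoint U = U * (mat_adjoint U * (A * U)) * mat_adjoint U" by simp
  also have "\<dots> = (U * mat_adjoint U) * A * (U * mat_adjoint U)"
    using U A by (simp add: mult_assoc_dim)
  also have "\<dots> = A" using A by (simp add: UU')
  finally have decomp: "A = U * bdiag (0\<^sub>m m m) B * mat_adjoint U" by simp
  have inj: "c = 0\<^sub>v (n - m)" if c: "c \<in> carrier_vec (n - m)" "B *\<^sub>v c = 0\<^sub>v (n - m)" for c
  proof (rule ccontr)
    assume "c \<noteq> 0\<^sub>v (n - m)"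
    then obtain d where d: "d \<noteq> 0" "cprod (d \<cdot>\<^sub>v c) (d \<cdot>\<^sub>v c) = 1" using unit_multiple[of c] c by auto
    define w where "w = Z *\<^sub>v (d \<cdot>\<^sub>v c)"
    have dc: "d \<cdot>\<^sub>v c \<in> carrier_vec (n - m)" using c by simp
    have w: "w \<in> carrier_vec n" unfolding w_def using Z c by simp
    have Zw: "mat_adjoint Z *\<^sub>v w = d \<cdot>\<^sub>v c"
      unfolding w_def using Z(1,3) dc c(1) by (simp add: mult_vec_assoc_dim[symmetric])
    have "A *\<^sub>v w = U *\<^sub>v (bdiag (0\<^sub>m m m) B *\<^sub>v (mat_adjoint U *\<^sub>v w))"
      by (subst decomp) (use U A B mn w in \<open>simp add: mult_vec_assoc_dim mult_assoc_dim\<close>)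
    also have "mat_adjoint U *\<^sub>v w = 0\<^sub>v m @\<^sub>v (d \<cdot>\<^sub>v c)"
    proof -
      have "U *\<^sub>v (0\<^sub>v m @\<^sub>v (d \<cdot>\<^sub>v c)) = w"
        unfolding U_def w_def using X(1) Z(1) c(1) mult_mat_vec_zero[of X] by (subst hcat_mult_append) auto
      then have "mat_adjoint U *\<^sub>v w = (mat_adjoint U * U) *\<^sub>v (0\<^sub>v m @\<^sub>v (d \<cdot>\<^sub>v c))"
        using U c mn by (subst mult_vec_assoc_dim) auto
      moreover have "0\<^sub>v m @\<^sub>v (d \<cdot>\<^sub>v c) \<in> carrier_vec n" using c mn by (intro carrier_vecI) auto
      ultimately show ?thesis using UU by simp
    qed
    also have "bdiag (0\<^sub>m m m) B *\<^sub>v (0\<^sub>v m @\<^sub>v (d \<cdot>\<^sub>v c)) = 0\<^sub>v m @\<^sub>v 0\<^sub>v (n - m)"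
    proof -
      have "B *\<^sub>v (d \<cdot>\<^sub>v c) = d \<cdot>\<^sub>v 0\<^sub>v (n - m)"
        using B c by (subst mult_mat_vec_scale) auto
      then show ?thesis using B c by (subst bdiag_mult_append) auto
    qed
    also have "U *\<^sub>v (0\<^sub>v m @\<^sub>v 0\<^sub>v (n - m)) = 0\<^sub>v n"
      using U mn mult_mat_vec_zero[of U] by (simp add: append_vec_zero)
    finally have Aw: "A *\<^sub>v w = 0\<^sub>v n" .
    define W where "W = mat_of_cols n [w]"
    have W: "W \<in> carrier_mat n 1" "col W 0 = w" unfolding W_def using w by auto
    have "mat_adjoint W * W = 1\<^sub>m 1"
    proof (rule eq_matI)
      fix i j assume ij: "i < dim_row (1\<^sub>m 1 :: complex mat)" "j < dim_col (1\<^sub>m 1 :: complex mat)"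
      have "cprod w w = cprod (mat_adjoint Z *\<^sub>v w) (d \<cdot>\<^sub>v c)"
        using cprod_adjoint[of w Z "d \<cdot>\<^sub>v c"] Z(1) c(1) w by (simp add: w_def)
      then show "(mat_adjoint W * W) $$ (i, j) = 1\<^sub>m 1 $$ (i, j)"
        using ij W Zw d(2) by (simp add: row_mat_adjoint)
    qed (use W in auto)
    moreover have "mat_adjoint X * W = 0\<^sub>m m 1"
    proof (rule eq_matI)
      fix i j assume ij: "i < dim_row (0\<^sub>m m 1 :: complex mat)" "j < dim_col (0\<^sub>m m 1 :: complex mat)"
      have "mat_adjoint X *\<^sub>v w = (mat_adjoint X * Z) *\<^sub>v (d \<cdot>\<^sub>v c)"
        unfolding w_def using X Z c by (subst mult_vec_assoc_dim) auto
      also have "\<dots> = 0\<^sub>v m" using Z(2) c by (intro eq_vecI) auto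
      finally have "(mat_adjoint X *\<^sub>v w) $ i = 0" using ij by simp
      then show "(mat_adjoint X * W) $$ (i, j) = 0\<^sub>m m 1 $$ (i, j)" using ij W X by simp
    qed (use X W in auto)
    moreover have "mat_adjoint W * X = 0\<^sub>m 1 m"
      using mat_adjoint_mult[of "mat_adjoint X" W] X(1) W(1) calculation(2) by simp
    ultimately have "mat_adjoint (hcat X W) * hcat X W = 1\<^sub>m (m + 1)"
      using X W by (simp add: adjoint_hcat_mult_hcat)
    moreover have "A * W = 0\<^sub>m n 1"
    proof (rule eq_matI)
      fix i j assume ij: "i < dim_row (0\<^sub>m n 1 :: complex mat)" "j < dim_col (0\<^sub>m n 1 :: complex mat)"
      have "(A *\<^sub>v w) $ i = 0" using Aw ij by simp
      then show "(A * W) $$ (i, j) = 0\<^sub>m n 1 $$ (i, j)" using ij W A by simp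
    qed (use A W in auto)
    then have "A * hcat X W = 0\<^sub>m n (m + 1)"
      using X W by (simp add: mult_hcat) (auto simp: hcat_def)
    ultimately have "P (m + 1)" unfolding P_def using hcat_carrier[OF X(1) W(1)] by blast
    then show False using m(2) by fastforce
  qed
  show ?thesis
    using that[OF mn X(1) Z(1) X(2) Z(2) ZX Z(3) X(3)] UU UU' decomp inj unfolding U_def B_def by blast
qed

section \<open>Moore-Penrose inverse and Schur complement\<close>

lemma moore_penrose_inverse_exists:
  fixes A :: "complex mat"
  assumes A: "A \<in> carrier_mat k l"
  shows "\<exists>M \<in> carrier_mat l k. A * M * A = A \<and> M * A * M = M \<and>
    mat_adjoint (A * M) = A * M \<and> mat_adjoint (M * A) = M * A"
proof -
  \<comment> \<open>The Gram matrix is Hermitian and has the same kernel as \<open>A\<close>. The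
    inverse sought is the pseudo-inverse of \<open>G\<close> times the adjoint of
    \<open>A\<close>.\<close>
  define G where "G = mat_adjoint A * A"
  have G: "G \<in> carrier_mat l l" using A unfolding G_def by (intro carrier_matI) auto
  have adjG: "mat_adjoint G = G" unfolding G_def using A by (simp add: mat_adjoint_mult)
  obtain m X Z where Z: "m \<le> l" "X \<in> carrier_mat l m" "Z \<in> carrier_mat l (l - m)"
    "mat_adjoint Z * X = 0\<^sub>m (l - m) m"
    "mat_adjoint Z * Z = 1\<^sub>m (l - m)"
    "G * X = 0\<^sub>m l m" 
    "hcat X Z * mat_adjoint (hcat X Z) = 1\<^sub>m l"
    "\<And>c. c \<in> carrier_vec (l - m) \<Longrightarrow> (mat_adjoint Z * G * Z) *\<^sub>v c = 0\<^sub>v (l - m) \<Longrightarrow> c = 0\<^sub>v (l - m)"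
    using kernel_decomposition[OF G] adjG by metis
  define B where "B = mat_adjoint Z * G * Z"
  have B: "B \<in> carrier_mat (l - m) (l - m)" unfolding B_def using Z(1-3) G by (intro carrier_matI) auto
  have adjB: "mat_adjoint B = B" unfolding B_def using Z(3) G adjG by (simp add: mat_adjoint_mult mult_assoc_dim)
  obtain R where R: "R \<in> carrier_mat (l - m) (l - m)" "B * R = 1\<^sub>m (l - m)" "R * B = 1\<^sub>m (l - m)"
    using injective_square_inverse[OF B] Z(8) unfolding B_def by blast
  have "mat_adjoint R = mat_adjoint R * (B * R)" using R by simp
  also have "\<dots> = mat_adjoint (B * R) * R" using R(1) B adjB by (simp add: mat_adjoint_mult mult_assoc_dim)
  also have "\<dots> = R" using R by simp
  finally have adjR: "mat_adjoint R = R" .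
  have "mat_adjoint (A * X) * (A * X) = mat_adjoint X * (G * X)"
    unfolding G_def using A Z(2) by (simp add: mat_adjoint_mult mult_assoc_dim)
  also have "\<dots> = 0\<^sub>m m m" using Z by simp
  finally have AX: "A * X = 0\<^sub>m k m" using adjoint_mult_self_eq_0[of "A * X"] A Z(2) by simp
  \<comment> \<open>The projection \<open>Z * mat_adjoint Z\<close> does not change
    \<open>A\<close>, since \<open>A\<close> kills \<open>X\<close>. This is checked on the columns
    of the unitary matrix, whose adjoint then cancels it.\<close>
  have "A * (Z * mat_adjoint Z) * hcat X Z = A * hcat X Z"
    using A Z(2-5) AX by (simp add: mult_hcat mult_assoc_dim)
  then have "A * (Z * mat_adjoint Z) * hcat X Z * mat_adjoint (hcat X Z) = A * hcat X Z * mat_adjoint (hcat X Z)" by simp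
  then have AZZ: "A * (Z * mat_adjoint Z) = A" using Z A by (simp add: mult_assoc_dim)
  \<comment> \<open>\<open>R\<close> inverts the nonsingular block of \<open>G\<close>, so
    \<open>Z * R * mat_adjoint Z\<close> is the pseudo-inverse of \<open>G\<close>.\<close>
  define M where "M = Z * R * mat_adjoint Z * mat_adjoint A"
  have M: "M \<in> carrier_mat l k" unfolding M_def using Z(1-3) R A by (intro carrier_matI) auto
  have ZG: "mat_adjoint Z * G = B * mat_adjoint Z"
  proof -
    have "mat_adjoint Z * G * hcat X Z = B * mat_adjoint Z * hcat X Z"
      using Z(2-6) G B by (simp add: mult_hcat mult_assoc_dim) (simp add: B_def mult_assoc_dim)
    then have "mat_adjoint Z * G * hcat X Z * mat_adjoint (hcat X Z) = B * mat_adjoint Z * hcat X Z * mat_adjoint (hcat X Z)" by simp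
    then show ?thesis using Z G B by (simp add: mult_assoc_dim)
  qed
  have "M * A = Z * R * (mat_adjoint Z * G)"
    unfolding M_def G_def using Z R A by (simp add: mult_assoc_dim)
  also have "\<dots> = Z * (R * B) * mat_adjoint Z" unfolding ZG using Z(3) R(1) B by (simp add: mult_assoc_dim)
  also have "\<dots> = Z * mat_adjoint Z" using R Z by simp
  finally have MA: "M * A = Z * mat_adjoint Z" .
  have "A * M * A = A" using A M MA AZZ by (simp add: mult_assoc_dim)
  moreover have "M * A * M = Z * (mat_adjoint Z * Z) * (R * mat_adjoint Z * mat_adjoint A)"
    unfolding MA unfolding M_def using Z(3) R(1) A by (simp add: mult_assoc_dim)
  then have "M * A * M = M"
    unfolding Z(5) M_def using Z(3) R(1) A by (simp add: mult_assoc_dim)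
  moreover have "mat_adjoint (M * A) = M * A" unfolding MA using Z(3) by (simp add: mat_adjoint_mult)
  moreover have "mat_adjoint (A * M) = A * M"
    unfolding M_def using A Z(3) R(1) adjR by (simp add: mat_adjoint_mult mult_assoc_dim)
  ultimately show ?thesis using M by blast
qed

text \<open>\<open>A * M\<close> and \<open>A * N\<close> are the orthogonal projection onto the
  range of \<open>A\<close>, and \<open>M * A\<close> and \<open>N * A\<close> are that onto the
  range of its adjoint. With the products equal, \<open>M = M * A * M\<close> turns into
  \<open>N * A * N = N\<close>.\<close>

lemma moore_penrose_inverse_unique:
  fixes A :: "complex mat"
  assumes A: "A \<in> carrier_mat k l" and M: "M \<in> carrier_mat l k" and N: "N \<in> carrier_mat l k"
    and 1: "A * M * A = A" "M * A * M = M" "mat_adjoint (A * M) = A * M" "mat_adjoint (M * A) = M * A"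
    and 2: "A * N * A = A" "N * A * N = N" "mat_adjoint (A * N) = A * N" "mat_adjoint (N * A) = N * A"
  shows "M = N"
proof -
  have "A * M = (A * N * A) * M" by (simp only: 2(1))
  also have "\<dots> = (A * N) * (A * M)" using A M N by (intro mult_assoc_dim) auto
  also have "\<dots> = mat_adjoint ((A * M) * (A * N))" using A M N 1 2 by (simp add: mat_adjoint_mult[of "A * M" "A * N"])
  also have "(A * M) * (A * N) = (A * M * A) * N" using A M N by (intro mult_assoc_dim[symmetric]) auto
  also have "mat_adjoint \<dots> = mat_adjoint (A * N)" by (simp only: 1(1))
  finally have AM: "A * M = A * N" using 2 by simp
  have "M * A = M * (A * N * A)" by (simp only: 2(1))
  also have "\<dots> = (M * A) * (N * A)" using A M N by (simp add: mult_assoc_dim)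
  also have "\<dots> = mat_adjoint ((N * A) * (M * A))" using A M N 1 2 by (simp add: mat_adjoint_mult[of "N * A" "M * A"])
  also have "(N * A) * (M * A) = N * (A * M * A)" using A M N by (simp add: mult_assoc_dim)
  also have "mat_adjoint \<dots> = mat_adjoint (N * A)" by (simp only: 1(1))
  finally have MA: "M * A = N * A" using 2 by simp
  have "M = M * A * M" by (simp only: 1(2))
  also have "\<dots> = M * (A * M)" using A M by (intro mult_assoc_dim) auto
  also have "\<dots> = M * A * N" unfolding AM using A M N by (intro mult_assoc_dim[symmetric]) auto
  also have "\<dots> = N" unfolding MA by (rule 2(2))
  finally show ?thesis .
qed

lemma moore_penrose:
  assumes A: "A \<in> carrier_mat k l"
  shows "moore_penrose A \<in> carrier_mat l k" "A * moore_penrose A * A = A"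
proof -
  define P where "P = (\<lambda>X. X \<in> carrier_mat (dim_col A) (dim_row A) \<and>
     A * X * A = A \<and> X * A * X = X \<and>
     mat_adjoint (A * X) = A * X \<and> mat_adjoint (X * A) = X * A)"
  obtain M where M: "P M" using moore_penrose_inverse_exists[OF A] A unfolding P_def by (metis carrier_matD)
  have "\<exists>!X. P X"
    by (rule ex1I[of P M, OF M]) (use M moore_penrose_inverse_unique[OF A] A in \<open>auto simp: P_def\<close>)
  then have "P (moore_penrose A)" unfolding moore_penrose_def P_def by (rule theI')
  then show "moore_penrose A \<in> carrier_mat l k" "A * moore_penrose A * A = A"
    using A unfolding P_def by auto
qed

lemma mat_range_subset_imp_factor:
  assumes A: "A \<in> carrier_mat k l" and B: "B \<in> carrier_mat k p" and sub: "mat_range B \<subseteq> mat_range A"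
  obtains Y where "Y \<in> carrier_mat l p" "B = A * Y"
proof -
  have "\<exists>x \<in> carrier_vec l. A *\<^sub>v x = col B j" if "j < p" for j
  proof -
    have "B *\<^sub>v unit_vec p j = col B j" using B that by (intro eq_vecI) auto
    then have "col B j \<in> mat_range B"
      using B that vec_space.col_space_eq[of B k p] by (auto intro!: bexI[of _ "unit_vec p j"])
    then show ?thesis using sub A vec_space.col_space_eq[of A k l] by auto
  qed
  then obtain f where f: "\<And>j. j < p \<Longrightarrow> f j \<in> carrier_vec l \<and> A *\<^sub>v f j = col B j" by metis
  define Y where "Y = mat_of_cols l (map f [0..<p])"
  have "Y \<in> carrier_mat l p" unfolding Y_def by (intro carrier_matI) auto
  moreover have "B = A * Y"
  proof (rule eq_matI)
    fix i j assume "i < dim_row (A * Y)" "j < dim_col (A * Y)"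
    then have ij: "i < k" "j < p" using A by (auto simp: Y_def)
    have "col Y j = f j" unfolding Y_def using ij f by simp
    then have "(A * Y) $$ (i, j) = (A *\<^sub>v f j) $ i" using ij A by (simp add: Y_def)
    then show "B $$ (i, j) = (A * Y) $$ (i, j)" using f ij B by simp
  qed (use A B in \<open>auto simp: Y_def\<close>)
  ultimately show ?thesis using that by blast
qed

text \<open>Eliminating the first block on the right only turns the Schur complement into a compression
  of \<open>C\<close>: with \<open>C12 = C11 * Y\<close> the columns of \<open>V = [-Y; I]\<close> are mapped by \<open>C\<close> to \<open>[0; S]\<close>.\<close>

lemma schur_complement_compression:
  assumes C11: "C11 \<in> carrier_mat k k"
    and C12: "C12 \<in> carrier_mat k p"
    and C21: "C21 \<in> carrier_mat p k"
    and C22: "C22 \<in> carrier_mat p p"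
    and range12: "mat_range C12 \<subseteq> mat_range C11"
    and range21: "mat_range (mat_adjoint C21) \<subseteq> mat_range (mat_adjoint C11)"
  obtains V where "V \<in> carrier_mat (k + p) p"
    "\<And>x. x \<in> carrier_vec p \<Longrightarrow> V *\<^sub>v x = 0\<^sub>v (k + p) \<Longrightarrow> x = 0\<^sub>v p"
    "schur_complement C11 C12 C21 C22 = mat_adjoint V * four_block_mat C11 C12 C21 C22 * V"
proof -
  obtain Y where Y: "Y \<in> carrier_mat k p" "C12 = C11 * Y"
    using mat_range_subset_imp_factor[OF C11 C12 range12] by blast
  have "mat_adjoint C11 \<in> carrier_mat k k" "mat_adjoint C21 \<in> carrier_mat k p" using C11 C21 by auto
  then obtain W where W: "W \<in> carrier_mat k p" "mat_adjoint C21 = mat_adjoint C11 * W"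
    using mat_range_subset_imp_factor[OF _ _ range21] by metis
  then have C21W: "C21 = mat_adjoint W * C11"
    using mat_adjoint_mult[of "mat_adjoint C11" W] C11 by (metis carrier_matD mat_adjoint_adjoint dim_mat_adjoint)
  note MP = moore_penrose[OF C11]
  \<comment> \<open>The two range conditions place the generalized inverse between two copies of
    \<open>C11\<close>, where the first Penrose condition absorbs it.\<close>
  have "C21 * moore_penrose C11 * C12 = mat_adjoint W * (C11 * moore_penrose C11 * C11) * Y"
    unfolding C21W Y(2) using MP(1) C11 W(1) Y(1) by (simp add: mult_assoc_dim)
  also have "\<dots> = C21 * Y" unfolding MP(2) C21W ..
  finally have S: "schur_complement C11 C12 C21 C22 = C22 - C21 * Y" unfolding schur_complement_def by simp
  let ?C = "four_block_mat C11 C12 C21 C22"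
  \<comment> \<open>The right block column has width 0; it makes the column of blocks
    \<open>- Y\<close> and the identity an instance of \<open>four_block_mat\<close>.\<close>
  define V where "V = four_block_mat (- Y) (0\<^sub>m k 0) (1\<^sub>m p) (0\<^sub>m p 0)"
  have V: "V \<in> carrier_mat (k + p) p"
    unfolding V_def using Y by (intro carrier_matI) auto
  have Vx: "V *\<^sub>v x = (- Y *\<^sub>v x) @\<^sub>v x" if x: "x \<in> carrier_vec p" for x
  proof -
    have "V *\<^sub>v (x @\<^sub>v 0\<^sub>v 0) = (- Y *\<^sub>v x + 0\<^sub>m k 0 *\<^sub>v 0\<^sub>v 0) @\<^sub>v (1\<^sub>m p *\<^sub>v x + 0\<^sub>m p 0 *\<^sub>v 0\<^sub>v 0)"
      unfolding V_def using x Y by (intro four_block_mat_mult_vec) auto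
    moreover have "x @\<^sub>v 0\<^sub>v 0 = x" by (rule eq_vecI) auto
    moreover have "0\<^sub>m q 0 *\<^sub>v 0\<^sub>v 0 = (0\<^sub>v q :: complex vec)" for q by (rule eq_vecI) auto
    ultimately show ?thesis using x Y by simp
  qed
  have inj: "x = 0\<^sub>v p" if x: "x \<in> carrier_vec p" and 0: "V *\<^sub>v x = 0\<^sub>v (k + p)" for x
    using Vx[OF x] 0 append_vec_eq_zero[of "- Y *\<^sub>v x" k x p] x Y by auto
  have "?C * V = four_block_mat (0\<^sub>m k p) (0\<^sub>m k 0) (C22 - C21 * Y) (0\<^sub>m p 0)"
  proof -
    have e1: "C11 * (- Y) + C12 * 1\<^sub>m p = 0\<^sub>m k p"
      using C11 C12 Y by (intro eq_matI) auto
    have e2: "C21 * (- Y) + C22 * 1\<^sub>m p = C22 - C21 * Y"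
      using C21 C22 Y by (intro eq_matI) auto
    show ?thesis unfolding V_def
      by (subst mult_four_block_mat[OF C11 C12 C21 C22, of _ p _ 0])
         (use C11 C12 C21 C22 Y e1 e2 in auto)
  qed
  moreover have "mat_adjoint V = four_block_mat (- mat_adjoint Y) (1\<^sub>m p) (0\<^sub>m 0 k) (0\<^sub>m 0 p)"
    unfolding V_def using Y
    by (subst mat_adjoint_four_block[of _ k p _ 0 _ p]) (auto intro!: cong_four_block_mat eq_matI)
  ultimately have "mat_adjoint V * (?C * V) = four_block_mat (- mat_adjoint Y) (1\<^sub>m p) (0\<^sub>m 0 k) (0\<^sub>m 0 p)
      * four_block_mat (0\<^sub>m k p) (0\<^sub>m k 0) (C22 - C21 * Y) (0\<^sub>m p 0)" by simp
  also have "\<dots> = four_block_mat (C22 - C21 * Y) (0\<^sub>m p 0) (0\<^sub>m 0 p) (0\<^sub>m 0 0)"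
    by (subst mult_four_block_mat[of _ p k _ p _ 0 _ _ p _ 0]) (use C21 C22 Y in auto)
  also have "\<dots> = C22 - C21 * Y" using C21 C22 Y by (intro eq_matI) auto
  finally have "mat_adjoint V * ?C * V = C22 - C21 * Y"
    using V C11 C22 by (simp add: mult_assoc_dim)
  then show ?thesis using that[OF V inj] S by simp
qed

section \<open>The diagonal and E blocks of the canonical form\<close>

lemma cis_diag_carrier [simp]: "cis_diag \<phi>s \<in> carrier_mat (length \<phi>s) (length \<phi>s)"
  unfolding cis_diag_def by simp

lemma dim_cis_diag [simp]: "dim_row (cis_diag \<phi>s) = length \<phi>s" "dim_col (cis_diag \<phi>s) = length \<phi>s"
  using cis_diag_carrier[of \<phi>s] by (blast dest: carrier_matD)+

lemma cis_diag_Nil [simp]: "cis_diag [] = 0\<^sub>m 0 0"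
  by (rule eq_matI) auto

lemma cis_diag_Cons: "cis_diag (\<phi> # \<phi>s) = bdiag (cis_diag [\<phi>]) (cis_diag \<phi>s)"
  by (rule eq_matI) (auto simp: bdiag_def cis_diag_def mat_diag_def nth_Cons')

lemma diag_block_mat_cis_diag: "diag_block_mat (map (\<lambda>\<phi>. cis_diag [\<phi>]) \<phi>s) = cis_diag \<phi>s"
  by (induction \<phi>s) (simp_all add: diag_block_mat_Cons_bdiag cis_diag_Cons[symmetric] del: diag_block_mat.simps(2))

lemma qf_cis_diag:
  assumes "dim_vec x = length \<phi>s"
  shows "qf (cis_diag \<phi>s) x = (\<Sum>i<length \<phi>s. of_real ((cmod (x $ i))\<^sup>2) * cis (\<phi>s ! i))"
proof -
  have "(cis_diag \<phi>s *\<^sub>v x) $ i = cis (\<phi>s ! i) * x $ i" if "i < length \<phi>s" for i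
  proof -
    have "(cis_diag \<phi>s *\<^sub>v x) $ i = (\<Sum>j<length \<phi>s. (if i = j then cis (\<phi>s ! j) else 0) * x $ j)"
      using that assms unfolding cis_diag_def mat_diag_def by (simp add: scalar_prod_def atLeast0LessThan)
    also have "\<dots> = (\<Sum>j<length \<phi>s. if i = j then cis (\<phi>s ! i) * x $ i else 0)"
      by (rule sum.cong) auto
    finally have "(cis_diag \<phi>s *\<^sub>v x) $ i = (\<Sum>j<length \<phi>s. if i = j then cis (\<phi>s ! i) * x $ i else 0)" .
    then show ?thesis using that by simp
  qed
  then show ?thesis
    unfolding qf_def scalar_prod_def using assms
    by (auto simp: atLeast0LessThan complex_norm_square mult.commute simp del: of_real_power intro!: sum.cong)
qed

lemma E_block_carrier [simp]: "E_block \<theta> \<in> carrier_mat 2 2"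
  unfolding E_block_def mat_of_rows_list_def by (intro carrier_matI) auto

lemma dim_E_block [simp]: "dim_row (E_block \<theta>) = 2" "dim_col (E_block \<theta>) = 2"
  using E_block_carrier[of \<theta>] by (blast dest: carrier_matD)+

lemma qf_E_block:
  assumes "dim_vec x = 2"
  shows "qf (E_block \<theta>) x = cis \<theta> * (of_real ((cmod (x $ 0))\<^sup>2) + of_real ((cmod (x $ 1))\<^sup>2) + 2 * cnj (x $ 0) * x $ 1)"
  using assms unfolding qf_def E_block_def mat_of_rows_list_def scalar_prod_def complex_norm_square
  by (simp add: numeral_2_eq_2 atLeast0_lessThan_Suc scalar_prod_def algebra_simps)

section \<open>Interlacing\<close>

text \<open>The positive index of inertia of the Hermitian form \<open>Im (cis (- \<beta>) * qf A x)\<close>: \<open>m\<close> linear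
  conditions make it nonpositive, and it is positive on an \<open>m\<close>-dimensional space.\<close>

definition pos_index :: "complex mat \<Rightarrow> real \<Rightarrow> nat \<Rightarrow> bool" where
  "pos_index A \<beta> m \<longleftrightarrow> (\<exists>L \<in> carrier_mat m (dim_row A). \<exists>F \<in> carrier_mat (dim_row A) m.
     (\<forall>x \<in> carrier_vec (dim_row A). L *\<^sub>v x = 0\<^sub>v m \<longrightarrow> Im (cis (- \<beta>) * qf A x) \<le> 0) \<and>
     (\<forall>y \<in> carrier_vec m. y \<noteq> 0\<^sub>v m \<longrightarrow> 0 < Im (cis (- \<beta>) * qf A (F *\<^sub>v y))))"

lemma pos_indexI:
  assumes "A \<in> carrier_mat n n" "L \<in> carrier_mat m n" "F \<in> carrier_mat n m"
    "\<And>x. x \<in> carrier_vec n \<Longrightarrow> L *\<^sub>v x = 0\<^sub>v m \<Longrightarrow> Im (cis (- \<beta>) * qf A x) \<le> 0"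
    "\<And>y. y \<in> carrier_vec m \<Longrightarrow> y \<noteq> 0\<^sub>v m \<Longrightarrow> 0 < Im (cis (- \<beta>) * qf A (F *\<^sub>v y))"
  shows "pos_index A \<beta> m"
  unfolding pos_index_def using assms by auto

lemma pos_indexE:
  assumes "pos_index A \<beta> m" "A \<in> carrier_mat n n"
  obtains L F where "L \<in> carrier_mat m n" "F \<in> carrier_mat n m"
    "\<And>x. x \<in> carrier_vec n \<Longrightarrow> L *\<^sub>v x = 0\<^sub>v m \<Longrightarrow> Im (cis (- \<beta>) * qf A x) \<le> 0"
    "\<And>y. y \<in> carrier_vec m \<Longrightarrow> y \<noteq> 0\<^sub>v m \<Longrightarrow> 0 < Im (cis (- \<beta>) * qf A (F *\<^sub>v y))"
  using assms unfolding pos_index_def by (metis carrier_matD(1))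

text \<open>Sylvester's argument: if \<open>j > m\<close>, then \<open>m\<close> linear conditions
  on \<open>j\<close> parameters have a nonzero solution, at which the form of \<open>C\<close>
  would be nonpositive and positive at once.\<close>

lemma pos_index_compression:
  assumes C: "C \<in> carrier_mat n n" and V: "V \<in> carrier_mat n p"
    and m: "pos_index C \<beta> m" and j: "pos_index (mat_adjoint V * C * V) \<beta> j"
  shows "j \<le> m"
proof (rule ccontr)
  have S: "mat_adjoint V * C * V \<in> carrier_mat p p" using C V by (intro carrier_matI) auto
  obtain L where L: "L \<in> carrier_mat m n" "\<And>x. x \<in> carrier_vec n \<Longrightarrow> L *\<^sub>v x = 0\<^sub>v m \<Longrightarrow> Im (cis (- \<beta>) * qf C x) \<le> 0"
    using pos_indexE[OF m C] by metis
  obtain F where F: "F \<in> carrier_mat p j"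
    "\<And>y. y \<in> carrier_vec j \<Longrightarrow> y \<noteq> 0\<^sub>v j \<Longrightarrow> 0 < Im (cis (- \<beta>) * qf (mat_adjoint V * C * V) (F *\<^sub>v y))"
    using pos_indexE[OF j S] by metis
  assume "\<not> j \<le> m"
  moreover have "L * (V * F) \<in> carrier_mat m j" using L V F by (intro carrier_matI) auto
  ultimately obtain y where y: "y \<in> carrier_vec j" "y \<noteq> 0\<^sub>v j" "(L * (V * F)) *\<^sub>v y = 0\<^sub>v m"
    using wide_matrix_kernel[of "L * (V * F)" m j] by auto
  have "L *\<^sub>v (V *\<^sub>v (F *\<^sub>v y)) = 0\<^sub>v m" using y L V F by (simp add: mult_vec_assoc_dim)
  moreover have "V *\<^sub>v (F *\<^sub>v y) \<in> carrier_vec n" using V F y by (intro carrier_vecI) auto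
  ultimately have "Im (cis (- \<beta>) * qf C (V *\<^sub>v (F *\<^sub>v y))) \<le> 0" using L(2) by blast
  moreover have "qf (mat_adjoint V * C * V) (F *\<^sub>v y) = qf C (V *\<^sub>v (F *\<^sub>v y))"
    by (rule qf_congruence) (use V C F y in auto)
  ultimately show False using F(2)[OF y(1,2)] by simp
qed

lemma pos_index_congruence:
  assumes A: "A \<in> carrier_mat n n" and T: "T \<in> carrier_mat n n" "invertible_mat T"
    and m: "pos_index A \<beta> m"
  shows "pos_index (mat_adjoint T * A * T) \<beta> m"
proof -
  obtain R where R: "R \<in> carrier_mat n n" "T * R = 1\<^sub>m n" using invertible_inverse[OF T(2,1)] by metis
  obtain L F where L: "L \<in> carrier_mat m n" "\<And>x. x \<in> carrier_vec n \<Longrightarrow> L *\<^sub>v x = 0\<^sub>v m \<Longrightarrow> Im (cis (- \<beta>) * qf A x) \<le> 0"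
    and F: "F \<in> carrier_mat n m" "\<And>y. y \<in> carrier_vec m \<Longrightarrow> y \<noteq> 0\<^sub>v m \<Longrightarrow> 0 < Im (cis (- \<beta>) * qf A (F *\<^sub>v y))"
    using pos_indexE[OF m A] by metis
  show ?thesis
  proof (rule pos_indexI)
    show "mat_adjoint T * A * T \<in> carrier_mat n n" "L * T \<in> carrier_mat m n" "R * F \<in> carrier_mat n m"
      using A T L F R by (auto intro!: carrier_matI)
    fix x assume x: "x \<in> carrier_vec n" and "(L * T) *\<^sub>v x = 0\<^sub>v m"
    then have "L *\<^sub>v (T *\<^sub>v x) = 0\<^sub>v m" using L T by (simp add: mult_vec_assoc_dim)
    then show "Im (cis (- \<beta>) * qf (mat_adjoint T * A * T) x) \<le> 0"
      using L(2)[of "T *\<^sub>v x"] A T x by (subst qf_congruence) auto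
  next
    fix y :: "complex vec" assume y: "y \<in> carrier_vec m" "y \<noteq> 0\<^sub>v m"
    have "T *\<^sub>v ((R * F) *\<^sub>v y) = (T * R * F) *\<^sub>v y" using T R(1) F y by (simp add: mult_vec_assoc_dim)
    also have "\<dots> = F *\<^sub>v y" using R F by simp
    finally show "0 < Im (cis (- \<beta>) * qf (mat_adjoint T * A * T) ((R * F) *\<^sub>v y))"
      using F(2)[OF y] A T R F y by (subst qf_congruence) auto
  qed
qed

lemma pos_index_bdiag:
  assumes A: "A \<in> carrier_mat a a" and B: "B \<in> carrier_mat b b"
    and m: "pos_index A \<beta> m" and p: "pos_index B \<beta> p"
  shows "pos_index (bdiag A B) \<beta> (m + p)"
proof -
  obtain L F where L: "L \<in> carrier_mat m a" "\<And>x. x \<in> carrier_vec a \<Longrightarrow> L *\<^sub>v x = 0\<^sub>v m \<Longrightarrow> Im (cis (- \<beta>) * qf A x) \<le> 0"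
    and F: "F \<in> carrier_mat a m" "\<And>y. y \<in> carrier_vec m \<Longrightarrow> y \<noteq> 0\<^sub>v m \<Longrightarrow> 0 < Im (cis (- \<beta>) * qf A (F *\<^sub>v y))"
    using pos_indexE[OF m A] by metis
  obtain L' F' where L': "L' \<in> carrier_mat p b" "\<And>x. x \<in> carrier_vec b \<Longrightarrow> L' *\<^sub>v x = 0\<^sub>v p \<Longrightarrow> Im (cis (- \<beta>) * qf B x) \<le> 0"
    and F': "F' \<in> carrier_mat b p" "\<And>y. y \<in> carrier_vec p \<Longrightarrow> y \<noteq> 0\<^sub>v p \<Longrightarrow> 0 < Im (cis (- \<beta>) * qf B (F' *\<^sub>v y))"
    using pos_indexE[OF p B] by metis
  show ?thesis
  proof (rule pos_indexI)
    show "bdiag A B \<in> carrier_mat (a + b) (a + b)" "bdiag L L' \<in> carrier_mat (m + p) (a + b)"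
      "bdiag F F' \<in> carrier_mat (a + b) (m + p)" using A B L F L' F' by auto
    fix v assume v: "v \<in> carrier_vec (a + b)" "bdiag L L' *\<^sub>v v = 0\<^sub>v (m + p)"
    obtain x y where xy: "x \<in> carrier_vec a" "y \<in> carrier_vec b" "v = x @\<^sub>v y" by (rule split_vec[OF v(1)])
    have "(L *\<^sub>v x) @\<^sub>v (L' *\<^sub>v y) = 0\<^sub>v (m + p)" using v xy L L' by (simp add: bdiag_mult_append)
    then have "L *\<^sub>v x = 0\<^sub>v m" "L' *\<^sub>v y = 0\<^sub>v p"
      using append_vec_eq_zero[of "L *\<^sub>v x" m "L' *\<^sub>v y" p] L(1) L'(1) by auto
    then have "Im (cis (- \<beta>) * qf A x) \<le> 0" "Im (cis (- \<beta>) * qf B y) \<le> 0" using L(2) L'(2) xy by auto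
    then show "Im (cis (- \<beta>) * qf (bdiag A B) v) \<le> 0"
      using xy A B by (simp add: qf_bdiag distrib_left)
  next
    fix v :: "complex vec" assume v: "v \<in> carrier_vec (m + p)" "v \<noteq> 0\<^sub>v (m + p)"
    obtain x y where xy: "x \<in> carrier_vec m" "y \<in> carrier_vec p" "v = x @\<^sub>v y" by (rule split_vec[OF v(1)])
    have *: "0 \<le> Im (cis (- \<beta>) * qf A (F *\<^sub>v x))" "0 \<le> Im (cis (- \<beta>) * qf B (F' *\<^sub>v y))"
      using F(2)[OF xy(1)] F'(2)[OF xy(2)] F(1) F'(1) A B mult_mat_vec_zero[of F] mult_mat_vec_zero[of F']
        qf_zero[of A] qf_zero[of B] by force+
    have "x \<noteq> 0\<^sub>v m \<or> y \<noteq> 0\<^sub>v p" using append_vec_eq_zero[of x m y p] xy v by auto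
    then have "0 < Im (cis (- \<beta>) * qf A (F *\<^sub>v x)) + Im (cis (- \<beta>) * qf B (F' *\<^sub>v y))"
      using F(2)[OF xy(1)] F'(2)[OF xy(2)] * by auto
    then show "0 < Im (cis (- \<beta>) * qf (bdiag A B) (bdiag F F' *\<^sub>v v))"
      using xy A B F F' by (simp add: bdiag_mult_append qf_bdiag distrib_left)
  qed
qed

lemma pos_index_zero: "pos_index (0\<^sub>m n n) \<beta> 0"
proof (rule pos_indexI[of _ n "0\<^sub>m 0 n" _ "0\<^sub>m n 0"])
  fix x :: "complex vec" assume "x \<in> carrier_vec n"
  then show "Im (cis (- \<beta>) * qf (0\<^sub>m n n) x) \<le> 0" by (simp add: qf_def scalar_prod_def)
qed auto

text \<open>A diagonal entry \<open>cis \<phi>\<close> contributes a form in one variable with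
  coefficient \<open>sin (\<phi> - \<beta>)\<close>. A vanishing sine does not count towards the
  index.\<close>

lemma pos_index_cis_diag:
  "pos_index (cis_diag \<phi>s) \<beta> (length (filter (\<lambda>\<phi>. 0 < sin (\<phi> - \<beta>)) \<phi>s))"
proof (induction \<phi>s)
  case Nil
  then show ?case using pos_index_zero[of 0] by simp
next
  case (Cons \<phi> \<phi>s)
  have q: "Im (cis (- \<beta>) * qf (cis_diag [\<phi>]) x) = (cmod (x $ 0))\<^sup>2 * sin (\<phi> - \<beta>)" if "dim_vec x = 1" for x :: "complex vec"
  proof -
    have "cis (- \<beta>) * qf (cis_diag [\<phi>]) x = of_real ((cmod (x $ 0))\<^sup>2) * (cis (- \<beta>) * cis \<phi>)"
      using that by (simp add: qf_cis_diag)
    then show ?thesis unfolding cis_mult by (simp del: of_real_power)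
  qed
  have "pos_index (cis_diag [\<phi>]) \<beta> (if 0 < sin (\<phi> - \<beta>) then 1 else 0)"
  proof (cases "0 < sin (\<phi> - \<beta>)")
    case True
    have "pos_index (cis_diag [\<phi>]) \<beta> 1"
    proof (rule pos_indexI[of _ 1 "1\<^sub>m 1" _ "1\<^sub>m 1"])
      fix x :: "complex vec" assume "x \<in> carrier_vec 1" "1\<^sub>m 1 *\<^sub>v x = 0\<^sub>v 1"
      then show "Im (cis (- \<beta>) * qf (cis_diag [\<phi>]) x) \<le> 0" using qf_zero[of "cis_diag [\<phi>]"] by simp
    next
      fix x :: "complex vec" assume x: "x \<in> carrier_vec 1" "x \<noteq> 0\<^sub>v 1"
      then have "x $ 0 \<noteq> 0" by (metis carrier_vecD eq_vecI index_zero_vec less_one)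
      then show "0 < Im (cis (- \<beta>) * qf (cis_diag [\<phi>]) (1\<^sub>m 1 *\<^sub>v x))"
        using x True q[of x] by (simp del: times_complex.sel)
    qed auto
    then show ?thesis using True by simp
  next
    case False
    have "pos_index (cis_diag [\<phi>]) \<beta> 0"
    proof (rule pos_indexI[of _ 1 "0\<^sub>m 0 1" _ "0\<^sub>m 1 0"])
      fix x :: "complex vec" assume "x \<in> carrier_vec 1"
      then show "Im (cis (- \<beta>) * qf (cis_diag [\<phi>]) x) \<le> 0" 
        using False q[of x] by (simp add: mult_nonneg_nonpos del: times_complex.sel)
    qed auto
    then show ?thesis using False by simp
  qed
  then have "pos_index (bdiag (cis_diag [\<phi>]) (cis_diag \<phi>s)) \<beta>
    ((if 0 < sin (\<phi> - \<beta>) then 1 else 0) + length (filter (\<lambda>\<phi>. 0 < sin (\<phi> - \<beta>)) \<phi>s))"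
    using Cons by (intro pos_index_bdiag) (auto intro: carrier_matI)
  then show ?case unfolding cis_diag_Cons[of \<phi> \<phi>s] by (auto split: if_splits)
qed

text \<open>The form is Hermitian with eigenvalues \<open>sin (\<theta> - \<beta>) + 1\<close> and
  \<open>sin (\<theta> - \<beta>) - 1\<close>. They have opposite signs unless the sine has modulus
  1, that is, unless the cosine vanishes.\<close>

lemma pos_index_E_block:
  assumes "cos (\<theta> - \<beta>) \<noteq> 0"
  shows "pos_index (E_block \<theta>) \<beta> 1"
proof -
  define \<gamma> where "\<gamma> = \<theta> - \<beta>"
  have "(sin \<gamma>)\<^sup>2 \<noteq> 1" using assms cos_squared_eq[of \<gamma>] by (auto simp: \<gamma>_def)
  then have "sin \<gamma> \<noteq> 1" "sin \<gamma> \<noteq> -1" by auto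
  then have s: "-1 < sin \<gamma>" "sin \<gamma> < 1" using sin_ge_minus_one[of \<gamma>] sin_le_one[of \<gamma>] by linarith+
  have q: "Im (cis (- \<beta>) * qf (E_block \<theta>) x) = (cmod a)\<^sup>2 * (2 * sin \<gamma> + 2 * Im (cis \<gamma> * t))"
    if x: "dim_vec x = 2" "x $ 0 = a" "x $ 1 = t * a" and t: "cmod t = 1" for x :: "complex vec" and a t
  proof -
    have "cis (- \<beta>) * qf (E_block \<theta>) x = (cis (- \<beta>) * cis \<theta>) * (2 * of_real ((cmod a)\<^sup>2) + 2 * t * (cnj a * a))"
      unfolding qf_E_block[OF x(1)] x using t by (simp add: norm_mult algebra_simps)
    also have "\<dots> = of_real ((cmod a)\<^sup>2) * (2 * cis \<gamma> + 2 * (cis \<gamma> * t))"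
      unfolding cis_mult \<gamma>_def complex_norm_square by (simp add: algebra_simps)
    finally show ?thesis by (simp del: of_real_power)
  qed
  \<comment> \<open>With this unimodular \<open>t\<close> the vectors \<open>(1, t)\<close> and
    \<open>(1, - t)\<close> are the eigenvectors. The first spans the positive line
    \<open>F\<close>, and the condition \<open>L\<close> below leaves the multiples of the
    second.\<close>
  define t where "t = cis (- \<gamma>) * \<i>"
  have t: "cmod t = 1" "cmod (- t) = 1" "cis \<gamma> * t = \<i>"
    by (auto simp: t_def norm_mult mult.assoc[symmetric] cis_mult)
  show ?thesis
  proof (rule pos_indexI[of _ 2 "mat 1 2 (\<lambda>(i,j). if j = 0 then - t else - 1)" _ "mat 2 1 (\<lambda>(i,j). if i = 0 then 1 else t)"])
    fix x assume x: "x \<in> carrier_vec 2" "mat 1 2 (\<lambda>(i,j). if j = 0 then - t else - 1) *\<^sub>v x = 0\<^sub>v 1"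
    then have "(mat 1 2 (\<lambda>(i,j). if j = 0 then - t else - 1) *\<^sub>v x) $ 0 = 0" by simp
    moreover have "(mat 1 2 (\<lambda>(i,j). if j = 0 then - t else - 1) *\<^sub>v x) $ 0 = (- t) * (x $ 0) + (- 1) * (x $ 1)"
      using carrier_vecD[OF x(1)] by (simp add: scalar_prod_def numeral_2_eq_2 atLeast0_lessThan_Suc)
    ultimately have "(- t) * (x $ 0) + (- 1) * (x $ 1) = 0" by metis
    then have "x $ 1 = - t * (x $ 0)" by (simp add: add_eq_0_iff)
    then have "Im (cis (- \<beta>) * qf (E_block \<theta>) x) = (cmod (x $ 0))\<^sup>2 * (2 * sin \<gamma> - 2)"
      using q[of x "x $ 0" "- t"] x(1) t by simp
    then show "Im (cis (- \<beta>) * qf (E_block \<theta>) x) \<le> 0" using s by (simp add: mult_nonneg_nonpos)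
  next
    fix y :: "complex vec" assume y: "y \<in> carrier_vec 1" "y \<noteq> 0\<^sub>v 1"
    then have y0: "y $ 0 \<noteq> 0" by (metis carrier_vecD eq_vecI index_zero_vec less_one)
    let ?x = "mat 2 1 (\<lambda>(i,j). if i = 0 then 1 else t) *\<^sub>v y"
    have "?x $ 0 = y $ 0" "?x $ 1 = t * y $ 0" using y(1) by (auto simp: scalar_prod_def)
    then have "Im (cis (- \<beta>) * qf (E_block \<theta>) ?x) = (cmod (y $ 0))\<^sup>2 * (2 * sin \<gamma> + 2)"
      using q[of ?x "y $ 0" t] t by simp
    then show "0 < Im (cis (- \<beta>) * qf (E_block \<theta>) ?x)" using s y0 by simp
  qed auto
qed

abbreviation E_blocks :: "nat \<Rightarrow> real \<Rightarrow> complex mat" where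
  "E_blocks q \<theta> \<equiv> diag_block_mat (replicate q (E_block \<theta>))"

text \<open>One shape for all three kinds of phases: the quasi-sectorial and the rotated Hermitian
  kinds have \<open>q = 0\<close>.\<close>

abbreviation canonical_mat :: "nat \<Rightarrow> real list \<Rightarrow> nat \<Rightarrow> real \<Rightarrow> complex mat" where
  "canonical_mat m \<theta>s q \<theta> \<equiv> bdiag (0\<^sub>m m m) (bdiag (cis_diag \<theta>s) (E_blocks q \<theta>))"

lemma E_blocks_carrier:
  "E_blocks q \<theta> \<in> carrier_mat (2 * q) (2 * q)"
  by (intro carrier_matI) (auto simp: dim_diag_block_mat sum_list_replicate)

lemma pos_index_E_blocks:
  assumes "q \<noteq> 0 \<Longrightarrow> cos (\<theta> - \<beta>) \<noteq> 0"
  shows "pos_index (E_blocks q \<theta>) \<beta> q"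
  using assms
proof (induction q)
  case 0
  then show ?case using pos_index_zero[of 0] by simp
next
  case (Suc q)
  then show ?case
    using pos_index_bdiag[OF E_block_carrier E_blocks_carrier[of q \<theta>] pos_index_E_block, of \<theta> \<beta> q]
    by (simp add: diag_block_mat_Cons_bdiag del: diag_block_mat.simps(2))
qed

section \<open>Counting phases by inertia\<close>

lemma sorted_descending_bounds:
  fixes xs :: "real list"
  assumes "sorted_wrt (\<ge>) xs" "x \<in> set xs"
  shows "last xs \<le> x \<and> x \<le> hd xs"
proof
  show "x \<le> hd xs" using assms by (cases xs) auto
  show "last xs \<le> x" using assms by (cases xs rule: rev_cases) (auto simp: sorted_wrt_append)
qed

text \<open>\<open>U\<close> is unitary, so the decomposition of a quasi-sectorial matrix is a congruence too.\<close>

lemma phases_congruence: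
  assumes "phases C \<phi>s" "C \<in> carrier_mat n n"
  obtains T m \<theta> \<theta>s q where "T \<in> carrier_mat n n" "invertible_mat T" "m + length \<theta>s + 2 * q = n"
    "C = mat_adjoint T * canonical_mat m \<theta>s q \<theta> * T"
    "\<phi>s = replicate q (\<theta> + pi / 2) @ \<theta>s @ replicate q (\<theta> - pi / 2)"
    "length \<phi>s = mat_rank C" "sorted_wrt (\<ge>) \<phi>s"
    "\<And>\<phi> \<phi>'. \<phi> \<in> set \<phi>s \<Longrightarrow> \<phi>' \<in> set \<phi>s \<Longrightarrow> \<phi> - \<phi>' \<le> pi"
proof -
  have rank: "mat_rank C \<le> n" using vec_space.rank_le_nc[of C n n] assms(2) by auto
  consider (Q) "quasi_sectorial_phases C \<phi>s" | (R) "rotated_hermitian_phases C \<phi>s" | (N) "non_rotated_hermitian_phases C \<phi>s"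
    using assms(1) unfolding phases_def by blast
  then show ?thesis
  proof cases
    case Q
    define r where "r = mat_rank C"
    obtain U Cs where U: "U \<in> carrier_mat n n" "Cs \<in> carrier_mat r r"
        "mat_adjoint U * U = 1\<^sub>m n"
        "C = U * diag_block_mat [0\<^sub>m (n - r) (n - r), Cs] * mat_adjoint U"
        "sectorial_phases Cs \<phi>s"
      using Q unfolding quasi_sectorial_phases_def Let_def r_def carrier_matD(1)[OF assms(2)] by blast
    obtain T where T: "T \<in> carrier_mat r r" "invertible_mat T" "Cs = mat_adjoint T * cis_diag \<phi>s * T"
      and len: "length \<phi>s = r" and sorted: "sorted_wrt (\<ge>) \<phi>s" and w: "\<phi>s \<noteq> [] \<longrightarrow> hd \<phi>s - last \<phi>s < pi"
      using U(2,5) unfolding sectorial_phases_def by auto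
    obtain R where R: "R \<in> carrier_mat r r" "R * T = 1\<^sub>m r" using invertible_inverse[OF T(2,1)] by metis
    \<comment> \<open>The unitary change of basis and the congruence of the sectorial block combined
      into a single congruence of the whole matrix.\<close>
    define W where "W = bdiag (1\<^sub>m (n - r)) T * mat_adjoint U"
    have rn: "r \<le> n" using rank r_def by simp
    have W: "W \<in> carrier_mat n n" unfolding W_def using T U rn by (intro carrier_matI) auto
    have "U * bdiag (1\<^sub>m (n - r)) R * W = U * (bdiag (1\<^sub>m (n - r)) R * bdiag (1\<^sub>m (n - r)) T) * mat_adjoint U"
      unfolding W_def using U(1) R(1) T(1) rn by (simp add: mult_assoc_dim)
    also have "\<dots> = U * mat_adjoint U" using R T(1) U(1) rn by (simp add: bdiag_mult bdiag_one)
    also have "\<dots> = 1\<^sub>m n" using mat_mult_left_right_inverse[OF _ U(1,3)] U(1) by simp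
    finally have "invertible_mat W"
      using W U R rn by (intro invertible_matI[of W n "U * bdiag (1\<^sub>m (n - r)) R"]) (auto intro!: carrier_matI)
    moreover have "C = mat_adjoint W * bdiag (0\<^sub>m (n - r) (n - r)) (cis_diag \<phi>s) * W"
    proof -
      have "mat_adjoint W * bdiag (0\<^sub>m (n - r) (n - r)) (cis_diag \<phi>s) * W
        = U * (bdiag (1\<^sub>m (n - r)) (mat_adjoint T) * (bdiag (0\<^sub>m (n - r) (n - r)) (cis_diag \<phi>s) * bdiag (1\<^sub>m (n - r)) T)) * mat_adjoint U"
        unfolding W_def using U(1) T(1) rn len by (simp add: mat_adjoint_mult mat_adjoint_bdiag mult_assoc_dim)
      also have "\<dots> = U * bdiag (0\<^sub>m (n - r) (n - r)) Cs * mat_adjoint U"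
        using T len by (simp add: bdiag_mult mult_assoc_dim)
      finally show ?thesis using U(4) by (simp add: diag_block_mat_Cons_bdiag del: diag_block_mat.simps(2))
    qed
    moreover have "\<phi> - \<phi>' \<le> pi" if "\<phi> \<in> set \<phi>s" "\<phi>' \<in> set \<phi>s" for \<phi> \<phi>'
      using sorted_descending_bounds[OF sorted that(1)] sorted_descending_bounds[OF sorted that(2)] w that
      by fastforce
    \<comment> \<open>The first 0 says that there are no E blocks; the second is a placeholder for
      their angle.\<close>
    ultimately show ?thesis
      using that[of W "n - r" \<phi>s 0 0] W len rn sorted unfolding r_def by simp
  next
    case R
    define r where "r = mat_rank C"
    obtain T \<theta>0 p q where T: "T \<in> carrier_mat n n" "invertible_mat T" "p + q = r"
        "\<phi>s = replicate p (\<theta>0 + pi / 2) @ replicate q (\<theta>0 - pi / 2)"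
        "C = mat_adjoint T * diag_block_mat [0\<^sub>m (n - r) (n - r), cis_diag \<phi>s] * T"
      using R unfolding rotated_hermitian_phases_def Let_def r_def carrier_matD(1)[OF assms(2)] by blast
    have "sorted_wrt (\<ge>) (replicate q a)" for q and a :: real by (simp add: sorted_wrt_iff_nth_less)
    then have "sorted_wrt (\<ge>) \<phi>s" unfolding T(4) by (auto simp: sorted_wrt_append)
    moreover have "\<phi> - \<phi>' \<le> pi" if "\<phi> \<in> set \<phi>s" "\<phi>' \<in> set \<phi>s" for \<phi> \<phi>'
      using that unfolding T(4) by auto
    ultimately show ?thesis
      using that[of T "n - r" \<phi>s 0 0] T rank unfolding r_def by (simp add: diag_block_mat_Cons_bdiag del: diag_block_mat.simps(2))
  next
    case N
    define r where "r = mat_rank C"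
    obtain T \<theta>0 \<theta>s q where T: "T \<in> carrier_mat n n" "invertible_mat T" "length \<theta>s + 2 * q = r"
        "sorted_wrt (\<ge>) \<theta>s" "set \<theta>s \<subseteq> {\<theta>0 - pi / 2 .. \<theta>0 + pi / 2}"
        "\<phi>s = replicate q (\<theta>0 + pi / 2) @ \<theta>s @ replicate q (\<theta>0 - pi / 2)"
        "C = mat_adjoint T *
              diag_block_mat ([0\<^sub>m (n - r) (n - r), cis_diag \<theta>s] @ replicate q (E_block \<theta>0)) * T"
      using N unfolding non_rotated_hermitian_phases_def Let_def r_def carrier_matD(1)[OF assms(2)] by blast
    have sub: "set \<phi>s \<subseteq> {\<theta>0 - pi / 2 .. \<theta>0 + pi / 2}" using T(5) unfolding T(6) by auto
    have "sorted_wrt (\<ge>) (replicate q a)" for a :: real by (simp add: sorted_wrt_iff_nth_less)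
    then have "sorted_wrt (\<ge>) \<phi>s" using T(4,5) unfolding T(6) by (fastforce simp: sorted_wrt_append)
    moreover have "\<phi> - \<phi>' \<le> pi" if "\<phi> \<in> set \<phi>s" "\<phi>' \<in> set \<phi>s" for \<phi> \<phi>'
    proof -
      have "\<phi> \<le> \<theta>0 + pi / 2" "\<theta>0 - pi / 2 \<le> \<phi>'" using sub that by auto
      then show ?thesis by simp
    qed
    moreover have "n - r + length \<theta>s + 2 * q = n" using T(3) rank r_def by simp
    moreover have "C = mat_adjoint T * bdiag (0\<^sub>m (n - r) (n - r)) (bdiag (cis_diag \<theta>s) (E_blocks q \<theta>0)) * T"
      unfolding T(7) by (simp add: diag_block_mat_Cons_bdiag del: diag_block_mat.simps(2))
    moreover have "length \<phi>s = mat_rank C" using T(3,6) r_def by simp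
    ultimately show ?thesis
      using that[OF T(1,2)] T(6) by blast
  qed
qed

text \<open>At the phases \<theta> + pi/2 and \<theta> - pi/2 of an E block the sines are
  \<open>cos (\<theta> - \<beta>)\<close> and its negative, so exactly one of the two is counted, in
  agreement with the index 1 of the block. The hypothesis \<open>nz\<close> excludes a vanishing
  cosine whenever E blocks are present.\<close>

lemma pos_index_phases:
  assumes ph: "phases C \<phi>s" and C: "C \<in> carrier_mat n n" and nz: "\<forall>\<phi> \<in> set \<phi>s. sin (\<phi> - \<beta>) \<noteq> 0"
  shows "pos_index C \<beta> (length (filter (\<lambda>\<phi>. 0 < sin (\<phi> - \<beta>)) \<phi>s))"
proof -
  obtain T m \<theta> \<theta>s q where T: "T \<in> carrier_mat n n" "invertible_mat T" "m + length \<theta>s + 2 * q = n"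
    "C = mat_adjoint T * canonical_mat m \<theta>s q \<theta> * T"
    "\<phi>s = replicate q (\<theta> + pi / 2) @ \<theta>s @ replicate q (\<theta> - pi / 2)"
    using phases_congruence[OF ph C] by metis
  have s: "sin (\<theta> + pi / 2 - \<beta>) = cos (\<theta> - \<beta>)" "sin (\<theta> - pi / 2 - \<beta>) = - cos (\<theta> - \<beta>)"
    using sin_add[of "\<theta> - \<beta>" "pi / 2"] sin_diff[of "\<theta> - \<beta>" "pi / 2"] by (simp_all add: algebra_simps)
  have cos: "cos (\<theta> - \<beta>) \<noteq> 0" if "q \<noteq> 0" using nz that s T(5) by auto
  let ?l = "length (filter (\<lambda>\<phi>. 0 < sin (\<phi> - \<beta>)) \<theta>s)"
  have "pos_index C \<beta> (0 + (?l + q))"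
    unfolding T(4)
    by (intro pos_index_congruence[OF _ T(1,2)] pos_index_bdiag[of _ m _ "length \<theta>s + 2 * q"]
        pos_index_bdiag[of _ "length \<theta>s" _ "2 * q"]
        pos_index_zero pos_index_cis_diag pos_index_E_blocks cos E_blocks_carrier bdiag_carrier cis_diag_carrier)
      (use T(3) in \<open>auto intro!: carrier_matI simp: dim_diag_block_mat sum_list_replicate\<close>)
  moreover have "length (filter (\<lambda>\<phi>. 0 < sin (\<phi> - \<beta>)) \<phi>s) = ?l + q"
    using cos unfolding T(5) by (cases "q = 0") (auto simp: s filter_replicate)
  ultimately show ?thesis by simp
qed

text \<open>In a descending list the entries above \<alpha> have their positions before those below
  it, so a single entry bounds the counts on both sides. Positions start at 0: entry
  \<open>i\<close> above \<alpha> means at least \<open>i + 1\<close> entries above, and entry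
  \<open>i\<close> below \<alpha> means at least \<open>length xs - i\<close> below.\<close>

lemma length_filter_greater:
  fixes xs :: "real list"
  assumes "sorted_wrt (\<ge>) xs" "i < length xs"
  shows "\<alpha> < xs ! i \<Longrightarrow> i < length (filter (\<lambda>x. \<alpha> < x) xs)"
    and "xs ! i < \<alpha> \<Longrightarrow> length (filter (\<lambda>x. \<alpha> < x) xs) \<le> i"
    and "xs ! i < \<alpha> \<Longrightarrow> length xs - i \<le> length (filter (\<lambda>x. x < \<alpha>) xs)"
    and "\<alpha> < xs ! i \<Longrightarrow> length (filter (\<lambda>x. x < \<alpha>) xs) < length xs - i"
proof -
  have mono: "xs ! l \<le> xs ! k" if "k \<le> l" "l < length xs" for k l
    using that assms(1) by (cases "k = l") (auto simp: sorted_wrt_iff_nth_less)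
  show "i < length (filter (\<lambda>x. \<alpha> < x) xs)" if "\<alpha> < xs ! i"
  proof -
    have "card {..i} \<le> card {k. k < length xs \<and> \<alpha> < xs ! k}"
      by (rule card_mono) (use assms(2) that mono[of _ i] in \<open>auto intro: less_le_trans\<close>)
    then show ?thesis by (simp add: length_filter_conv_card)
  qed
  show "length (filter (\<lambda>x. \<alpha> < x) xs) \<le> i" if "xs ! i < \<alpha>"
  proof -
    have "card {k. k < length xs \<and> \<alpha> < xs ! k} \<le> card {..<i}"
      by (rule card_mono) (use that mono[of i] in \<open>force simp: not_less[symmetric]\<close>)+
    then show ?thesis by (simp add: length_filter_conv_card)
  qed
  show "length xs - i \<le> length (filter (\<lambda>x. x < \<alpha>) xs)" if "xs ! i < \<alpha>"
  proof -
    have "card {i..<length xs} \<le> card {k. k < length xs \<and> xs ! k < \<alpha>}"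
    proof (rule card_mono)
      show "{i..<length xs} \<subseteq> {k. k < length xs \<and> xs ! k < \<alpha>}"
        using that mono[of i] by (auto intro: le_less_trans[OF _ that])
    qed simp
    then show ?thesis by (simp add: length_filter_conv_card)
  qed
  show "length (filter (\<lambda>x. x < \<alpha>) xs) < length xs - i" if "\<alpha> < xs ! i"
  proof -
    have "card {k. k < length xs \<and> xs ! k < \<alpha>} \<le> card {i<..<length xs}"
      by (rule card_mono) (use assms(2) that mono[of _ i] in \<open>force simp: not_less[symmetric]\<close>)+
    then show ?thesis using assms(2) by (simp add: length_filter_conv_card)
  qed
qed

text \<open>Within distance pi of \<alpha> the sign of \<open>sin (\<phi> - \<alpha>)\<close> is
  that of \<open>\<phi> - \<alpha>\<close>. Replacing \<alpha> by \<alpha> + pi reverses the sign,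
  so the negative index is the positive index at another angle and one compression lemma gives both
  counts.\<close>

lemma phase_counts:
  assumes C: "C \<in> carrier_mat n n" and V: "V \<in> carrier_mat n p" and S: "S = mat_adjoint V * C * V"
    and ph: "phases C \<phi>s" "phases S \<psi>s"
    and \<alpha>: "\<And>\<phi>. \<phi> \<in> set \<phi>s \<union> set \<psi>s \<Longrightarrow> \<phi> \<noteq> \<alpha> \<and> \<bar>\<phi> - \<alpha>\<bar> < pi"
  shows "length (filter (\<lambda>x. \<alpha> < x) \<psi>s) \<le> length (filter (\<lambda>x. \<alpha> < x) \<phi>s)"
    and "length (filter (\<lambda>x. x < \<alpha>) \<psi>s) \<le> length (filter (\<lambda>x. x < \<alpha>) \<phi>s)"
proof -
  have Sc: "S \<in> carrier_mat p p" unfolding S using C V by (intro carrier_matI) auto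
  have sin_pos: "0 < sin (\<phi> - \<alpha>) \<longleftrightarrow> \<alpha> < \<phi>" "sin (\<phi> - \<alpha>) \<noteq> 0"
    and sin_neg: "0 < sin (\<phi> - (\<alpha> + pi)) \<longleftrightarrow> \<phi> < \<alpha>" "sin (\<phi> - (\<alpha> + pi)) \<noteq> 0"
    if in_union: "\<phi> \<in> set \<phi>s \<union> set \<psi>s" for \<phi>
  proof -
    have e: "sin (\<phi> - (\<alpha> + pi)) = - sin (\<phi> - \<alpha>)" by (simp add: sin_diff sin_add cos_add)
    consider "\<alpha> < \<phi>" "0 < sin (\<phi> - \<alpha>)" | "\<phi> < \<alpha>" "sin (\<phi> - \<alpha>) < 0"
    proof (cases "\<alpha> < \<phi>")
      case True
      then show ?thesis using \<alpha>[OF in_union] sin_gt_zero[of "\<phi> - \<alpha>"] by (intro that(1)) auto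
    next
      case False
      have "sin (\<phi> - \<alpha>) = - sin (\<alpha> - \<phi>)" using sin_minus[of "\<alpha> - \<phi>"] by simp
      then show ?thesis using False \<alpha>[OF in_union] sin_gt_zero[of "\<alpha> - \<phi>"] by (intro that(2)) auto
    qed
    then show "0 < sin (\<phi> - \<alpha>) \<longleftrightarrow> \<alpha> < \<phi>" "sin (\<phi> - \<alpha>) \<noteq> 0"
      "0 < sin (\<phi> - (\<alpha> + pi)) \<longleftrightarrow> \<phi> < \<alpha>" "sin (\<phi> - (\<alpha> + pi)) \<noteq> 0"
      unfolding e by (cases; simp)+
  qed
  note idx = pos_index_compression[OF C V pos_index_phases[OF ph(1) C] pos_index_phases[OF ph(2) Sc, unfolded S]]
  show "length (filter (\<lambda>x. \<alpha> < x) \<psi>s) \<le> length (filter (\<lambda>x. \<alpha> < x) \<phi>s)"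
    using idx[of \<alpha>] sin_pos by (simp cong: filter_cong)
  show "length (filter (\<lambda>x. x < \<alpha>) \<psi>s) \<le> length (filter (\<lambda>x. x < \<alpha>) \<phi>s)"
    using idx[of "\<alpha> + pi"] sin_neg by (simp cong: filter_cong)
qed

lemma dense_avoiding_finite:
  fixes a b :: real
  assumes "a < b" "finite A"
  obtains c where "a < c" "c < b" "c \<notin> A"
proof -
  have "\<not> {a<..<b} \<subseteq> A" using assms infinite_Ioo[of a b] finite_subset by blast
  then obtain c where "c \<in> {a<..<b}" "c \<notin> A" by blast
  then show ?thesis by (intro that[of c]) auto
qed

text \<open>A violated inequality leaves room for a generic \<alpha> between the two phases, and
  then \<open>S\<close> has more phases on one side of \<alpha> than \<open>C\<close>. The
  inequality of lengths is the sum of the two counts at one generic \<alpha>.\<close>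

lemma phase_interlacing:
  assumes C: "C \<in> carrier_mat n n" and V: "V \<in> carrier_mat n p" and S: "S = mat_adjoint V * C * V"
    and ph: "phases C \<phi>s" and comp: "compatible_phases \<phi>s S \<psi>s"
  shows "length \<psi>s \<le> length \<phi>s"
    and "\<And>j. j < length \<psi>s \<Longrightarrow> \<psi>s ! j \<le> \<phi>s ! j"
    and "\<And>j. j < length \<psi>s \<Longrightarrow> \<phi>s ! (length \<phi>s - length \<psi>s + j) \<le> \<psi>s ! j"
proof -
  have Sc: "S \<in> carrier_mat p p" unfolding S using C V by (intro carrier_matI) auto
  have ph': "phases S \<psi>s" and within: "\<And>\<psi>. \<psi> \<in> set \<psi>s \<Longrightarrow> \<phi>s \<noteq> [] \<and> last \<phi>s \<le> \<psi> \<and> \<psi> \<le> hd \<phi>s"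
    using comp unfolding compatible_phases_def by auto
  obtain sorted: "sorted_wrt (\<ge>) \<phi>s" and width: "\<And>\<phi> \<phi>'. \<phi> \<in> set \<phi>s \<Longrightarrow> \<phi>' \<in> set \<phi>s \<Longrightarrow> \<phi> - \<phi>' \<le> pi"
    using phases_congruence[OF ph C] by metis
  obtain sorted': "sorted_wrt (\<ge>) \<psi>s" using phases_congruence[OF ph' Sc] by metis
  note within' = sorted_descending_bounds[OF sorted]
  have counts: "length (filter (\<lambda>x. \<alpha> < x) \<psi>s) \<le> length (filter (\<lambda>x. \<alpha> < x) \<phi>s) \<and>
      length (filter (\<lambda>x. x < \<alpha>) \<psi>s) \<le> length (filter (\<lambda>x. x < \<alpha>) \<phi>s)"
    if ne: "\<phi>s \<noteq> []" and \<alpha>: "last \<phi>s < \<alpha>" "\<alpha> < hd \<phi>s" "\<alpha> \<notin> set \<phi>s \<union> set \<psi>s" for \<alpha>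
  proof -
    \<comment> \<open>As \<alpha> lies strictly inside a window of length at most pi that contains
      all phases, each of them is at distance less than pi.\<close>
    have w: "hd \<phi>s - last \<phi>s \<le> pi" using width ne by simp
    have "\<phi> \<noteq> \<alpha> \<and> \<bar>\<phi> - \<alpha>\<bar> < pi" if "\<phi> \<in> set \<phi>s \<union> set \<psi>s" for \<phi>
      using that \<alpha> w within[of \<phi>] within'[of \<phi>] by (auto simp: abs_less_iff)
    from phase_counts[OF C V S ph ph' this] show ?thesis by blast
  qed
  show len: "length \<psi>s \<le> length \<phi>s"
  proof (cases "\<psi>s = []")
    case False
    then have ne: "\<phi>s \<noteq> []" using within[of "hd \<psi>s"] by simp
    show ?thesis
    proof (cases "last \<phi>s < hd \<phi>s")
      case True
      obtain \<alpha> where \<alpha>: "last \<phi>s < \<alpha>" "\<alpha> < hd \<phi>s" "\<alpha> \<notin> set \<phi>s \<union> set \<psi>s"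
        using dense_avoiding_finite[OF True, of "set \<phi>s \<union> set \<psi>s"] by auto
      have split: "length (filter (\<lambda>x. \<alpha> < x) xs) + length (filter (\<lambda>x. x < \<alpha>) xs) = length xs" if "\<alpha> \<notin> set xs" for xs
      proof -
        have "filter (\<lambda>x. x < \<alpha>) xs = filter (\<lambda>x. \<not> \<alpha> < x) xs" using that by (intro filter_cong) (auto simp: not_less order_le_less)
        then show ?thesis using sum_length_filter_compl[of "\<lambda>x. \<alpha> < x" xs] by simp
      qed
      show ?thesis using counts[OF ne \<alpha>] split[of \<phi>s] split[of \<psi>s] \<alpha>(3) by simp
    next
      case False
      then have all: "\<phi> = hd \<phi>s" if "\<phi> \<in> set \<phi>s \<union> set \<psi>s" for \<phi>
        using that within[of \<phi>] within'[of \<phi>] by auto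
      \<comment> \<open>All phases coincide, so the window has no interior. A point at distance 1,
        which is less than pi, below the common value sees all of them on its upper side.\<close>
      have "\<phi> \<noteq> hd \<phi>s - 1 \<and> \<bar>\<phi> - (hd \<phi>s - 1)\<bar> < pi" if "\<phi> \<in> set \<phi>s \<union> set \<psi>s" for \<phi>
        using all[OF that] pi_ge_two by simp
      from phase_counts(1)[OF C V S ph ph' this]
      have "length (filter (\<lambda>x. hd \<phi>s - 1 < x) \<psi>s) \<le> length \<phi>s" by (meson le_trans length_filter_le)
      moreover have "filter (\<lambda>x. hd \<phi>s - 1 < x) \<psi>s = \<psi>s"
        by (rule filter_True) (use all in force)
      ultimately show ?thesis by simp
    qed
  qed simp
  fix j assume j: "j < length \<psi>s"
  then have ne: "\<phi>s \<noteq> []" using within[OF nth_mem[OF j]] by simp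
  have \<psi>: "last \<phi>s \<le> \<psi>s ! j" "\<psi>s ! j \<le> hd \<phi>s" using within[OF nth_mem[OF j]] by auto
  show "\<psi>s ! j \<le> \<phi>s ! j"
  proof (rule ccontr)
    have \<phi>: "last \<phi>s \<le> \<phi>s ! j" using within' j len by simp
    assume "\<not> \<psi>s ! j \<le> \<phi>s ! j"
    then obtain \<alpha> where \<alpha>: "\<phi>s ! j < \<alpha>" "\<alpha> < \<psi>s ! j" "\<alpha> \<notin> set \<phi>s \<union> set \<psi>s"
      using dense_avoiding_finite[of "\<phi>s ! j" "\<psi>s ! j" "set \<phi>s \<union> set \<psi>s"] by auto
    show False
      using counts[OF ne _ _ \<alpha>(3)] \<alpha> \<psi> \<phi> length_filter_greater(1)[OF sorted' j \<alpha>(2)]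
        length_filter_greater(2)[OF sorted _ \<alpha>(1)] j len by fastforce
  qed
  show "\<phi>s ! (length \<phi>s - length \<psi>s + j) \<le> \<psi>s ! j"
  proof (rule ccontr)
    \<comment> \<open>From position \<open>?i\<close> to the end of \<phi>s there are as many
      entries as from position \<open>j\<close> to the end of \<psi>s, which is the number compared
      by the counts from below.\<close>
    let ?i = "length \<phi>s - length \<psi>s + j"
    have i: "?i < length \<phi>s" using j len by simp
    have \<phi>: "\<phi>s ! ?i \<le> hd \<phi>s" using within' i by simp
    assume "\<not> \<phi>s ! ?i \<le> \<psi>s ! j"
    then obtain \<alpha> where \<alpha>: "\<psi>s ! j < \<alpha>" "\<alpha> < \<phi>s ! ?i" "\<alpha> \<notin> set \<phi>s \<union> set \<psi>s"
      using dense_avoiding_finite[of "\<psi>s ! j" "\<phi>s ! ?i" "set \<phi>s \<union> set \<psi>s"] by auto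
    show False
      using counts[OF ne _ _ \<alpha>(3)] \<alpha> \<psi> \<phi> length_filter_greater(3)[OF sorted' j \<alpha>(1)]
        length_filter_greater(4)[OF sorted i \<alpha>(2)] j len by fastforce
  qed
qed

section \<open>Congruence\<close>

text \<open>The carriers are part of the relation, so that transitivity and block sums have no
  further side conditions.\<close>

definition mat_congruent :: "nat \<Rightarrow> complex mat \<Rightarrow> complex mat \<Rightarrow> bool" where
  "mat_congruent n A B \<longleftrightarrow> A \<in> carrier_mat n n \<and> B \<in> carrier_mat n n \<and>
     (\<exists>T \<in> carrier_mat n n. invertible_mat T \<and> A = mat_adjoint T * B * T)"

lemma mat_congruentI:
  assumes "A \<in> carrier_mat n n" "B \<in> carrier_mat n n" "T \<in> carrier_mat n n" "R \<in> carrier_mat n n"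
    "R * T = 1\<^sub>m n" "A = mat_adjoint T * B * T"
  shows "mat_congruent n A B"
  unfolding mat_congruent_def using assms invertible_matI by blast

lemma mat_congruentE:
  assumes "mat_congruent n A B"
  obtains T R where "A \<in> carrier_mat n n" "B \<in> carrier_mat n n" "T \<in> carrier_mat n n" "R \<in> carrier_mat n n"
    "R * T = 1\<^sub>m n" "T * R = 1\<^sub>m n" "A = mat_adjoint T * B * T"
  using assms invertible_inverse unfolding mat_congruent_def by metis

lemma mat_congruent_refl: "A \<in> carrier_mat n n \<Longrightarrow> mat_congruent n A A"
  by (rule mat_congruentI[of _ _ _ "1\<^sub>m n" "1\<^sub>m n"]) auto

lemma mat_congruent_trans:
  assumes "mat_congruent n A B" "mat_congruent n B C"
  shows "mat_congruent n A C"
proof -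
  obtain T R where 1: "A \<in> carrier_mat n n" "B \<in> carrier_mat n n" "T \<in> carrier_mat n n" "R \<in> carrier_mat n n"
    "R * T = 1\<^sub>m n" "A = mat_adjoint T * B * T" using mat_congruentE[OF assms(1)] by metis
  obtain T' R' where 2: "C \<in> carrier_mat n n" "T' \<in> carrier_mat n n" "R' \<in> carrier_mat n n"
    "R' * T' = 1\<^sub>m n" "B = mat_adjoint T' * C * T'" using mat_congruentE[OF assms(2)] by metis
  have "(R * R') * (T' * T) = R * ((R' * T') * T)" using 1(3,4) 2(2,3) by (simp add: mult_assoc_dim)
  also have "\<dots> = 1\<^sub>m n" using 1(3-5) unfolding 2(4) by simp
  finally have "(R * R') * (T' * T) = 1\<^sub>m n" .
  moreover have "A = mat_adjoint (T' * T) * C * (T' * T)"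
    unfolding 1(6) 2(5) using 1(3) 2(1,2) by (simp add: mat_adjoint_mult mult_assoc_dim)
  ultimately show ?thesis
    by (intro mat_congruentI[of A n C "T' * T" "R * R'"]) (use 1(1-4) 2(1-3) in auto)
qed

lemma mat_congruent_bdiag:
  assumes "mat_congruent a A A'" "mat_congruent b B B'"
  shows "mat_congruent (a + b) (bdiag A B) (bdiag A' B')"
proof -
  obtain T R where 1: "A \<in> carrier_mat a a" "A' \<in> carrier_mat a a" "T \<in> carrier_mat a a" "R \<in> carrier_mat a a"
    "R * T = 1\<^sub>m a" "A = mat_adjoint T * A' * T" using mat_congruentE[OF assms(1)] by metis
  obtain T' R' where 2: "B \<in> carrier_mat b b" "B' \<in> carrier_mat b b" "T' \<in> carrier_mat b b" "R' \<in> carrier_mat b b"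
    "R' * T' = 1\<^sub>m b" "B = mat_adjoint T' * B' * T'" using mat_congruentE[OF assms(2)] by metis
  have "bdiag R R' * bdiag T T' = 1\<^sub>m (a + b)" using 1(3-5) 2(3-5) by (simp add: bdiag_mult bdiag_one)
  moreover have "bdiag A B = mat_adjoint (bdiag T T') * bdiag A' B' * bdiag T T'"
    unfolding 1(6) 2(6) using 1(2,3) 2(2,3) by (simp add: mat_adjoint_bdiag bdiag_mult)
  ultimately show ?thesis
    by (intro mat_congruentI[of _ _ _ "bdiag T T'" "bdiag R R'"]) (use 1(1-4) 2(1-4) in auto)
qed

text \<open>A block permutation is unitary: its adjoint \<open>R\<close> is also its
  inverse.\<close>

lemma mat_congruent_swap:
  assumes A: "A \<in> carrier_mat a a" and B: "B \<in> carrier_mat b b"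
  shows "mat_congruent (a + b) (bdiag A B) (bdiag B A)"
proof -
  define T where "T = four_block_mat (0\<^sub>m b a) (1\<^sub>m b) (1\<^sub>m a) (0\<^sub>m a b :: complex mat)"
  define R where "R = four_block_mat (0\<^sub>m a b) (1\<^sub>m a) (1\<^sub>m b) (0\<^sub>m b a :: complex mat)"
  have T: "T \<in> carrier_mat (a + b) (a + b)" and R: "R \<in> carrier_mat (a + b) (a + b)"
    unfolding T_def R_def by (intro carrier_matI; simp)+
  have adj: "mat_adjoint T = R"
    unfolding T_def R_def by (subst mat_adjoint_four_block[of _ b a _ b _ a]) auto
  have RT: "R * T = 1\<^sub>m (a + b)"
    unfolding R_def T_def by (subst mult_four_block_mat[of _ a b _ a _ b _ _ a _ b]) auto
  have "bdiag B A * T = four_block_mat (0\<^sub>m b a) B A (0\<^sub>m a b)"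
    unfolding T_def bdiag_def using A B
    by (subst mult_four_block_mat[of _ b b _ a _ a _ _ a _ b]) auto
  then have "R * (bdiag B A * T) = bdiag A B"
    unfolding R_def bdiag_def using A B
    by (simp add: mult_four_block_mat[of _ a b _ a _ b _ _ a _ b])
  then have "bdiag A B = mat_adjoint T * bdiag B A * T"
    unfolding adj using T R A B by (simp add: mult_assoc_dim)
  moreover have "bdiag B A \<in> carrier_mat (a + b) (a + b)" using A B by (intro carrier_matI) auto
  ultimately show ?thesis
    using mat_congruentI[OF bdiag_carrier[OF A B] _ T R RT] by blast
qed

lemma diag_block_mat_carrier:
  assumes "\<And>A. A \<in> set As \<Longrightarrow> square_mat A"
  shows "diag_block_mat As \<in> carrier_mat (sum_list (map dim_row As)) (sum_list (map dim_row As))"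
proof -
  have "sum_list (map dim_col As) = sum_list (map dim_row As)"
    using assms by (intro arg_cong[of _ _ sum_list] map_cong) auto
  then show ?thesis by (intro carrier_matI) (simp_all only: dim_diag_block_mat)
qed

text \<open>The head of one list reaches its place in the other by a single swap with the blocks in
  front of it. This sorts the phases and collects the E blocks at the end.\<close>

lemma mat_congruent_perm:
  assumes "mset As = mset Bs" "\<And>A. A \<in> set As \<Longrightarrow> square_mat A"
  shows "mat_congruent (sum_list (map dim_row As)) (diag_block_mat As) (diag_block_mat Bs)"
  using assms
proof (induction As arbitrary: Bs)
  case Nil
  then show ?case by (auto intro!: mat_congruent_refl)
next
  case (Cons A As)
  have "A \<in> set Bs" using Cons.prems(1) by (metis list.set_intros(1) mset_eq_setD)
  then obtain B1 B2 where Bs: "Bs = B1 @ A # B2" by (meson split_list)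
  have set: "set (A # As) = set Bs" using Cons.prems(1) by (metis mset_eq_setD)
  have ms: "mset As = mset (B1 @ B2)" using Cons.prems(1) Bs by simp
  have A: "A \<in> carrier_mat (dim_row A) (dim_row A)" using Cons.prems(2)[of A] by (auto intro: carrier_matI)
  let ?d = "\<lambda>As :: complex mat list. sum_list (map dim_row As)"
  have sq1: "diag_block_mat B1 \<in> carrier_mat (?d B1) (?d B1)" "diag_block_mat B2 \<in> carrier_mat (?d B2) (?d B2)"
    by (rule diag_block_mat_carrier; use Cons.prems(2) set Bs in auto)+
  have "mset (map dim_row As) = mset (map dim_row (B1 @ B2))" using ms by (metis mset_map)
  then have d: "?d As = ?d B1 + ?d B2" by (metis map_append sum_list_append sum_mset_sum_list)
  have "mat_congruent (dim_row A + ?d As) (bdiag A (diag_block_mat As)) (bdiag A (diag_block_mat (B1 @ B2)))"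
    using Cons.IH[OF ms] Cons.prems(2) by (intro mat_congruent_bdiag mat_congruent_refl A) auto
  also have "bdiag A (diag_block_mat (B1 @ B2)) = diag_block_mat ((A # B1) @ B2)"
    by (simp add: diag_block_mat_Cons_bdiag del: diag_block_mat.simps(2))
  also have "\<dots> = bdiag (bdiag A (diag_block_mat B1)) (diag_block_mat B2)"
    unfolding diag_block_mat_append_bdiag diag_block_mat_Cons_bdiag ..
  finally have 1: "mat_congruent (dim_row A + ?d As) (bdiag A (diag_block_mat As))
      (bdiag (bdiag A (diag_block_mat B1)) (diag_block_mat B2))" .
  have "mat_congruent ((dim_row A + ?d B1) + ?d B2) (bdiag (bdiag A (diag_block_mat B1)) (diag_block_mat B2))
      (bdiag (bdiag (diag_block_mat B1) A) (diag_block_mat B2))"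
    by (intro mat_congruent_bdiag mat_congruent_refl mat_congruent_swap A sq1)
  also have "bdiag (bdiag (diag_block_mat B1) A) (diag_block_mat B2) = diag_block_mat ((B1 @ [A]) @ B2)"
    unfolding diag_block_mat_append_bdiag diag_block_mat_singleton ..
  finally have "mat_congruent (dim_row A + ?d As) (bdiag (bdiag A (diag_block_mat B1)) (diag_block_mat B2)) (diag_block_mat Bs)"
    using d Bs by (simp add: add.assoc)
  with 1 have "mat_congruent (dim_row A + ?d As) (bdiag A (diag_block_mat As)) (diag_block_mat Bs)"
    by (rule mat_congruent_trans)
  then show ?case by (simp add: diag_block_mat_Cons_bdiag del: diag_block_mat.simps(2))
qed

section \<open>Canonical form of accretive matrices\<close>

lemma cprod_add_right: "dim_vec y = dim_vec x \<Longrightarrow> dim_vec z = dim_vec x \<Longrightarrow> cprod x (y + z) = cprod x y + cprod x z"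
  by (simp add: scalar_prod_def sum.distrib algebra_simps)

lemma cprod_add_left: "dim_vec y = dim_vec x \<Longrightarrow> dim_vec z = dim_vec x \<Longrightarrow> cprod (y + z) x = cprod y x + cprod z x"
  by (simp add: scalar_prod_def sum.distrib algebra_simps)

lemma cprod_smult_right: "dim_vec y = dim_vec x \<Longrightarrow> cprod x (c \<cdot>\<^sub>v y) = c * cprod x y"
  by (simp add: scalar_prod_def sum_distrib_left algebra_simps)

lemma cprod_smult_left: "dim_vec y = dim_vec x \<Longrightarrow> cprod (c \<cdot>\<^sub>v y) x = cnj c * cprod y x"
  by (simp add: scalar_prod_def sum_distrib_left algebra_simps)

lemmas cprod_linear = cprod_add_right cprod_add_left cprod_smult_right cprod_smult_left

lemma cprod_hermitian:
  assumes "K \<in> carrier_mat n n" "mat_adjoint K = K" "x \<in> carrier_vec n" "y \<in> carrier_vec n"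
  shows "cprod (K *\<^sub>v x) y = cprod x (K *\<^sub>v y)" "cprod x (K *\<^sub>v y) = cnj (cprod y (K *\<^sub>v x))"
proof -
  show "cprod (K *\<^sub>v x) y = cprod x (K *\<^sub>v y)" using cprod_adjoint[of x K y] assms by simp
  then show "cprod x (K *\<^sub>v y) = cnj (cprod y (K *\<^sub>v x))" using cprod_commute[of "K *\<^sub>v x" y] assms by simp
qed

lemma qf_hermitian_real:
  assumes "K \<in> carrier_mat n n" "mat_adjoint K = K" "x \<in> carrier_vec n"
  shows "qf K x = of_real (Re (qf K x))"
  using cprod_hermitian(2)[OF assms(1,2,3,3)] unfolding qf_def by (simp add: complex_eq_iff)

text \<open>Moving from \<open>x\<close> in the direction \<open>- H x\<close> by a step
  \<open>t\<close> changes the form to \<open>- 2 * t * s + t\<^sup>2 * r\<close>, where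
  \<open>s\<close> is the squared norm of \<open>H x\<close>. For small positive \<open>t\<close>
  this is negative unless \<open>s = 0\<close>.\<close>

lemma psd_null_vector:
  assumes H: "H \<in> carrier_mat n n" "mat_adjoint H = H"
    and psd: "\<And>x. x \<in> carrier_vec n \<Longrightarrow> 0 \<le> Re (qf H x)"
    and x: "x \<in> carrier_vec n" "qf H x = 0"
  shows "H *\<^sub>v x = 0\<^sub>v n"
proof -
  define w where "w = H *\<^sub>v x"
  have w: "w \<in> carrier_vec n" unfolding w_def using H x by (intro carrier_vecI) auto
  define s where "s = Re (cprod w w)"
  define r where "r = Re (qf H w)"
  have *: "0 \<le> - 2 * t * s + t\<^sup>2 * r" for t :: real
  proof -
    define v where "v = x + (- of_real t) \<cdot>\<^sub>v w"
    have v: "v \<in> carrier_vec n" unfolding v_def using x w by simp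
    have Hw: "cprod x (H *\<^sub>v w) = cprod w w"
      using cprod_hermitian(1)[OF H x(1) w] by (simp add: w_def)
    have "H *\<^sub>v v = w + (- of_real t) \<cdot>\<^sub>v (H *\<^sub>v w)"
      unfolding v_def using H(1) x w by (simp add: mult_mat_vec_add mult_mat_vec_scale w_def)
    then have "qf H v = cprod x w + (- of_real t) * cprod x (H *\<^sub>v w)
      + (- of_real t) * cprod w w + (of_real t)\<^sup>2 * cprod w (H *\<^sub>v w)"
      unfolding qf_def v_def using x(1) w H(1) by (simp add: cprod_linear power2_eq_square algebra_simps)
    also have "cprod x w = 0" using x(2) unfolding qf_def w_def .
    finally have "qf H v = of_real (- 2 * t) * cprod w w + of_real (t\<^sup>2) * qf H w"
      unfolding Hw by (simp add: qf_def[of H w])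
    then have "Re (qf H v) = - 2 * t * s + t\<^sup>2 * r"
      unfolding s_def r_def by (simp del: of_real_mult of_real_power of_real_minus)
    then show ?thesis using psd[OF v] by simp
  qed
  have "s = 0"
  proof (rule ccontr)
    assume "s \<noteq> 0"
    then have s: "0 < s" using cprod_self_ge_0[of w] by (simp add: s_def)
    have r: "0 \<le> r" using psd[OF w] by (simp add: r_def)
    \<comment> \<open>Small enough for \<open>t * r < s\<close>; the summand 1 covers the case
      \<open>r = 0\<close>.\<close>
    define t where "t = s / (r + 1)"
    have t: "0 < t" "t * r < s" using s r by (auto simp: t_def field_simps)
    have "t * (t * r) < t * (2 * s)" using t s by (intro mult_strict_left_mono) auto
    then show False using *[of t] by (simp add: power2_eq_square algebra_simps)
  qed
  then have "cprod w w = 0" unfolding s_def using cprod_self_real[of w] by simp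
  then show ?thesis using cprod_self_eq_0[of w] w H(1) by (simp add: w_def)
qed

text \<open>The range of a Hermitian matrix is the orthogonal complement of its kernel. In the
  coordinates of the kernel decomposition \<open>v\<close> has only components in the nonsingular
  block, where the equation is solved.\<close>

lemma hermitian_range:
  assumes H: "H \<in> carrier_mat n n" "mat_adjoint H = H" and v: "v \<in> carrier_vec n"
    and orth: "\<And>f. f \<in> carrier_vec n \<Longrightarrow> H *\<^sub>v f = 0\<^sub>v n \<Longrightarrow> cprod f v = 0"
  obtains y where "y \<in> carrier_vec n" "H *\<^sub>v y = v"
proof -
  obtain m X Z where Z: "m \<le> n" "X \<in> carrier_mat n m" "Z \<in> carrier_mat n (n - m)"
    "H * X = 0\<^sub>m n m"
    "hcat X Z * mat_adjoint (hcat X Z) = 1\<^sub>m n" "mat_adjoint (hcat X Z) * hcat X Z = 1\<^sub>m n"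
    "H = hcat X Z * bdiag (0\<^sub>m m m) (mat_adjoint Z * H * Z) * mat_adjoint (hcat X Z)"
    "\<And>c. c \<in> carrier_vec (n - m) \<Longrightarrow> (mat_adjoint Z * H * Z) *\<^sub>v c = 0\<^sub>v (n - m) \<Longrightarrow> c = 0\<^sub>v (n - m)"
    using kernel_decomposition[OF H(1)] H(2) by metis
  define U where "U = hcat X Z"
  define B where "B = mat_adjoint Z * H * Z"
  have U: "U \<in> carrier_mat n n" using hcat_carrier[OF Z(2,3)] Z(1) by (simp add: U_def)
  have B: "B \<in> carrier_mat (n - m) (n - m)" unfolding B_def using Z(3) H(1) by (intro carrier_matI) auto
  obtain R where R: "R \<in> carrier_mat (n - m) (n - m)" "B * R = 1\<^sub>m (n - m)"
    using injective_square_inverse[OF B] Z(8) unfolding B_def by blast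
  have Uv: "mat_adjoint U *\<^sub>v v \<in> carrier_vec (m + (n - m))" using U v Z(1) by (intro carrier_vecI) auto
  obtain a b where ab: "a \<in> carrier_vec m" "b \<in> carrier_vec (n - m)" "mat_adjoint U *\<^sub>v v = a @\<^sub>v b"
    by (rule split_vec[OF Uv])
  have "a $ i = 0" if i: "i < m" for i
  proof -
    have "H *\<^sub>v col X i = col (H * X) i" using H Z(2) i by (intro eq_vecI) auto
    also have "\<dots> = 0\<^sub>v n" unfolding Z(4) using i by (intro eq_vecI) auto
    finally have 0: "cprod (col X i) v = 0" using orth[of "col X i"] Z(2) i by auto
    have "a $ i = (mat_adjoint U *\<^sub>v v) $ i" unfolding ab(3) using ab(1,2) i by simp
    also have "\<dots> = cprod (col U i) v" using U i Z(1) by (simp add: row_mat_adjoint)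
    also have "col U i = col X i" unfolding U_def using Z(2,3) i by (subst col_hcat) auto
    finally show ?thesis using 0 by simp
  qed
  then have a: "a = 0\<^sub>v m" using ab(1) by (intro eq_vecI) auto
  define y where "y = U *\<^sub>v (0\<^sub>v m @\<^sub>v (R *\<^sub>v b))"
  have y: "y \<in> carrier_vec n" unfolding y_def using U by (intro carrier_vecI) auto
  have Rb: "R *\<^sub>v b \<in> carrier_vec (n - m)" using R ab by (intro carrier_vecI) auto
  have c: "0\<^sub>v m @\<^sub>v (R *\<^sub>v b) \<in> carrier_vec n" using carrier_vecD[OF Rb] Z(1) R(1) by (intro carrier_vecI) auto
  have "H *\<^sub>v y = (U * bdiag (0\<^sub>m m m) B * mat_adjoint U) *\<^sub>v y" using Z(7) by (simp add: U_def B_def)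
  also have "\<dots> = U *\<^sub>v (bdiag (0\<^sub>m m m) B *\<^sub>v ((mat_adjoint U * U) *\<^sub>v (0\<^sub>v m @\<^sub>v (R *\<^sub>v b))))"
    unfolding y_def using U B R(1) Z(1) by (simp add: mult_vec_assoc_dim mult_assoc_dim)
  also have "(mat_adjoint U * U) *\<^sub>v (0\<^sub>v m @\<^sub>v (R *\<^sub>v b)) = 0\<^sub>v m @\<^sub>v (R *\<^sub>v b)"
    using Z(6) c by (simp add: U_def)
  also have "bdiag (0\<^sub>m m m) B *\<^sub>v (0\<^sub>v m @\<^sub>v (R *\<^sub>v b)) = 0\<^sub>v m @\<^sub>v ((B * R) *\<^sub>v b)"
    using B R(1) ab by (subst bdiag_mult_append) (auto simp: mult_vec_assoc_dim)
  also have "\<dots> = mat_adjoint U *\<^sub>v v" unfolding R(2) ab(3) a using ab(2) by simp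
  also have "U *\<^sub>v (mat_adjoint U *\<^sub>v v) = (U * mat_adjoint U) *\<^sub>v v" using U v by (simp add: mult_vec_assoc_dim)
  also have "\<dots> = v" using Z(5) v by (simp add: U_def)
  finally show ?thesis using that y by blast
qed

lemma complex_eigenvector_exists:
  assumes "A \<in> carrier_mat n n" "0 < n"
  obtains x l where "x \<in> carrier_vec n" "x \<noteq> 0\<^sub>v n" "A *\<^sub>v x = l \<cdot>\<^sub>v (x :: complex vec)"
proof -
  obtain l where "eigenvalue A l"
    using spectrum_non_empty[of A n] assms unfolding spectrum_def by auto
  then obtain x where "eigenvector A x l" unfolding eigenvalue_def by auto
  then show ?thesis using that assms unfolding eigenvector_def by auto
qed

text \<open>A block \<open>P\<close> splits off from \<open>S\<close> along the columns of \<open>X\<close>: the orthogonal complement of the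
  columns of \<open>Y\<close> is then orthogonal to \<open>X\<close> from both sides with respect to \<open>S\<close>.\<close>

lemma split_off_block:
  assumes S: "S \<in> carrier_mat n n" and X: "X \<in> carrier_mat n m" and Y: "Y \<in> carrier_mat n m"
    and P: "P \<in> carrier_mat m m"
    and YX: "mat_adjoint Y * X = 1\<^sub>m m" and SX: "S * X = Y * P" and SX': "mat_adjoint S * X = Y * mat_adjoint P"
    and inj: "\<And>x. x \<in> carrier_vec n \<Longrightarrow> S *\<^sub>v x = 0\<^sub>v n \<Longrightarrow> x = 0\<^sub>v n"
  obtains Z where "m \<le> n" "Z \<in> carrier_mat n (n - m)" "mat_congruent n S (bdiag P (mat_adjoint Z * S * Z))"
    "\<And>c. c \<in> carrier_vec (n - m) \<Longrightarrow> (mat_adjoint Z * S * Z) *\<^sub>v c = 0\<^sub>v (n - m) \<Longrightarrow> c = 0\<^sub>v (n - m)"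
proof -
  have mn: "m \<le> n"
  proof (rule ccontr)
    assume "\<not> m \<le> n"
    then obtain y where y: "y \<in> carrier_vec m" "y \<noteq> 0\<^sub>v m" "X *\<^sub>v y = 0\<^sub>v n" using wide_matrix_kernel[OF X] by auto
    have "y = (mat_adjoint Y * X) *\<^sub>v y" using YX y by simp
    also have "\<dots> = 0\<^sub>v m" using X Y y(1,3) mult_mat_vec_zero[of "mat_adjoint Y"] by (simp add: mult_vec_assoc_dim)
    finally show False using y by simp
  qed
  obtain Z where Z: "Z \<in> carrier_mat n (n - m)" "mat_adjoint Y * Z = 0\<^sub>m m (n - m)" "mat_adjoint Z * Z = 1\<^sub>m (n - m)"
    using orthonormal_complement[OF Y, of "n - m"] mn by auto
  have ZY: "mat_adjoint Z * Y = 0\<^sub>m (n - m) m"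
    using mat_adjoint_mult[of "mat_adjoint Y" Z] Y Z by simp
  define M where "M = hcat X Z"
  have M: "M \<in> carrier_mat n n" using hcat_carrier[OF X Z(1)] mn by (simp add: M_def)
  \<comment> \<open>The adjoint of \<open>Y\<close> is a left inverse of \<open>X\<close> and kills
    \<open>Z\<close>, which isolates \<open>a\<close>; the orthonormality of \<open>Z\<close> then
    gives \<open>b\<close>.\<close>
  have injM: "v = 0\<^sub>v n" if v: "v \<in> carrier_vec n" "M *\<^sub>v v = 0\<^sub>v n" for v
  proof -
    have v': "v \<in> carrier_vec (m + (n - m))" using v mn by simp
    obtain a b where ab: "a \<in> carrier_vec m" "b \<in> carrier_vec (n - m)" "v = a @\<^sub>v b" by (rule split_vec[OF v'])
    have 0: "X *\<^sub>v a + Z *\<^sub>v b = 0\<^sub>v n" using v(2) X Z(1) ab unfolding M_def by (simp add: hcat_mult_append)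
    have "0\<^sub>v m = mat_adjoint Y *\<^sub>v (X *\<^sub>v a + Z *\<^sub>v b)"
      unfolding 0 using mult_mat_vec_zero[of "mat_adjoint Y"] Y by simp
    also have "\<dots> = (mat_adjoint Y * X) *\<^sub>v a + (mat_adjoint Y * Z) *\<^sub>v b"
      using X Y Z(1) ab by (simp add: mult_mat_vec_add mult_vec_assoc_dim)
    also have "\<dots> = a" unfolding YX Z(2) using ab by (intro eq_vecI) auto
    finally have a: "a = 0\<^sub>v m" by simp
    have "X *\<^sub>v a = 0\<^sub>v n" unfolding a using mult_mat_vec_zero[of X] X by simp
    then have Zb: "Z *\<^sub>v b = 0\<^sub>v n" using 0 Z(1) ab by auto
    have "b = (mat_adjoint Z * Z) *\<^sub>v b" using Z(3) ab by simp
    also have "\<dots> = 0\<^sub>v (n - m)" using Zb Z(1) ab(2) mult_mat_vec_zero[of "mat_adjoint Z"] by (simp add: mult_vec_assoc_dim)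
    finally show ?thesis using a ab(3) mn by (simp add: append_vec_zero)
  qed
  obtain R where R: "R \<in> carrier_mat n n" "M * R = 1\<^sub>m n" "R * M = 1\<^sub>m n"
    using injective_square_inverse[OF M injM] by blast
  define B where "B = mat_adjoint Z * S * Z"
  have B: "B \<in> carrier_mat (n - m) (n - m)" unfolding B_def using Z(1) S by (intro carrier_matI) auto
  \<comment> \<open>With the condition on the adjoint of \<open>S\<close> read from the left, both
    off-diagonal blocks contain a product of \<open>Y\<close> with \<open>Z\<close> and
    vanish.\<close>
  have XS: "mat_adjoint X * S = P * mat_adjoint Y"
  proof -
    have "mat_adjoint X * S = mat_adjoint (mat_adjoint S * X)" using X S by (simp add: mat_adjoint_mult)
    also have "\<dots> = P * mat_adjoint Y" unfolding SX' using Y P by (simp add: mat_adjoint_mult)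
    finally show ?thesis .
  qed
  have b11: "mat_adjoint X * (S * X) = P"
  proof -
    have "mat_adjoint X * (S * X) = P * (mat_adjoint Y * X)"
      using X Y S P XS by (simp add: mult_assoc_dim[symmetric])
    then show ?thesis using YX P by simp
  qed
  have b12: "mat_adjoint X * (S * Z) = 0\<^sub>m m (n - m)"
  proof -
    have "mat_adjoint X * (S * Z) = mat_adjoint X * S * Z" using X S Z(1) by (simp add: mult_assoc_dim)
    also have "\<dots> = P * (mat_adjoint Y * Z)" unfolding XS using P Y Z(1) by (simp add: mult_assoc_dim)
    finally show ?thesis using Z(2) P by simp
  qed
  have b21: "mat_adjoint Z * (S * X) = 0\<^sub>m (n - m) m"
  proof -
    have "mat_adjoint Z * (S * X) = (mat_adjoint Z * Y) * P" unfolding SX using P Y Z(1) by (simp add: mult_assoc_dim)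
    then show ?thesis using ZY P by simp
  qed
  have MSM: "mat_adjoint M * (S * M) = bdiag P B"
  proof -
    have "S * M = hcat (S * X) (S * Z)" unfolding M_def using X Z(1) by (simp add: mult_hcat)
    then have "mat_adjoint M * (S * M) = four_block_mat (mat_adjoint X * (S * X)) (mat_adjoint X * (S * Z))
        (mat_adjoint Z * (S * X)) (mat_adjoint Z * (S * Z))"
      unfolding M_def using X Z(1) S by (simp add: adjoint_hcat_mult_hcat)
    then show ?thesis
      unfolding b11 b12 b21 bdiag_def B_def using Z(1) S P by (simp add: mult_assoc_dim)
  qed
  have RM: "mat_adjoint R * mat_adjoint M = 1\<^sub>m n" using R M mat_adjoint_mult[of M R] by simp
  have "mat_adjoint R * bdiag P B * R = (mat_adjoint R * mat_adjoint M) * S * (M * R)"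
    unfolding MSM[symmetric] using R(1) M S by (simp add: mult_assoc_dim)
  also have "\<dots> = S" unfolding RM R(2) using S by simp
  finally have dec: "S = mat_adjoint R * bdiag P B * R" by simp
  have cong: "mat_congruent n S (bdiag P B)"
    by (rule mat_congruentI[OF S _ R(1) M R(2) dec]) (use P B mn in \<open>intro carrier_matI, auto\<close>)
  \<comment> \<open>Nonsingularity passes to the remaining block, so the splitting can be
    repeated.\<close>
  have "c = 0\<^sub>v (n - m)" if c: "c \<in> carrier_vec (n - m)" "B *\<^sub>v c = 0\<^sub>v (n - m)" for c
  proof -
    let ?v = "0\<^sub>v m @\<^sub>v c"
    have v: "?v \<in> carrier_vec n" using c mn by (intro carrier_vecI) auto
    have "bdiag P B *\<^sub>v ?v = 0\<^sub>v n"
      using c P B mn mult_mat_vec_zero[of P] by (simp add: bdiag_mult_append append_vec_zero)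
    then have "mat_adjoint M *\<^sub>v (S *\<^sub>v (M *\<^sub>v ?v)) = 0\<^sub>v n"
      unfolding MSM[symmetric] using M S v c mn by (simp add: mult_vec_assoc_dim)
    then have "mat_adjoint R *\<^sub>v (mat_adjoint M *\<^sub>v (S *\<^sub>v (M *\<^sub>v ?v))) = 0\<^sub>v n"
      using mult_mat_vec_zero[of "mat_adjoint R"] R(1) by simp
    moreover have "mat_adjoint R *\<^sub>v (mat_adjoint M *\<^sub>v (S *\<^sub>v (M *\<^sub>v ?v))) = (mat_adjoint R * mat_adjoint M) *\<^sub>v (S *\<^sub>v (M *\<^sub>v ?v))"
      using R(1) M S v by (simp add: mult_vec_assoc_dim)
    moreover have Mv: "M *\<^sub>v ?v \<in> carrier_vec n" using M by (intro carrier_vecI) auto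
    moreover have "S *\<^sub>v (M *\<^sub>v ?v) \<in> carrier_vec n" using S by (intro carrier_vecI) auto
    ultimately have "S *\<^sub>v (M *\<^sub>v ?v) = 0\<^sub>v n" unfolding RM by simp
    then have "?v = 0\<^sub>v n" using inj[OF Mv] injM[OF v] by blast
    then show ?thesis using append_vec_eq_zero[of "0\<^sub>v m" m c "n - m"] c mn by simp
  qed
  then show ?thesis using that[OF mn Z(1)] cong unfolding B_def by blast
qed

lemma smult_vec_zero [simp]: "c \<cdot>\<^sub>v 0\<^sub>v n = (0\<^sub>v n :: complex vec)"
  by (rule eq_vecI) auto

lemma smult_smult_mat: "c \<cdot>\<^sub>m (d \<cdot>\<^sub>m A) = (c * d) \<cdot>\<^sub>m (A :: complex mat)"
  by (rule eq_matI) (auto simp: mult.assoc)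

lemma smult_mat_mult_vec: "dim_vec v = dim_col A \<Longrightarrow> (c \<cdot>\<^sub>m A) *\<^sub>v v = c \<cdot>\<^sub>v (A *\<^sub>v (v :: complex vec))"
  by (rule eq_vecI) (auto simp: scalar_prod_def sum_distrib_left ac_simps)

lemma mult_mat_of_cols1:
  assumes "A \<in> carrier_mat k n" "x \<in> carrier_vec n"
  shows "A * mat_of_cols n [x] = mat_of_cols k [A *\<^sub>v (x :: complex vec)]"
  using assms by (intro eq_matI) (auto simp: mat_of_cols_index)

lemma mult_mat_of_cols2:
  assumes "A \<in> carrier_mat k n" "x \<in> carrier_vec n" "y \<in> carrier_vec n"
  shows "A * mat_of_cols n [x, y] = mat_of_cols k [A *\<^sub>v x, A *\<^sub>v (y :: complex vec)]"
proof (rule eq_matI)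
  fix i j assume "i < dim_row (mat_of_cols k [A *\<^sub>v x, A *\<^sub>v y])" "j < dim_col (mat_of_cols k [A *\<^sub>v x, A *\<^sub>v y])"
  then have "i < k" "j = 0 \<or> j = 1" by auto
  then show "(A * mat_of_cols n [x, y]) $$ (i, j) = mat_of_cols k [A *\<^sub>v x, A *\<^sub>v y] $$ (i, j)"
    using assms by (auto simp: mat_of_cols_index)
qed (use assms in auto)

lemma Re_nonneg_Arg:
  assumes "0 \<le> Re z" shows "\<bar>Arg z\<bar> \<le> pi / 2"
proof (cases "z = 0")
  case False
  have "0 \<le> cos \<bar>Arg z\<bar>" using assms False by (simp add: cos_Arg)
  moreover have "\<bar>Arg z\<bar> \<le> pi" using Arg_bounded[of z] by auto
  moreover have "cos \<bar>Arg z\<bar> < 0" if "pi / 2 < \<bar>Arg z\<bar>"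
    using that \<open>\<bar>Arg z\<bar> \<le> pi\<close> cos_gt_zero_pi[of "pi - \<bar>Arg z\<bar>"] by (simp add: cos_diff)
  ultimately show ?thesis by force
qed (simp add: Arg_zero)

text \<open>If \<open>S\<close> and its adjoint send \<open>x\<close> to conjugate multiples of the
  same vector \<open>G x\<close>, then after normalization \<open>x\<close> carries a diagonal
  entry, the direction of the value of the form at \<open>x\<close>. It is applied with either the
  Hermitian part or the skew part of the rotated matrix as \<open>G\<close>.\<close>

lemma rank_one_block:
  fixes \<theta> :: real
  assumes S: "S \<in> carrier_mat n n" and x: "x \<in> carrier_vec n"
    and G: "G \<in> carrier_mat n n" "mat_adjoint G = G" "qf G x \<noteq> 0"
    and \<mu>: "S *\<^sub>v x = \<mu> \<cdot>\<^sub>v (G *\<^sub>v x)" "mat_adjoint S *\<^sub>v x = cnj \<mu> \<cdot>\<^sub>v (G *\<^sub>v x)" "\<mu> \<noteq> 0"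
    and acc: "0 \<le> Re (cis (- \<theta>) * qf S x)"
  obtains X Y \<psi> where "X \<in> carrier_mat n 1" "Y \<in> carrier_mat n 1" "\<bar>\<psi> - \<theta>\<bar> \<le> pi / 2"
    "mat_adjoint Y * X = 1\<^sub>m 1" "S * X = Y * cis_diag [\<psi>]" "mat_adjoint S * X = Y * mat_adjoint (cis_diag [\<psi>])"
proof -
  define h where "h = Re (qf G x)"
  have qG: "qf G x = of_real h" unfolding h_def by (rule qf_hermitian_real[OF G(1,2) x])
  have h: "h \<noteq> 0" using G(3) qG by auto
  define c where "c = qf S x"
  have c: "c = \<mu> * of_real h" unfolding c_def qf_def \<mu>(1) using x G(1) qG by (simp add: cprod_smult_right qf_def)
  have c0: "c \<noteq> 0" using c h \<mu>(3) by simp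
  \<comment> \<open>The argument is taken after the rotation by \<theta>, where accretivity bounds
    it by pi/2; this puts \<psi> into the window around \<theta> and not merely into the principal
    range.\<close>
  define \<psi> where "\<psi> = \<theta> + Arg (cis (- \<theta>) * c)"
  have "cis \<psi> = cis \<theta> * sgn (cis (- \<theta>) * c)" unfolding \<psi>_def cis_mult[symmetric] using c0 by (simp add: cis_Arg)
  also have "\<dots> = sgn c" using c0 by (simp add: sgn_eq norm_mult cis_mult mult.assoc[symmetric])
  finally have cis\<psi>: "cis \<psi> = c / of_real (cmod c)" by (simp add: sgn_eq)
  define s where "s = 1 / sqrt (cmod c)"
  have s: "s\<^sup>2 * cmod c = 1" using c0 by (simp add: s_def power_divide)
  define x' where "x' = of_real s \<cdot>\<^sub>v x"
  \<comment> \<open>\<open>u\<close> is the multiple of \<open>G x\<close> with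
    \<open>cprod u x' = 1\<close>. Since \<open>h\<close> may be negative, the modulus of
    \<open>c\<close> and not of \<open>\<mu>\<close> fixes the factor.\<close>
  define u where "u = of_real (cmod c / h * s) \<cdot>\<^sub>v (G *\<^sub>v x)"
  have x': "x' \<in> carrier_vec n" and u: "u \<in> carrier_vec n" unfolding x'_def u_def using x G(1) by (auto intro!: carrier_vecI)
  have "\<mu> = c / of_real h" using c h by simp
  then have \<mu>': "\<mu> = cis \<psi> * of_real (cmod c / h)" unfolding cis\<psi> using c0 by simp
  have Sx: "S *\<^sub>v x' = cis \<psi> \<cdot>\<^sub>v u"
    unfolding x'_def u_def using S x \<mu>(1) by (subst mult_mat_vec_scale) (auto simp: \<mu>' smult_smult_assoc ac_simps)
  have Sx': "mat_adjoint S *\<^sub>v x' = cnj (cis \<psi>) \<cdot>\<^sub>v u"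
    unfolding x'_def u_def using S x \<mu>(2) by (subst mult_mat_vec_scale) (auto simp: \<mu>' smult_smult_assoc ac_simps)
  have "cprod u x' = of_real (s\<^sup>2 * cmod c / h) * cprod (G *\<^sub>v x) x"
  proof -
    have "cprod u x' = cnj (of_real (cmod c / h * s)) * of_real s * cprod (G *\<^sub>v x) x"
      unfolding u_def x'_def by (rule cprod_smult) (use x G(1) in auto)
    then show ?thesis by (simp add: power2_eq_square)
  qed
  also have "cprod (G *\<^sub>v x) x = of_real h" using cprod_hermitian(1)[OF G(1,2) x x] qG by (simp add: qf_def)
  also have "of_real (s\<^sup>2 * cmod c / h) * of_real h = (1 :: complex)" using h s by simp
  finally have ux: "cprod u x' = 1" .
  define X where "X = mat_of_cols n [x']"
  define Y where "Y = mat_of_cols n [u]"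
  have XY: "X \<in> carrier_mat n 1" "Y \<in> carrier_mat n 1" unfolding X_def Y_def by auto
  have col: "col Y 0 = u" "col X 0 = x'" unfolding X_def Y_def using u x' by auto
  have diag: "Y * cis_diag [\<psi>] = mat_of_cols n [cis \<psi> \<cdot>\<^sub>v u]" "Y * mat_adjoint (cis_diag [\<psi>]) = mat_of_cols n [cnj (cis \<psi>) \<cdot>\<^sub>v u]"
    unfolding Y_def using u by (intro eq_matI; auto simp: cis_diag_def mat_diag_def scalar_prod_def mat_of_cols_index)+
  have "mat_adjoint Y * X = 1\<^sub>m 1"
    using XY col ux by (intro eq_matI) (auto simp: row_mat_adjoint)
  moreover have "S * X = Y * cis_diag [\<psi>]"
    unfolding diag X_def using S x' Sx by (simp add: mult_mat_of_cols1)
  moreover have "mat_adjoint S * X = Y * mat_adjoint (cis_diag [\<psi>])"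
    unfolding diag X_def using S x' Sx' mult_mat_of_cols1[of "mat_adjoint S" n n x'] by simp
  moreover have "\<bar>\<psi> - \<theta>\<bar> \<le> pi / 2" unfolding \<psi>_def using Re_nonneg_Arg acc by (simp add: c_def)
  ultimately show ?thesis using that XY by blast
qed

lemma E_block_mult_cols:
  assumes "u \<in> carrier_vec n" "v \<in> carrier_vec n"
  shows "mat_of_cols n [u, v] * E_block \<theta> = mat_of_cols n [cis \<theta> \<cdot>\<^sub>v u, cis \<theta> \<cdot>\<^sub>v (2 \<cdot>\<^sub>v u + v)]"
    and "mat_of_cols n [u, v] * mat_adjoint (E_block \<theta>) = mat_of_cols n [cis (- \<theta>) \<cdot>\<^sub>v (u + 2 \<cdot>\<^sub>v v), cis (- \<theta>) \<cdot>\<^sub>v v]"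
  using assms by (intro eq_matI; auto simp: E_block_def mat_of_rows_list_def scalar_prod_def mat_of_cols_index
      atLeast0_lessThan_Suc numeral_2_eq_2 less_Suc_eq cis_cnj algebra_simps)+

text \<open>Write the rotated matrix as \<open>H + i K\<close> with Hermitian \<open>H \<ge> 0\<close> and \<open>K\<close>. A vector of \<open>ker H\<close> on which the form of
  \<open>K\<close> does not vanish or, if \<open>ker H = 0\<close>, an eigenvector of \<open>H\<^sup>-\<^sup>1 K\<close> splits off a diagonal entry. Otherwise the form
  of \<open>K\<close> vanishes on \<open>ker H\<close>, so for \<open>x\<close> in \<open>ker H\<close> the vector \<open>K x\<close> is orthogonal to \<open>ker H\<close>, and a solution \<open>y\<close> of
  \<open>H y = K x\<close> gives the vectors \<open>i x + y\<close> and \<open>y\<close> that span an \<open>E\<close> block.\<close>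

lemma accretive_step:
  fixes \<theta> :: real
  assumes S: "S \<in> carrier_mat n n" and n: "0 < n"
    and acc: "\<And>x. x \<in> carrier_vec n \<Longrightarrow> 0 \<le> Re (cis (- \<theta>) * qf S x)"
    and inj: "\<And>x. x \<in> carrier_vec n \<Longrightarrow> S *\<^sub>v x = 0\<^sub>v n \<Longrightarrow> x = 0\<^sub>v n"
  obtains (diagonal) X Y \<psi> where "X \<in> carrier_mat n 1" "Y \<in> carrier_mat n 1" "\<bar>\<psi> - \<theta>\<bar> \<le> pi / 2"
      "mat_adjoint Y * X = 1\<^sub>m 1" "S * X = Y * cis_diag [\<psi>]" "mat_adjoint S * X = Y * mat_adjoint (cis_diag [\<psi>])"
    | (block) X Y where "X \<in> carrier_mat n 2" "Y \<in> carrier_mat n 2"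
      "mat_adjoint Y * X = 1\<^sub>m 2" "S * X = Y * E_block \<theta>" "mat_adjoint S * X = Y * mat_adjoint (E_block \<theta>)"
proof -
  define A where "A = cis (- \<theta>) \<cdot>\<^sub>m S"
  define H where "H = (1/2) \<cdot>\<^sub>m (A + mat_adjoint A)"
  define K where "K = (- \<i>/2) \<cdot>\<^sub>m (A - mat_adjoint A)"
  have A: "A \<in> carrier_mat n n" and H: "H \<in> carrier_mat n n" and K: "K \<in> carrier_mat n n"
    unfolding H_def K_def A_def using S by (auto intro!: carrier_matI)
  have adjH: "mat_adjoint H = H" unfolding H_def using A by (intro eq_matI) auto
  have adjK: "mat_adjoint K = K" unfolding K_def using A by (intro eq_matI) (auto simp: algebra_simps)
  have "(1/2) * (a + b) + \<i> * ((- \<i>/2) * (a - b)) = a" "(1/2) * (a + b) + (- \<i>) * ((- \<i>/2) * (a - b)) = b" for a b :: complex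
    by (simp_all add: field_simps)
  then have HK: "H + \<i> \<cdot>\<^sub>m K = A" "H + (- \<i>) \<cdot>\<^sub>m K = mat_adjoint A"
    unfolding H_def K_def using A by (auto intro!: eq_matI simp del: minus_mult_left)
  have S_eq: "S = cis \<theta> \<cdot>\<^sub>m (H + \<i> \<cdot>\<^sub>m K)" and S'_eq: "mat_adjoint S = cis (- \<theta>) \<cdot>\<^sub>m (H + (- \<i>) \<cdot>\<^sub>m K)"
    unfolding HK unfolding A_def mat_adjoint_smult smult_smult_mat cis_cnj by (auto simp: cis_mult intro!: eq_matI)
  have Sv: "S *\<^sub>v v = cis \<theta> \<cdot>\<^sub>v (H *\<^sub>v v + \<i> \<cdot>\<^sub>v (K *\<^sub>v v))"
    and S'v: "mat_adjoint S *\<^sub>v v = cis (- \<theta>) \<cdot>\<^sub>v (H *\<^sub>v v + (- \<i>) \<cdot>\<^sub>v (K *\<^sub>v v))" if "v \<in> carrier_vec n" for v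
  proof -
    have "(c \<cdot>\<^sub>m (H + d \<cdot>\<^sub>m K)) *\<^sub>v v = c \<cdot>\<^sub>v (H *\<^sub>v v + d \<cdot>\<^sub>v (K *\<^sub>v v))" for c d
      using H K that by (simp add: smult_mat_mult_vec add_mult_distrib_mat_vec[of H n n "d \<cdot>\<^sub>m K"])
    then show "S *\<^sub>v v = cis \<theta> \<cdot>\<^sub>v (H *\<^sub>v v + \<i> \<cdot>\<^sub>v (K *\<^sub>v v))"
      "mat_adjoint S *\<^sub>v v = cis (- \<theta>) \<cdot>\<^sub>v (H *\<^sub>v v + (- \<i>) \<cdot>\<^sub>v (K *\<^sub>v v))"
      by (subst S_eq S'_eq, blast)+
  qed
  note herm = cprod_hermitian[OF H adjH] cprod_hermitian[OF K adjK]
  have realK: "Re (\<i> * qf K v) = 0" if "v \<in> carrier_vec n" for v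
    using arg_cong[OF qf_hermitian_real[OF K adjK that], of Im] by simp
  have psd: "0 \<le> Re (qf H v)" if v: "v \<in> carrier_vec n" for v
  proof -
    have "cis (- \<theta>) * qf S v = (cis (- \<theta>) * cis \<theta>) * (qf H v + \<i> * qf K v)"
      unfolding qf_def Sv[OF v] using v H K by (simp add: cprod_linear)
    then have "cis (- \<theta>) * qf S v = qf H v + \<i> * qf K v" by (simp add: cis_mult)
    then show ?thesis using acc[OF v] realK[OF v] by simp
  qed
  show ?thesis
  proof (cases "\<exists>g \<in> carrier_vec n. H *\<^sub>v g = 0\<^sub>v n \<and> qf K g \<noteq> 0")
    case True
    then obtain g where g: "g \<in> carrier_vec n" "H *\<^sub>v g = 0\<^sub>v n" "qf K g \<noteq> 0" by blast
    \<comment> \<open>Only the skew part acts on \<open>g\<close>, so the phase split off here is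
      \<theta> + pi/2 or \<theta> - pi/2, according to the sign of the form of
      \<open>K\<close>.\<close>
    have "S *\<^sub>v g = (cis \<theta> * \<i>) \<cdot>\<^sub>v (K *\<^sub>v g)" "mat_adjoint S *\<^sub>v g = cnj (cis \<theta> * \<i>) \<cdot>\<^sub>v (K *\<^sub>v g)"
      unfolding Sv[OF g(1)] S'v[OF g(1)] g(2) using K by (auto simp: cis_cnj intro!: eq_vecI)
    then show ?thesis
      using rank_one_block[OF S g(1) K adjK g(3) _ _ _ acc[OF g(1)], of "cis \<theta> * \<i>"] diagonal by auto
  next
    case False
    then have null: "qf K g = 0" if "g \<in> carrier_vec n" "H *\<^sub>v g = 0\<^sub>v n" for g using that by blast
    show ?thesis
    proof (cases "\<exists>x \<in> carrier_vec n. x \<noteq> 0\<^sub>v n \<and> H *\<^sub>v x = 0\<^sub>v n")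
      case True
      then obtain x0 where x0: "x0 \<in> carrier_vec n" "x0 \<noteq> 0\<^sub>v n" "H *\<^sub>v x0 = 0\<^sub>v n" by blast
      define v where "v = K *\<^sub>v x0"
      have v: "v \<in> carrier_vec n" unfolding v_def using K by (intro carrier_vecI) auto
      have v0: "v \<noteq> 0\<^sub>v n"
      proof
        assume "v = 0\<^sub>v n"
        then have "S *\<^sub>v x0 = 0\<^sub>v n" unfolding Sv[OF x0(1)] x0(3) v_def[symmetric] by auto
        then show False using inj x0 by blast
      qed
      \<comment> \<open>Polarization: the form of \<open>K\<close> vanishes at
        \<open>f + c x0\<close> for every \<open>c\<close>, and \<open>c = 1\<close> and
        \<open>c = i\<close> together make the mixed term vanish.\<close>
      have "cprod f v = 0" if f: "f \<in> carrier_vec n" "H *\<^sub>v f = 0\<^sub>v n" for f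
      proof -
        have "cnj c * cprod x0 (K *\<^sub>v f) + c * cprod f v = 0" for c
        proof -
          define w where "w = f + c \<cdot>\<^sub>v x0"
          have w: "w \<in> carrier_vec n" unfolding w_def using f x0 by simp
          have "H *\<^sub>v w = 0\<^sub>v n" unfolding w_def using f x0 H by (simp add: mult_mat_vec_add mult_mat_vec_scale)
          then have "0 = qf K w" using null w by simp
          also have "\<dots> = qf K f + cnj c * cprod x0 (K *\<^sub>v f) + c * cprod f v + cnj c * c * qf K x0"
            unfolding qf_def w_def v_def using f(1) x0(1) K
            by (simp add: mult_mat_vec_add mult_mat_vec_scale cprod_linear algebra_simps)
          finally show ?thesis using null f x0 by simp
        qed
        from this[of 1] this[of \<i>] show ?thesis by (simp add: complex_eq_iff)
      qed
      then obtain y0 where y0: "y0 \<in> carrier_vec n" "H *\<^sub>v y0 = v"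
        using hermitian_range[OF H adjH v] by blast
      define b where "b = Re (qf H y0)"
      have qHy: "qf H y0 = of_real b" unfolding b_def by (rule qf_hermitian_real[OF H adjH y0(1)])
      have "qf H y0 \<noteq> 0" using psd_null_vector[OF H adjH psd y0(1)] v0 y0(2) by auto
      then have "b \<noteq> 0" using qHy by auto
      moreover have "0 \<le> b" unfolding b_def by (rule psd[OF y0(1)])
      ultimately have b: "0 < b" by simp
      define k where "k = Re (qf K y0)"
      have qKy: "qf K y0 = of_real k" unfolding k_def by (rule qf_hermitian_real[OF K adjK y0(1)])
      have yKx: "cprod y0 (K *\<^sub>v x0) = of_real b" using qHy y0(2) by (simp add: qf_def v_def)
      have xKy: "cprod x0 (K *\<^sub>v y0) = of_real b" using herm(4)[OF x0(1) y0(1)] yKx by simp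
      have xKx: "cprod x0 (K *\<^sub>v x0) = 0" using null[OF x0(1,3)] by (simp add: qf_def)
      have yKy: "cprod y0 (K *\<^sub>v y0) = of_real k" using qKy by (simp add: qf_def)
      \<comment> \<open>The factor \<open>s\<close> normalizes the mixed value \<open>b\<close> of
        \<open>K\<close> to 1. The shift \<open>t\<close> along \<open>x0\<close> cancels the value
        \<open>k\<close> of \<open>K\<close> at \<open>y0\<close> and leaves \<open>H y0\<close>
        unchanged, as \<open>x0\<close> lies in the kernel of \<open>H\<close>.\<close>
      define s where "s = complex_of_real (1 / sqrt b)"
      have s: "s * s * of_real b = 1" "cnj s = s"
        using b unfolding s_def by (simp_all add: of_real_mult[symmetric] del: of_real_mult)
      define t where "t = complex_of_real (- k / (2 * b))"
      have t: "of_real k + 2 * t * of_real b = 0" "cnj t = t"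
        using b unfolding t_def by simp_all
      define x where "x = s \<cdot>\<^sub>v x0"
      define y where "y = s \<cdot>\<^sub>v (y0 + t \<cdot>\<^sub>v x0)"
      have x: "x \<in> carrier_vec n" and y: "y \<in> carrier_vec n" unfolding x_def y_def using x0 y0 by auto
      have Hx: "H *\<^sub>v x = 0\<^sub>v n" unfolding x_def using x0 H by (simp add: mult_mat_vec_scale)
      have Kx: "K *\<^sub>v x = s \<cdot>\<^sub>v v" unfolding x_def v_def using x0 K by (simp add: mult_mat_vec_scale)
      have Hy: "H *\<^sub>v y = K *\<^sub>v x"
        unfolding Kx y_def using x0 y0 H v by (simp add: mult_mat_vec_add mult_mat_vec_scale)
      have Ky: "K *\<^sub>v y = s \<cdot>\<^sub>v (K *\<^sub>v y0 + t \<cdot>\<^sub>v v)"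
        unfolding y_def v_def using x0 y0 K by (simp add: mult_mat_vec_add mult_mat_vec_scale)
      have 1: "cprod x (K *\<^sub>v x) = 0"
        unfolding x_def using x0 K xKx by (simp add: cprod_linear mult_mat_vec_scale)
      have 2: "cprod y (K *\<^sub>v x) = 1"
        unfolding x_def y_def using x0 y0(1) K xKx yKx s by (simp add: cprod_linear mult_mat_vec_scale algebra_simps)
      have 3: "cprod x (K *\<^sub>v y) = 1" using herm(4)[OF x y] 2 by simp
      have "cprod y (K *\<^sub>v y) = s * s * (of_real k + 2 * t * of_real b)"
        unfolding y_def using x0 y0(1) K xKx yKx xKy yKy s(2) t(2)
        by (simp add: cprod_linear mult_mat_vec_add mult_mat_vec_scale algebra_simps)
      then have 4: "cprod y (K *\<^sub>v y) = 0" unfolding t(1) by simp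
      \<comment> \<open>On the basis \<open>x, y\<close> the form of \<open>H + i K\<close> has the
        matrix with rows \<open>0, i\<close> and \<open>i, 1\<close>. The basis \<open>p, y\<close>
        turns it into rows \<open>1, 2\<close> and \<open>0, 1\<close>, and \<open>u, w\<close> is
        the dual basis.\<close>
      define p where "p = \<i> \<cdot>\<^sub>v x + y"
      define u where "u = \<i> \<cdot>\<^sub>v (K *\<^sub>v y)"
      define w where "w = K *\<^sub>v x + (- \<i>) \<cdot>\<^sub>v (K *\<^sub>v y)"
      have p: "p \<in> carrier_vec n" and u: "u \<in> carrier_vec n" and w: "w \<in> carrier_vec n"
        unfolding p_def u_def w_def using x y K by (auto intro!: carrier_vecI)
      have Kxc: "K *\<^sub>v x \<in> carrier_vec n" and Kyc: "K *\<^sub>v y \<in> carrier_vec n" using K by (auto intro!: carrier_vecI)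
      have Hp: "H *\<^sub>v p = K *\<^sub>v x" unfolding p_def using x y H Hx Hy Kxc by (simp add: mult_mat_vec_add mult_mat_vec_scale)
      have Kp: "K *\<^sub>v p = \<i> \<cdot>\<^sub>v (K *\<^sub>v x) + K *\<^sub>v y" unfolding p_def using x y K by (simp add: mult_mat_vec_add mult_mat_vec_scale)
      have sw: "cprod (K *\<^sub>v a) c = cprod a (K *\<^sub>v c)" if "a \<in> carrier_vec n" "c \<in> carrier_vec n" for a c
        using herm(3) that by blast
      have up: "cprod u p = 1" "cprod u y = 0" "cprod w p = 0" "cprod w y = 1"
        unfolding u_def w_def p_def using x y K 1 2 3 4 by (simp_all add: cprod_linear sw algebra_simps)
      define X where "X = mat_of_cols n [p, y]"
      define Y where "Y = mat_of_cols n [u, w]"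
      have XY: "X \<in> carrier_mat n 2" "Y \<in> carrier_mat n 2" unfolding X_def Y_def by auto
      have cols: "col Y 0 = u" "col Y 1 = w" "col X 0 = p" "col X 1 = y"
        unfolding X_def Y_def using p u w y by auto
      have "mat_adjoint Y * X = 1\<^sub>m 2"
      proof (rule eq_matI)
        fix i j assume "i < dim_row (1\<^sub>m 2 :: complex mat)" "j < dim_col (1\<^sub>m 2 :: complex mat)"
        then have "i = 0 \<or> i = 1" "j = 0 \<or> j = 1" by auto
        then show "(mat_adjoint Y * X) $$ (i, j) = 1\<^sub>m 2 $$ (i, j)"
          using XY cols up by (auto simp: row_mat_adjoint)
      qed (use XY in auto)
      moreover have "S * X = Y * E_block \<theta>"
      proof -
        have "S *\<^sub>v p = cis \<theta> \<cdot>\<^sub>v u" unfolding Sv[OF p] Hp Kp u_def using Kxc Kyc by (auto intro!: eq_vecI simp: algebra_simps)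
        moreover have "S *\<^sub>v y = cis \<theta> \<cdot>\<^sub>v (2 \<cdot>\<^sub>v u + w)"
          unfolding Sv[OF y] Hy u_def w_def using Kxc Kyc by (auto intro!: eq_vecI simp: algebra_simps)
        ultimately show ?thesis
          unfolding X_def Y_def E_block_mult_cols(1)[OF u w] mult_mat_of_cols2[OF S p y] by simp
      qed
      moreover have "mat_adjoint S * X = Y * mat_adjoint (E_block \<theta>)"
      proof -
        have "mat_adjoint S *\<^sub>v p = cis (- \<theta>) \<cdot>\<^sub>v (u + 2 \<cdot>\<^sub>v w)"
          unfolding S'v[OF p] Hp Kp u_def w_def using Kxc Kyc by (auto intro!: eq_vecI simp: algebra_simps)
        moreover have "mat_adjoint S *\<^sub>v y = cis (- \<theta>) \<cdot>\<^sub>v w"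
          unfolding S'v[OF y] Hy u_def w_def ..
        ultimately show ?thesis
          unfolding X_def Y_def E_block_mult_cols(2)[OF u w] mult_mat_of_cols2[OF mat_adjoint_carrier[OF S] p y] by simp
      qed
      ultimately show ?thesis using block XY by blast
    next
      case False
      then have injH: "x = 0\<^sub>v n" if "x \<in> carrier_vec n" "H *\<^sub>v x = 0\<^sub>v n" for x using that by blast
      obtain R where R: "R \<in> carrier_mat n n" "H * R = 1\<^sub>m n"
        using injective_square_inverse[OF H injH] by blast
      have "R * K \<in> carrier_mat n n" using R K by auto
      then obtain x l where x: "x \<in> carrier_vec n" "x \<noteq> 0\<^sub>v n" "(R * K) *\<^sub>v x = l \<cdot>\<^sub>v x"
        using complex_eigenvector_exists[OF _ n] by blast
      have Hxc: "H *\<^sub>v x \<in> carrier_vec n" using H by (intro carrier_vecI) auto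
      have "K *\<^sub>v x = (H * R * K) *\<^sub>v x" unfolding R(2) using K by simp
      also have "\<dots> = H *\<^sub>v ((R * K) *\<^sub>v x)" using H R(1) K x(1) by (simp add: mult_vec_assoc_dim)
      also have "\<dots> = l \<cdot>\<^sub>v (H *\<^sub>v x)" unfolding x(3) using H x(1) by (simp add: mult_mat_vec_scale)
      finally have Kx: "K *\<^sub>v x = l \<cdot>\<^sub>v (H *\<^sub>v x)" .
      have qH: "qf H x \<noteq> 0" using psd_null_vector[OF H adjH psd x(1)] injH x(1,2) by blast
      have "qf K x = l * qf H x" unfolding qf_def Kx using x(1) H by (simp add: cprod_linear)
      \<comment> \<open>A quotient of values of two Hermitian forms is real. Hence
        \<open>1 + i l\<close> is nonzero, and the adjoint of \<open>S\<close> produces the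
        conjugate factor.\<close>
      then have "l = of_real (Re (qf K x) / Re (qf H x))"
        using qH qf_hermitian_real[OF H adjH x(1)] qf_hermitian_real[OF K adjK x(1)]
        by (metis nonzero_mult_div_cancel_right of_real_divide)
      then have l: "cnj l = l" "Im l = 0" by simp_all
      have "1 + \<i> * l \<noteq> 0" using l(2) by (auto simp: complex_eq_iff)
      moreover have "S *\<^sub>v x = (cis \<theta> * (1 + \<i> * l)) \<cdot>\<^sub>v (H *\<^sub>v x)"
        "mat_adjoint S *\<^sub>v x = cnj (cis \<theta> * (1 + \<i> * l)) \<cdot>\<^sub>v (H *\<^sub>v x)"
        unfolding Sv[OF x(1)] S'v[OF x(1)] Kx using Hxc l(1) by (auto simp: cis_cnj algebra_simps intro!: eq_vecI)
      ultimately show ?thesis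
        using rank_one_block[OF S x(1) H adjH qH _ _ _ acc[OF x(1)], of "cis \<theta> * (1 + \<i> * l)"] diagonal by auto
    qed
  qed
qed

text \<open>Strong induction on the dimension: the block left after a splitting is a compression of
  \<open>S\<close>, so it is accretive again, and it is again nonsingular.\<close>

lemma accretive_canonical_form:
  fixes \<theta> :: real
  assumes "S \<in> carrier_mat n n"
    and "\<And>x. x \<in> carrier_vec n \<Longrightarrow> 0 \<le> Re (cis (- \<theta>) * qf S x)"
    and "\<And>x. x \<in> carrier_vec n \<Longrightarrow> S *\<^sub>v x = 0\<^sub>v n \<Longrightarrow> x = 0\<^sub>v n"
  obtains \<psi>s q where "set \<psi>s \<subseteq> {\<theta> - pi / 2 .. \<theta> + pi / 2}" "sorted_wrt (\<ge>) \<psi>s" "length \<psi>s + 2 * q = n"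
    "mat_congruent n S (bdiag (cis_diag \<psi>s) (E_blocks q \<theta>))"
proof -
  let ?L = "\<lambda>\<psi>s q. map (\<lambda>\<psi>. cis_diag [\<psi>]) \<psi>s @ replicate q (E_block \<theta>)"
  have sq: "square_mat B" if "B \<in> set (?L \<psi>s q)" for B \<psi>s q using that by auto
  have dim: "sum_list (map dim_row (?L \<psi>s q)) = length \<psi>s + 2 * q" for \<psi>s q
    by (induction \<psi>s) (auto simp: sum_list_replicate)
  have "\<exists>\<psi>s q. set \<psi>s \<subseteq> {\<theta> - pi / 2 .. \<theta> + pi / 2} \<and> length \<psi>s + 2 * q = n \<and> mat_congruent n S (diag_block_mat (?L \<psi>s q))"
    using assms
  proof (induction n arbitrary: S rule: less_induct)
    case (less n)
    note S = less.prems(1) and acc = less.prems(2) and inj = less.prems(3)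
    show ?case
    proof (cases "n = 0")
      case True
      then have "S = 0\<^sub>m 0 0" using S by (intro eq_matI) auto
      then show ?thesis using True by (intro exI[of _ "[]"] exI[of _ 0]) (auto intro!: mat_congruent_refl)
    next
      case False
      have step: "\<exists>\<psi>s q. set \<psi>s \<subseteq> {\<theta> - pi / 2 .. \<theta> + pi / 2} \<and> length \<psi>s + 2 * q = n - m \<and>
          mat_congruent n S (bdiag P (diag_block_mat (?L \<psi>s q)))"
        if P: "P \<in> carrier_mat m m" "0 < m" "m \<le> n" and Z: "Z \<in> carrier_mat n (n - m)"
          and cong: "mat_congruent n S (bdiag P (mat_adjoint Z * S * Z))"
          and injZ: "\<And>c. c \<in> carrier_vec (n - m) \<Longrightarrow> (mat_adjoint Z * S * Z) *\<^sub>v c = 0\<^sub>v (n - m) \<Longrightarrow> c = 0\<^sub>v (n - m)"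
        for P m Z
      proof -
        have "mat_adjoint Z * S * Z \<in> carrier_mat (n - m) (n - m)" using Z S by (intro carrier_matI) auto
        moreover have "0 \<le> Re (cis (- \<theta>) * qf (mat_adjoint Z * S * Z) c)" if c: "c \<in> carrier_vec (n - m)" for c
        proof -
          have "Z *\<^sub>v c \<in> carrier_vec n" using Z by (intro carrier_vecI) auto
          then show ?thesis using acc[of "Z *\<^sub>v c"] Z S c by (subst qf_congruence) auto
        qed
        moreover have "n - m < n" using P False by simp
        ultimately obtain \<psi>s q where IH: "set \<psi>s \<subseteq> {\<theta> - pi / 2 .. \<theta> + pi / 2}" "length \<psi>s + 2 * q = n - m"
            "mat_congruent (n - m) (mat_adjoint Z * S * Z) (diag_block_mat (?L \<psi>s q))"
          using less.IH[OF _ _ _ injZ] by blast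
        have "mat_congruent n (bdiag P (mat_adjoint Z * S * Z)) (bdiag P (diag_block_mat (?L \<psi>s q)))"
          using mat_congruent_bdiag[OF mat_congruent_refl[OF P(1)] IH(3)] P(3) by simp
        then show ?thesis using mat_congruent_trans[OF cong] IH(1,2) by blast
      qed
      have n: "0 < n" using False by simp
      show ?thesis
      proof (rule accretive_step[OF S n acc inj])
        fix X Y \<psi> assume diagonal: "X \<in> carrier_mat n 1" "Y \<in> carrier_mat n 1" "\<bar>\<psi> - \<theta>\<bar> \<le> pi / 2"
          "mat_adjoint Y * X = 1\<^sub>m 1" "S * X = Y * cis_diag [\<psi>]" "mat_adjoint S * X = Y * mat_adjoint (cis_diag [\<psi>])"
        obtain Z where Z: "1 \<le> n" "Z \<in> carrier_mat n (n - 1)" "mat_congruent n S (bdiag (cis_diag [\<psi>]) (mat_adjoint Z * S * Z))"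
          "\<And>c. c \<in> carrier_vec (n - 1) \<Longrightarrow> (mat_adjoint Z * S * Z) *\<^sub>v c = 0\<^sub>v (n - 1) \<Longrightarrow> c = 0\<^sub>v (n - 1)"
          using split_off_block[OF S diagonal(1,2) _ diagonal(4-6) inj] cis_diag_carrier[of "[\<psi>]"] by auto
        obtain \<psi>s q where *: "set \<psi>s \<subseteq> {\<theta> - pi / 2 .. \<theta> + pi / 2}" "length \<psi>s + 2 * q = n - 1"
          "mat_congruent n S (bdiag (cis_diag [\<psi>]) (diag_block_mat (?L \<psi>s q)))"
          using step[OF _ _ Z] cis_diag_carrier[of "[\<psi>]"] by auto
        have eq: "bdiag (cis_diag [\<psi>]) (diag_block_mat (?L \<psi>s q)) = diag_block_mat (?L (\<psi> # \<psi>s) q)"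
          by (simp only: list.map append.simps diag_block_mat_Cons_bdiag)
        have "\<psi> \<in> {\<theta> - pi / 2 .. \<theta> + pi / 2}" using diagonal(3) unfolding atLeastAtMost_iff abs_le_iff by linarith
        then have c1: "set (\<psi> # \<psi>s) \<subseteq> {\<theta> - pi / 2 .. \<theta> + pi / 2}" using *(1) by simp
        have c2: "length (\<psi> # \<psi>s) + 2 * q = n" using *(2) Z(1) by simp
        show ?thesis by (intro exI[of _ "\<psi> # \<psi>s"] exI[of _ q] conjI c1 c2 *(3)[unfolded eq])
      next
        fix X Y assume block: "X \<in> carrier_mat n 2" "Y \<in> carrier_mat n 2"
          "mat_adjoint Y * X = 1\<^sub>m 2" "S * X = Y * E_block \<theta>" "mat_adjoint S * X = Y * mat_adjoint (E_block \<theta>)"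
        obtain Z where Z: "2 \<le> n" "Z \<in> carrier_mat n (n - 2)" "mat_congruent n S (bdiag (E_block \<theta>) (mat_adjoint Z * S * Z))"
          "\<And>c. c \<in> carrier_vec (n - 2) \<Longrightarrow> (mat_adjoint Z * S * Z) *\<^sub>v c = 0\<^sub>v (n - 2) \<Longrightarrow> c = 0\<^sub>v (n - 2)"
          using split_off_block[OF S block(1,2) E_block_carrier block(3-5) inj] by blast
        obtain \<psi>s q where *: "set \<psi>s \<subseteq> {\<theta> - pi / 2 .. \<theta> + pi / 2}" "length \<psi>s + 2 * q = n - 2"
          "mat_congruent n S (bdiag (E_block \<theta>) (diag_block_mat (?L \<psi>s q)))"
          using step[OF E_block_carrier zero_less_numeral Z] by blast
        have eq: "bdiag (E_block \<theta>) (diag_block_mat (?L \<psi>s q)) = diag_block_mat (E_block \<theta> # ?L \<psi>s q)"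
          by (simp only: diag_block_mat_Cons_bdiag)
        have d: "sum_list (map dim_row (E_block \<theta> # ?L \<psi>s q)) = n"
          using dim[of \<psi>s q] *(2) Z(1) by simp
        \<comment> \<open>The new E block stands in front of the diagonal entries found by the
          recursion and is moved behind them.\<close>
        have perm: "mat_congruent n (diag_block_mat (E_block \<theta> # ?L \<psi>s q)) (diag_block_mat (?L \<psi>s (Suc q)))"
          unfolding d[symmetric] by (rule mat_congruent_perm) auto
        have c1: "mat_congruent n S (diag_block_mat (?L \<psi>s (Suc q)))"
          by (rule mat_congruent_trans[OF *(3)[unfolded eq] perm])
        have c2: "length \<psi>s + 2 * Suc q = n" using *(2) Z(1) by simp
        show ?thesis by (intro exI[of _ \<psi>s] exI[of _ "Suc q"] conjI *(1) c1 c2)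
      qed
    qed
  qed
  then obtain \<psi>s q where *: "set \<psi>s \<subseteq> {\<theta> - pi / 2 .. \<theta> + pi / 2}" "length \<psi>s + 2 * q = n"
      "mat_congruent n S (diag_block_mat (?L \<psi>s q))" by blast
  \<comment> \<open>The order of the entries is left open during the induction; one final
    permutation makes them descending.\<close>
  define \<psi>s' where "\<psi>s' = rev (sort \<psi>s)"
  have "mat_congruent n (diag_block_mat (?L \<psi>s q)) (diag_block_mat (?L \<psi>s' q))"
    using mat_congruent_perm[of "?L \<psi>s q" "?L \<psi>s' q"] sq[of _ \<psi>s q] dim[of \<psi>s q] *(2) by (simp add: \<psi>s'_def)
  then have "mat_congruent n S (diag_block_mat (?L \<psi>s' q))" using *(3) mat_congruent_trans by blast
  then have "mat_congruent n S (bdiag (cis_diag \<psi>s') (E_blocks q \<theta>))"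
    by (simp add: diag_block_mat_append_bdiag diag_block_mat_cis_diag)
  moreover have "sorted_wrt (\<ge>) \<psi>s'" unfolding \<psi>s'_def by (simp add: sorted_wrt_rev)
  ultimately show ?thesis using that[of \<psi>s' q] * by (simp add: \<psi>s'_def)
qed

section \<open>Cones and field angles\<close>

text \<open>The closed sector of half-angle \<open>h \<le> \<pi>/2\<close> around the positive real axis, in the form of linear
  inequalities so that it is visibly closed under sums.\<close>

definition cone_0 :: "real \<Rightarrow> complex set" where
  "cone_0 h = {w. 0 \<le> Re w \<and> cos h * \<bar>Im w\<bar> \<le> sin h * Re w}"

lemma cone_0_zero: "0 \<in> cone_0 h"
  unfolding cone_0_def by simp

lemma cone_0_add:
  assumes "0 \<le> h" "h \<le> pi / 2" "v \<in> cone_0 h" "w \<in> cone_0 h"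
  shows "v + w \<in> cone_0 h"
proof -
  have "0 \<le> cos h" using assms by (intro cos_ge_zero) auto
  then have "cos h * \<bar>Im v + Im w\<bar> \<le> cos h * \<bar>Im v\<bar> + cos h * \<bar>Im w\<bar>"
    by (metis abs_triangle_ineq distrib_left mult_left_mono)
  then show ?thesis using assms unfolding cone_0_def by (auto simp: distrib_left)
qed

lemma cone_0_scale: "0 \<le> r \<Longrightarrow> w \<in> cone_0 h \<Longrightarrow> of_real r * w \<in> cone_0 h"
  unfolding cone_0_def by (auto simp: abs_mult mult.left_commute[of _ r] intro: mult_left_mono)

lemma cone_0_scale_iff: "0 < r \<Longrightarrow> of_real r * w \<in> cone_0 h \<longleftrightarrow> w \<in> cone_0 h"
  using cone_0_scale[of r w h] cone_0_scale[of "1 / r" "of_real r * w" h] by auto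

lemma cone_0_sum:
  assumes "0 \<le> h" "h \<le> pi / 2" "\<And>i. i \<in> I \<Longrightarrow> f i \<in> cone_0 h"
  shows "(\<Sum>i\<in>I. f i) \<in> cone_0 h"
  using assms(3) by (induction I rule: infinite_finite_induct) (auto intro: cone_0_zero cone_0_add[OF assms(1,2)])

text \<open>At \<open>cis \<delta>\<close> the inequality of the sector becomes
  \<open>0 \<le> sin (h - \<bar>\<delta>\<bar>)\<close>, and the sine is increasing between - pi/2
  and pi/2.\<close>

lemma cis_in_cone_0:
  assumes h: "0 \<le> h" "h \<le> pi / 2" and \<delta>: "\<bar>\<delta>\<bar> \<le> pi / 2"
  shows "cis \<delta> \<in> cone_0 h \<longleftrightarrow> \<bar>\<delta>\<bar> \<le> h"
proof -
  have "0 \<le> sin \<bar>\<delta>\<bar>" using \<delta> by (intro sin_ge_zero) auto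
  then have "\<bar>sin \<delta>\<bar> = sin \<bar>\<delta>\<bar>" by (cases "0 \<le> \<delta>") auto
  moreover have "cos \<delta> = cos \<bar>\<delta>\<bar>" by simp
  moreover have "0 \<le> cos \<delta>" using \<delta> by (intro cos_ge_zero) auto
  ultimately have "cis \<delta> \<in> cone_0 h \<longleftrightarrow> 0 \<le> sin (h - \<bar>\<delta>\<bar>)"
    unfolding cone_0_def sin_diff by (auto simp: mult.commute)
  also have "\<dots> \<longleftrightarrow> sin 0 \<le> sin (h - \<bar>\<delta>\<bar>)" by simp
  also have "\<dots> \<longleftrightarrow> 0 \<le> h - \<bar>\<delta>\<bar>" by (rule sin_mono_le_eq) (use h \<delta> in auto)
  finally show ?thesis by simp
qed

lemma half_plane_cone_0: "w \<in> cone_0 (pi / 2) \<longleftrightarrow> 0 \<le> Re w"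
  unfolding cone_0_def by auto

lemma cone_0_Arg:
  assumes h: "0 \<le> h" "h \<le> pi / 2" and w: "w \<in> cone_0 h" "w \<noteq> 0"
  shows "\<bar>Arg w\<bar> \<le> h"
proof -
  have "w = of_real (cmod w) * cis (Arg w)" using rcis_cmod_Arg[of w] unfolding rcis_def by simp
  then have "cis (Arg w) \<in> cone_0 h" using w cone_0_scale_iff[of "cmod w" "cis (Arg w)" h] by simp
  moreover have "\<bar>Arg w\<bar> \<le> pi / 2" using w(1) by (intro Re_nonneg_Arg) (simp add: cone_0_def)
  ultimately show ?thesis using cis_in_cone_0[OF h] by blast
qed

lemma angular_numerical_range_qf:
  "S \<in> carrier_mat n n \<Longrightarrow> angular_numerical_range S = {qf S x | x. x \<in> carrier_vec n \<and> x \<noteq> 0\<^sub>v n}"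
  unfolding angular_numerical_range_def qf_def by auto

lemma numerical_range_qf:
  "S \<in> carrier_mat n n \<Longrightarrow> numerical_range S = {qf S x | x. x \<in> carrier_vec n \<and> cprod x x = 1}"
  unfolding numerical_range_def qf_def by auto

lemma subtended_angle_bounds:
  shows "subtended_angle K \<le> pi"
    and "z \<in> K \<Longrightarrow> w \<in> K \<Longrightarrow> z \<noteq> 0 \<Longrightarrow> w \<noteq> 0 \<Longrightarrow> \<bar>Arg (z / w)\<bar> \<le> subtended_angle K"
proof -
  let ?A = "insert 0 {\<bar>Arg (z / w)\<bar> | z w. z \<in> K \<and> w \<in> K \<and> z \<noteq> 0 \<and> w \<noteq> 0}"
  have le: "a \<le> pi" if "a \<in> ?A" for a
  proof -
    have "\<bar>Arg u\<bar> \<le> pi" for u using Arg_bounded[of u] by auto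
    then show ?thesis using that by auto
  qed
  show "subtended_angle K \<le> pi" unfolding subtended_angle_def by (rule cSup_least) (use le in auto)
  have "bdd_above ?A" using le by (rule bdd_aboveI)
  then show "z \<in> K \<Longrightarrow> w \<in> K \<Longrightarrow> z \<noteq> 0 \<Longrightarrow> w \<noteq> 0 \<Longrightarrow> \<bar>Arg (z / w)\<bar> \<le> subtended_angle K"
    unfolding subtended_angle_def by (intro cSup_upper) auto
qed

text \<open>The line branch gives pi and the subtended angle is at most pi, so only the whole plane
  exceeds it. In this form semi-sectoriality passes to matrices with a smaller angular numerical
  range.\<close>

lemma field_angle_le_pi_iff: "field_angle C \<le> pi \<longleftrightarrow> angular_numerical_range C \<noteq> UNIV"
  unfolding field_angle_def Let_def using subtended_angle_bounds(1) by auto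

text \<open>With a unique line the angle is pi by definition, otherwise as a supremum. Angles only
  close to pi are demanded because an E block yields an open half-plane with the origin, where pi is
  not attained.\<close>

lemma field_angle_eq_pi:
  assumes "angular_numerical_range C \<noteq> UNIV"
    and "\<And>t. 0 < t \<Longrightarrow> t < pi \<Longrightarrow> \<exists>z \<in> angular_numerical_range C. \<exists>w \<in> angular_numerical_range C.
      z \<noteq> 0 \<and> w \<noteq> 0 \<and> t \<le> \<bar>Arg (z / w)\<bar>"
  shows "field_angle C = pi"
proof -
  have "t \<le> subtended_angle (angular_numerical_range C)" if "0 < t" "t < pi" for t
    using assms(2)[OF that] subtended_angle_bounds(2) by (meson order_trans)
  then have "pi \<le> subtended_angle (angular_numerical_range C)"
    by (intro dense_le_bounded[of 0 pi]) auto
  then have "subtended_angle (angular_numerical_range C) = pi" using subtended_angle_bounds(1) by (metis antisym)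
  then show ?thesis using assms(1) unfolding field_angle_def Let_def by simp
qed

text \<open>A sector of half-angle below pi/2 contains no line through the origin, and two of its
  directions differ by at most \<open>2 * h\<close>.\<close>

lemma field_angle_less_pi:
  assumes S: "S \<in> carrier_mat n n" and h: "0 \<le> h" "h < pi / 2"
    and cone: "\<And>x. x \<in> carrier_vec n \<Longrightarrow> cis (- c) * qf S x \<in> cone_0 h"
  shows "field_angle S < pi"
proof -
  define K where "K = angular_numerical_range S"
  have K: "cis (- c) * z \<in> cone_0 h" if "z \<in> K" for z
    using that cone unfolding K_def angular_numerical_range_qf[OF S] by auto
  have cos: "0 < cos h" using h by (intro cos_gt_zero_pi) auto
  have no_line: "\<not> (line_through_0 L \<and> L \<subseteq> K)" for L
  proof
    assume L: "line_through_0 L \<and> L \<subseteq> K"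
    then obtain z where z: "z \<noteq> 0" "L = range (\<lambda>t. of_real t * z)" unfolding line_through_0_def by blast
    have "of_real 1 * z \<in> K" "of_real (- 1) * z \<in> K" using L z(2) by blast+
    then have "cis (- c) * z \<in> cone_0 h" "- (cis (- c) * z) \<in> cone_0 h" using K[of z] K[of "- z"] by auto
    then have Re: "Re (cis (- c) * z) = 0" and "cos h * \<bar>Im (cis (- c) * z)\<bar> \<le> sin h * Re (cis (- c) * z)"
      unfolding cone_0_def mem_Collect_eq uminus_complex.sel by linarith+
    then have "Im (cis (- c) * z) = 0" using cos by (simp add: mult_le_0_iff del: times_complex.sel)
    then have "cis (- c) * z = 0" using Re by (metis complex_eqI zero_complex.sel)
    then show False using z(1) by simp
  qed
  have "line_through_0 (range (\<lambda>t. of_real t * 1))" unfolding line_through_0_def using one_neq_zero by blast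
  then have "K \<noteq> UNIV" using no_line by blast
  then have "field_angle S = subtended_angle K"
    unfolding field_angle_def Let_def K_def[symmetric] using no_line by auto
  also have "\<dots> \<le> 2 * h"
    unfolding subtended_angle_def
  proof (rule cSup_least)
    fix a assume "a \<in> insert 0 {\<bar>Arg (z / w)\<bar> | z w. z \<in> K \<and> w \<in> K \<and> z \<noteq> 0 \<and> w \<noteq> 0}"
    then consider "a = 0" | z w where "a = \<bar>Arg (z / w)\<bar>" "z \<in> K" "w \<in> K" "z \<noteq> 0" "w \<noteq> 0" by auto
    then show "a \<le> 2 * h"
    proof cases
      case 2
      define z' where "z' = cis (- c) * z"
      define w' where "w' = cis (- c) * w"
      have nz: "z' \<noteq> 0" "w' \<noteq> 0" using 2 by (auto simp: z'_def w'_def)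
      have A: "\<bar>Arg z'\<bar> \<le> h" "\<bar>Arg w'\<bar> \<le> h"
        using cone_0_Arg[of h] K[OF 2(2)] K[OF 2(3)] nz h unfolding z'_def w'_def by auto
      have "z / w = z' / w'" unfolding z'_def w'_def by simp
      moreover have "sgn (z' / w') = cis (Arg z' - Arg w')"
        using nz by (simp add: sgn_divide cis_Arg[symmetric] cis_divide)
      \<comment> \<open>The difference of the arguments has modulus at most
        \<open>2 * h < pi\<close>, so it is itself the principal argument.\<close>
      ultimately have "Arg (z / w) = Arg z' - Arg w'"
        using A h by (intro cis_Arg_unique) auto
      then show ?thesis using 2(1) A by auto
    qed (use h in auto)
  qed simp
  finally show ?thesis using h by simp
qed

section \<open>Numerical ranges of Hermitian matrices\<close>

text \<open>The spectral theorem on the level of forms: the orthogonal complement of a unit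
  eigenvector is invariant, so the mixed terms vanish and the induction continues on the compression
  to it.\<close>

lemma hermitian_spectral:
  assumes "G \<in> carrier_mat n n" "mat_adjoint G = G"
  shows "\<exists>U \<in> carrier_mat n n. \<exists>ls. mat_adjoint U * U = 1\<^sub>m n \<and> length ls = n \<and>
    (\<forall>y \<in> carrier_vec n. qf G (U *\<^sub>v y) = of_real (\<Sum>i<n. ls ! i * (cmod (y $ i))\<^sup>2))"
  using assms
proof (induction n arbitrary: G)
  case 0
  then show ?case
    by (intro bexI[of _ "1\<^sub>m 0"] exI[of _ "[]"]) (auto simp: qf_def scalar_prod_def)
next
  case (Suc n)
  note G = Suc.prems
  obtain x0 l where x0: "x0 \<in> carrier_vec (Suc n)" "x0 \<noteq> 0\<^sub>v (Suc n)" "G *\<^sub>v x0 = l \<cdot>\<^sub>v x0"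
    using complex_eigenvector_exists[OF G(1)] by auto
  obtain c where c: "c \<noteq> 0" "cprod (c \<cdot>\<^sub>v x0) (c \<cdot>\<^sub>v x0) = 1" using unit_multiple[of x0] x0 by auto
  define x where "x = c \<cdot>\<^sub>v x0"
  have x: "x \<in> carrier_vec (Suc n)" "cprod x x = 1" unfolding x_def using x0 c by auto
  have Gx: "G *\<^sub>v x = l \<cdot>\<^sub>v x" unfolding x_def using x0 G by (simp add: mult_mat_vec_scale smult_smult_assoc mult.commute)
  have "qf G x = l" unfolding qf_def Gx using x by (simp add: cprod_linear)
  then have l: "l = of_real (Re l)" using qf_hermitian_real[OF G x(1)] by simp
  define X where "X = mat_of_cols (Suc n) [x]"
  have X: "X \<in> carrier_mat (Suc n) 1" and colX: "col X 0 = x" unfolding X_def using x by auto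
  obtain Z where Z: "Z \<in> carrier_mat (Suc n) n" "mat_adjoint X * Z = 0\<^sub>m 1 n" "mat_adjoint Z * Z = 1\<^sub>m n"
    using orthonormal_complement[OF X, of n] by auto
  have ZX: "mat_adjoint Z * X = 0\<^sub>m n 1"
    using mat_adjoint_mult[of "mat_adjoint X" Z] X Z by simp
  have XX: "mat_adjoint X * X = 1\<^sub>m 1" using X colX x by (intro eq_matI) (auto simp: row_mat_adjoint)
  define W where "W = hcat X Z"
  have W: "W \<in> carrier_mat (Suc n) (Suc n)" using hcat_carrier[OF X Z(1)] by (simp add: W_def)
  have WW: "mat_adjoint W * W = 1\<^sub>m (Suc n)"
    unfolding W_def using X Z XX ZX by (simp add: adjoint_hcat_mult_hcat)
  define G' where "G' = mat_adjoint Z * G * Z"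
  have G': "G' \<in> carrier_mat n n" "mat_adjoint G' = G'"
    unfolding G'_def using Z(1) G by (auto intro!: carrier_matI simp: mat_adjoint_mult mult_assoc_dim)
  obtain U ls where U: "U \<in> carrier_mat n n" "mat_adjoint U * U = 1\<^sub>m n" "length ls = n"
      "\<And>y. y \<in> carrier_vec n \<Longrightarrow> qf G' (U *\<^sub>v y) = of_real (\<Sum>i<n. ls ! i * (cmod (y $ i))\<^sup>2)"
    using Suc.IH[OF G'] by blast
  define V where "V = W * bdiag (1\<^sub>m 1) U"
  have V: "V \<in> carrier_mat (Suc n) (Suc n)" unfolding V_def using W U(1) by (intro carrier_matI) auto
  have "mat_adjoint V * V = bdiag (1\<^sub>m 1) (mat_adjoint U) * ((mat_adjoint W * W) * bdiag (1\<^sub>m 1) U)"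
    unfolding V_def using W U(1) by (simp add: mat_adjoint_mult mat_adjoint_bdiag mult_assoc_dim)
  also have "\<dots> = bdiag (1\<^sub>m 1) (mat_adjoint U) * bdiag (1\<^sub>m 1) U"
    unfolding WW using U(1) by simp
  also have "\<dots> = 1\<^sub>m (Suc n)" using U(1,2) by (simp add: bdiag_mult bdiag_one)
  finally have VV: "mat_adjoint V * V = 1\<^sub>m (Suc n)" .
  have "qf G (V *\<^sub>v y) = of_real (\<Sum>i<Suc n. (Re l # ls) ! i * (cmod (y $ i))\<^sup>2)" if y: "y \<in> carrier_vec (Suc n)" for y
  proof -
    have y': "y \<in> carrier_vec (1 + n)" using y by simp
    obtain a b where ab: "a \<in> carrier_vec 1" "b \<in> carrier_vec n" "y = a @\<^sub>v b" by (rule split_vec[OF y'])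
    have Xa: "X *\<^sub>v a = (a $ 0) \<cdot>\<^sub>v x"
      unfolding X_def using ab(1) x(1) by (intro eq_vecI) (auto simp: scalar_prod_def mat_of_cols_index mult.commute)
    define z where "z = Z *\<^sub>v (U *\<^sub>v b)"
    have z: "z \<in> carrier_vec (Suc n)" unfolding z_def using Z(1) by (intro carrier_vecI) auto
    have "V *\<^sub>v y = hcat X Z *\<^sub>v (a @\<^sub>v (U *\<^sub>v b))"
      unfolding V_def W_def using X Z(1) U(1) ab by (simp add: mult_vec_assoc_dim bdiag_mult_append)
    also have "\<dots> = (a $ 0) \<cdot>\<^sub>v x + z"
      using X Z(1) U(1) ab Xa by (subst hcat_mult_append) (auto simp: z_def)
    finally have Vy: "V *\<^sub>v y = (a $ 0) \<cdot>\<^sub>v x + z" .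
    have xz: "cprod x z = 0"
    proof -
      have "(mat_adjoint X *\<^sub>v z) = (mat_adjoint X * Z) *\<^sub>v (U *\<^sub>v b)"
        unfolding z_def using X Z(1) U(1) by (simp add: mult_vec_assoc_dim)
      also have "\<dots> = 0\<^sub>v 1" unfolding Z(2) using U(1) by (intro eq_vecI) (auto simp: scalar_prod_def)
      finally have "(mat_adjoint X *\<^sub>v z) $ 0 = 0" by simp
      then show ?thesis using X colX by (simp add: row_mat_adjoint)
    qed
    then have zx: "cprod z x = 0" using cprod_commute[of z x] x z by simp
    have "cprod x (G *\<^sub>v z) = cprod (G *\<^sub>v x) z" using cprod_hermitian(1)[OF G x(1) z] by simp
    then have xGz: "cprod x (G *\<^sub>v z) = 0" unfolding Gx using xz x(1) z by (simp add: cprod_linear)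
    have "qf G (V *\<^sub>v y) = cnj (a $ 0) * (a $ 0) * l + qf G z"
      unfolding Vy qf_def using x z G(1) Gx zx xGz
      by (simp add: mult_mat_vec_add mult_mat_vec_scale cprod_linear algebra_simps)
    also have "qf G z = qf G' (U *\<^sub>v b)"
      unfolding G'_def z_def using Z(1) G(1) U(1) by (intro qf_congruence[symmetric]) auto
    also have "\<dots> = of_real (\<Sum>i<n. ls ! i * (cmod (b $ i))\<^sup>2)" by (rule U(4)[OF ab(2)])
    also have "cnj (a $ 0) * (a $ 0) * l = of_real (Re l * (cmod (a $ 0))\<^sup>2)"
      by (subst l) (simp add: complex_norm_square mult.commute del: of_real_power)
    also have "of_real (Re l * (cmod (a $ 0))\<^sup>2) + of_real (\<Sum>i<n. ls ! i * (cmod (b $ i))\<^sup>2) =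
        (of_real (\<Sum>i<Suc n. (Re l # ls) ! i * (cmod (y $ i))\<^sup>2) :: complex)"
      unfolding sum.lessThan_Suc_shift ab(3) using ab(1,2) by (simp del: of_real_power of_real_sum)
    finally show ?thesis .
  qed
  then show ?case using V VV U(3) by (intro bexI[of _ V] exI[of _ "Re l # ls"]) auto
qed

lemma cprod_self_unitary:
  assumes "U \<in> carrier_mat n n" "mat_adjoint U * U = 1\<^sub>m n" "y \<in> carrier_vec n"
  shows "cprod (U *\<^sub>v y) (U *\<^sub>v y) = cprod y y"
proof -
  have "cprod (U *\<^sub>v y) (U *\<^sub>v y) = cprod (mat_adjoint U *\<^sub>v (U *\<^sub>v y)) y"
    using assms by (intro cprod_adjoint) auto
  also have "mat_adjoint U *\<^sub>v (U *\<^sub>v y) = (mat_adjoint U * U) *\<^sub>v y" using assms(1,3) by (simp add: mult_vec_assoc_dim)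
  finally show ?thesis using assms(2,3) by simp
qed

text \<open>In an orthonormal eigenbasis the values of \<open>G\<close> on unit vectors are the
  convex combinations of its eigenvalues, which fill the interval from the least to the greatest.
  The vectors \<open>x\<close> and \<open>y\<close> force these two to have opposite signs.\<close>

lemma rotated_hermitianI:
  assumes S: "S \<in> carrier_mat n n" and e: "cmod e = 1" and G: "G \<in> carrier_mat n n" "mat_adjoint G = G"
    and SG: "\<And>x. x \<in> carrier_vec n \<Longrightarrow> qf S x = e * qf G x"
    and x: "x \<in> carrier_vec n" "0 < Re (qf G x)" and y: "y \<in> carrier_vec n" "Re (qf G y) < 0"
  shows "rotated_hermitian S"
proof -
  obtain U ls where U: "U \<in> carrier_mat n n" "mat_adjoint U * U = 1\<^sub>m n" "length ls = n"
      "\<And>y. y \<in> carrier_vec n \<Longrightarrow> qf G (U *\<^sub>v y) = of_real (\<Sum>i<n. ls ! i * (cmod (y $ i))\<^sup>2)"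
    using hermitian_spectral[OF G] by blast
  have UU: "U * mat_adjoint U = 1\<^sub>m n"
    by (rule mat_mult_left_right_inverse[OF _ U(1,2)]) (use U in simp)
  have coord: "\<exists>v \<in> carrier_vec n. U *\<^sub>v v = x" if "x \<in> carrier_vec n" for x
  proof (rule bexI)
    show "U *\<^sub>v (mat_adjoint U *\<^sub>v x) = x"
      using U(1) UU that by (simp add: mult_vec_assoc_dim[symmetric])
    show "mat_adjoint U *\<^sub>v x \<in> carrier_vec n" using U(1) by (intro carrier_vecI) auto
  qed
  obtain x' where x': "x' \<in> carrier_vec n" "U *\<^sub>v x' = x" using coord[OF x(1)] by blast
  obtain y' where y': "y' \<in> carrier_vec n" "U *\<^sub>v y' = y" using coord[OF y(1)] by blast
  have "0 < (\<Sum>i<n. ls ! i * (cmod (x' $ i))\<^sup>2)" using U(4)[OF x'(1)] x'(2) x(2) by simp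
  then obtain i where "i < n" "0 < ls ! i"
    by (metis (no_types, lifting) lessThan_iff mult_nonpos_nonneg not_le sum_nonpos zero_le_power2)
  moreover have "(\<Sum>i<n. ls ! i * (cmod (y' $ i))\<^sup>2) < 0" using U(4)[OF y'(1)] y'(2) y(2) by simp
  then obtain j where "j < n" "ls ! j < 0"
    by (metis (no_types, lifting) lessThan_iff mult_nonneg_nonneg not_le sum_nonneg zero_le_power2)
  moreover define a where "a = Min (set ls)"
  moreover define b where "b = Max (set ls)"
  ultimately have ne: "set ls \<noteq> {}" and "a \<le> ls ! j" "ls ! i \<le> b" using U(3) by (auto simp: a_def b_def)
  then have ab: "a < 0" "0 < b" using \<open>0 < ls ! i\<close> \<open>ls ! j < 0\<close> by auto
  have "a \<in> set ls" "b \<in> set ls" unfolding a_def b_def using ne by auto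
  then obtain p q where pq: "p < n" "q < n" "ls ! p = a" "ls ! q = b" using U(3) by (metis in_set_conv_nth)
  then have "p \<noteq> q" using ab by auto
  have bounds: "a \<le> ls ! i \<and> ls ! i \<le> b" if "i < n" for i using that U(3) by (simp add: a_def b_def)
  have "numerical_range S = closed_segment (e * of_real a) (e * of_real b)"
  proof (rule subset_antisym; rule subsetI)
    fix z assume "z \<in> numerical_range S"
    then obtain x where x: "x \<in> carrier_vec n" "cprod x x = 1" "z = qf S x"
      unfolding numerical_range_qf[OF S] by blast
    obtain v where v: "v \<in> carrier_vec n" "U *\<^sub>v v = x" using coord[OF x(1)] by blast
    have "cprod v v = 1" using cprod_self_unitary[OF U(1,2) v(1)] v(2) x(2) by simp
    then have norm: "(\<Sum>i<n. (cmod (v $ i))\<^sup>2) = 1" using v(1) unfolding cprod_self by (metis carrier_vecD of_real_eq_1_iff)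
    define s where "s = (\<Sum>i<n. ls ! i * (cmod (v $ i))\<^sup>2)"
    have "(\<Sum>i<n. a * (cmod (v $ i))\<^sup>2) \<le> s" "s \<le> (\<Sum>i<n. b * (cmod (v $ i))\<^sup>2)"
      unfolding s_def using bounds by (auto intro!: sum_mono mult_right_mono)
    then have s: "a \<le> s" "s \<le> b" unfolding sum_distrib_left[symmetric] norm by auto
    have z: "z = e * of_real s" using x(3) SG[OF x(1)] U(4)[OF v(1)] v(2) by (simp add: s_def)
    define u where "u = (s - a) / (b - a)"
    have "u * (b - a) = s - a" using ab by (simp add: u_def)
    then have "s = (1 - u) * a + u * b" by (simp add: algebra_simps)
    moreover have "0 \<le> u" "u \<le> 1" using s ab by (auto simp: u_def)
    ultimately have u: "0 \<le> u" "u \<le> 1" "s = (1 - u) * a + u * b" by auto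
    show "z \<in> closed_segment (e * of_real a) (e * of_real b)"
    proof -
      have "z = e * of_real ((1 - u) * a + u * b)" unfolding z u(3)[symmetric] ..
      then have "z = (1 - u) *\<^sub>R (e * of_real a) + u *\<^sub>R (e * of_real b)"
        by (simp add: scaleR_conv_of_real algebra_simps)
      then show ?thesis unfolding closed_segment_def using u(1,2) by blast
    qed
  next
    fix z assume "z \<in> closed_segment (e * of_real a) (e * of_real b)"
    then obtain u where u: "0 \<le> u" "u \<le> 1" "z = (1 - u) *\<^sub>R (e * of_real a) + u *\<^sub>R (e * of_real b)"
      unfolding closed_segment_def by blast
    \<comment> \<open>A unit vector whose squared coordinates are the weights of \<open>z\<close> at
      the two extreme eigenvalues.\<close>
    define v where "v = vec n (\<lambda>i. if i = p then complex_of_real (sqrt (1 - u)) else if i = q then of_real (sqrt u) else 0)"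
    have v: "v \<in> carrier_vec n" by (simp add: v_def)
    have sum: "(\<Sum>i<n. f i * (cmod (v $ i))\<^sup>2) = f p * (1 - u) + f q * u" for f
    proof -
      have "(\<Sum>i<n. f i * (cmod (v $ i))\<^sup>2) = (\<Sum>i<n. (if i = p then f p * (1 - u) else 0) + (if i = q then f q * u else 0))"
        using \<open>p \<noteq> q\<close> u by (intro sum.cong) (auto simp: v_def)
      also have "\<dots> = f p * (1 - u) + f q * u" unfolding sum.distrib using pq by simp
      finally show ?thesis .
    qed
    have "cprod v v = 1" unfolding cprod_self using sum[of "\<lambda>_. 1"] v by simp
    then have 1: "cprod (U *\<^sub>v v) (U *\<^sub>v v) = 1" using cprod_self_unitary[OF U(1,2) v] by simp
    have Uv: "U *\<^sub>v v \<in> carrier_vec n" using U(1) by (intro carrier_vecI) auto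
    have "qf S (U *\<^sub>v v) = e * of_real (a * (1 - u) + b * u)"
      unfolding SG[OF Uv] U(4)[OF v] sum pq(3,4) ..
    also have "\<dots> = z" unfolding u(3) by (simp add: scaleR_conv_of_real algebra_simps)
    finally show "z \<in> numerical_range S" unfolding numerical_range_qf[OF S] using Uv 1 by blast
  qed
  moreover have "0 \<in> open_segment (e * of_real a) (e * of_real b)"
  proof -
    have "e * of_real a \<noteq> e * of_real b" using e ab by auto
    \<comment> \<open>The weight \<open>- a / (b - a)\<close> is where the segment from
      \<open>a\<close> to \<open>b\<close> crosses zero; it lies strictly between 0 and 1 as
      \<open>a < 0 < b\<close>.\<close>
    moreover have "0 = (1 - (- a / (b - a))) *\<^sub>R (e * of_real a) + (- a / (b - a)) *\<^sub>R (e * of_real b)"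
    proof -
      have "(1 - (- a / (b - a))) * a + (- a / (b - a)) * b = 0" using ab by (simp add: field_simps)
      then have "e * of_real ((1 - (- a / (b - a))) * a + (- a / (b - a)) * b) = 0" by simp
      then show ?thesis by (simp add: scaleR_conv_of_real algebra_simps)
    qed
    moreover have "0 < - a / (b - a)" "- a / (b - a) < 1" using ab by (simp_all add: field_simps)
    ultimately show ?thesis unfolding in_segment(2) by blast
  qed
  ultimately show ?thesis unfolding rotated_hermitian_def by blast
qed

text \<open>Since the origin is interior to the segment, \<open>b\<close> is a negative multiple of
  \<open>a\<close>, so all values of the form lie on one line through the origin. Two values on
  different lines thus exclude the rotated Hermitian kind.\<close>

lemma rotated_hermitian_collinear:
  assumes S: "S \<in> carrier_mat n n" and rh: "rotated_hermitian S"
    and x: "x \<in> carrier_vec n" and y: "y \<in> carrier_vec n"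
  shows "Im (cnj (qf S x) * qf S y) = 0"
proof -
  obtain a b where ab: "numerical_range S = closed_segment a b" "0 \<in> open_segment a b"
    using rh unfolding rotated_hermitian_def by blast
  obtain u where u: "0 < u" "u < 1" "0 = (1 - u) *\<^sub>R a + u *\<^sub>R b" using ab(2) unfolding in_segment(2) by blast
  have b: "b = of_real (- (1 - u) / u) * a"
  proof -
    have "of_real u * b = of_real (- (1 - u)) * a" using u(3) by (simp add: scaleR_conv_of_real algebra_simps add_eq_0_iff2)
    then have "b = of_real (- (1 - u)) * a / of_real u" using u(1) by (simp add: field_simps)
    then show ?thesis by simp
  qed
  have *: "\<exists>t. qf S x = of_real t * a" if x: "x \<in> carrier_vec n" for x
  proof (cases "x = 0\<^sub>v n")
    case True
    then show ?thesis using S qf_zero[of S] by (intro exI[of _ 0]) simp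
  next
    case False
    then obtain c where c: "c \<noteq> 0" "cprod (c \<cdot>\<^sub>v x) (c \<cdot>\<^sub>v x) = 1" using unit_multiple[of x] x by auto
    then have "qf S (c \<cdot>\<^sub>v x) \<in> closed_segment a b"
      unfolding ab(1)[symmetric] numerical_range_qf[OF S] using x by auto
    then obtain v where "qf S (c \<cdot>\<^sub>v x) = (1 - v) *\<^sub>R a + v *\<^sub>R b" unfolding closed_segment_def by blast
    then have "of_real ((cmod c)\<^sup>2) * qf S x = of_real (1 - v + v * (- (1 - u) / u)) * a"
      using qf_scale[of x S c] x S b by (simp add: scaleR_conv_of_real distrib_right)
    then have "qf S x = of_real ((1 - v + v * (- (1 - u) / u)) / (cmod c)\<^sup>2) * a"
      using c(1) by (simp add: field_simps)
    then show ?thesis by blast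
  qed
  obtain s t where "qf S x = of_real s * a" "qf S y = of_real t * a" using * x y by meson
  then have "cnj (qf S x) * qf S y = of_real (s * t) * (a * cnj a)" by simp
  also have "\<dots> = of_real (s * t * (cmod a)\<^sup>2)" unfolding of_real_mult complex_norm_square by simp
  finally show ?thesis by simp
qed

section \<open>Existence of phases\<close>

text \<open>The real part contributed by a block at coordinates \<open>a\<close> and
  \<open>b\<close> is the square of \<open>cmod (a + b)\<close>.\<close>

lemma qf_E_blocks_Re:
  "z \<in> carrier_vec (2 * q) \<Longrightarrow> 0 \<le> Re (cis (- \<theta>) * qf (E_blocks q \<theta>) z)"
proof (induction q arbitrary: z)
  case 0
  then show ?case by (simp add: qf_def scalar_prod_def)
next
  case (Suc q)
  then have "z \<in> carrier_vec (2 + 2 * q)" by simp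
  then obtain x y where xy: "x \<in> carrier_vec 2" "y \<in> carrier_vec (2 * q)" "z = x @\<^sub>v y" by (rule split_vec)
  let ?D = "E_blocks q \<theta>"
  have "qf (E_blocks (Suc q) \<theta>) z = qf (E_block \<theta>) x + qf ?D y"
    unfolding replicate_Suc diag_block_mat_Cons_bdiag xy(3)
    using xy E_blocks_carrier[of q \<theta>] by (intro qf_bdiag) auto
  moreover have "0 \<le> Re (cis (- \<theta>) * qf (E_block \<theta>) x)"
  proof -
    define a where "a = x $ 0"
    define b where "b = x $ 1"
    have "cis (- \<theta>) * qf (E_block \<theta>) x = (cis (- \<theta>) * cis \<theta>) * (of_real ((cmod a)\<^sup>2) + of_real ((cmod b)\<^sup>2) + 2 * cnj a * b)"
      using xy(1) by (simp add: qf_E_block a_def b_def)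
    then have "Re (cis (- \<theta>) * qf (E_block \<theta>) x) = (cmod a)\<^sup>2 + (cmod b)\<^sup>2 + 2 * Re (cnj a * b)"
      unfolding cis_mult by (simp del: of_real_power)
    also have "\<dots> = (cmod (a + b))\<^sup>2" unfolding cmod_power2 by (simp add: power2_eq_square algebra_simps)
    finally show ?thesis by simp
  qed
  ultimately show ?case using Suc.IH[OF xy(2)] by (simp add: distrib_left del: times_complex.sel)
qed

lemma qf_cis_diag_rotate:
  assumes "y \<in> carrier_vec (length \<psi>s)"
  shows "cis (- c) * qf (cis_diag \<psi>s) y = (\<Sum>i<length \<psi>s. of_real ((cmod (y $ i))\<^sup>2) * cis (\<psi>s ! i - c))"
  using assms by (auto simp: qf_cis_diag sum_distrib_left cis_mult mult.left_commute intro!: sum.cong)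

lemma qf_cis_diag_cone:
  assumes h: "0 \<le> h" "h \<le> pi / 2" and c: "\<And>\<psi>. \<psi> \<in> set \<psi>s \<Longrightarrow> \<bar>\<psi> - c\<bar> \<le> h"
    and y: "y \<in> carrier_vec (length \<psi>s)"
  shows "cis (- c) * qf (cis_diag \<psi>s) y \<in> cone_0 h"
  unfolding qf_cis_diag_rotate[OF y]
proof (intro cone_0_sum[OF h] cone_0_scale)
  fix i assume "i \<in> {..<length \<psi>s}"
  then have "\<bar>\<psi>s ! i - c\<bar> \<le> h" using c by simp
  then show "cis (\<psi>s ! i - c) \<in> cone_0 h" using cis_in_cone_0[OF h, of "\<psi>s ! i - c"] h by simp
qed simp

text \<open>The form is a sum over the canonical blocks, and the sector is closed under sums, so
  each kind of block is treated on its own.\<close>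

lemma phases_cone:
  assumes ph: "phases C \<phi>s" and C: "C \<in> carrier_mat n n"
    and \<theta>: "\<And>\<phi>. \<phi> \<in> set \<phi>s \<Longrightarrow> \<bar>\<phi> - \<theta>\<bar> \<le> h" and h: "0 \<le> h" "h \<le> pi / 2"
    and x: "x \<in> carrier_vec n"
  shows "cis (- \<theta>) * qf C x \<in> cone_0 h"
proof -
  obtain T m \<theta>' \<theta>s q where T: "T \<in> carrier_mat n n" "invertible_mat T" "m + length \<theta>s + 2 * q = n"
    "C = mat_adjoint T * canonical_mat m \<theta>s q \<theta>' * T"
    "\<phi>s = replicate q (\<theta>' + pi / 2) @ \<theta>s @ replicate q (\<theta>' - pi / 2)"
    using phases_congruence[OF ph C] by metis
  let ?D = "E_blocks q \<theta>'"
  have D: "?D \<in> carrier_mat (2 * q) (2 * q)" by (rule E_blocks_carrier)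
  have "T *\<^sub>v x \<in> carrier_vec (m + (length \<theta>s + 2 * q))" using T x by (intro carrier_vecI) auto
  then obtain u v where u: "u \<in> carrier_vec m" "v \<in> carrier_vec (length \<theta>s + 2 * q)" "T *\<^sub>v x = u @\<^sub>v v" by (rule split_vec)
  from u(2) obtain y z where y: "y \<in> carrier_vec (length \<theta>s)" "z \<in> carrier_vec (2 * q)" "v = y @\<^sub>v z" by (rule split_vec)
  have "qf C x = qf (bdiag (0\<^sub>m m m) (bdiag (cis_diag \<theta>s) ?D)) (T *\<^sub>v x)"
    unfolding T(4) using T(1,3) D x by (intro qf_congruence) auto
  also have "\<dots> = qf (0\<^sub>m m m) u + (qf (cis_diag \<theta>s) y + qf ?D z)"
    unfolding u(3) y(3) using u y D by (subst qf_bdiag; simp)+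
  also have "qf (0\<^sub>m m m) u = 0" using u(1) by (simp add: qf_def scalar_prod_def)
  finally have "cis (- \<theta>) * qf C x = cis (- \<theta>) * qf (cis_diag \<theta>s) y + cis (- \<theta>) * qf ?D z"
    by (simp add: distrib_left)
  moreover have "cis (- \<theta>) * qf (cis_diag \<theta>s) y \<in> cone_0 h"
    using \<theta> T(5) by (intro qf_cis_diag_cone[OF h _ y(1)]) auto
  moreover have "cis (- \<theta>) * qf ?D z \<in> cone_0 h"
  proof (cases "q = 0")
    case True
    then show ?thesis using y(2) cone_0_zero[of h] by (simp add: qf_def scalar_prod_def)
  next
    case False
    then have "\<bar>\<theta>' + pi / 2 - \<theta>\<bar> \<le> h" "\<bar>\<theta>' - pi / 2 - \<theta>\<bar> \<le> h" using \<theta> unfolding T(5) by auto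
    \<comment> \<open>Two phases at distance pi fit into a window of half-width at most pi/2 only as
      its end points.\<close>
    then have "\<theta> = \<theta>'" "h = pi / 2" using h(2) by (auto simp: abs_le_iff)
    then show ?thesis using qf_E_blocks_Re[OF y(2)] by (simp only: half_plane_cone_0)
  qed
  ultimately show ?thesis using cone_0_add[OF h] by simp
qed

section \<open>Ranks and the canonical form of a singular accretive matrix\<close>

lemma rank_injective:
  assumes D: "D \<in> carrier_mat n r" and inj: "\<And>y. y \<in> carrier_vec r \<Longrightarrow> D *\<^sub>v y = 0\<^sub>v n \<Longrightarrow> y = 0\<^sub>v r"
  shows "vec_space.rank n (D :: complex mat) = r"
proof -
  interpret vec_space "TYPE(complex)" n .
  \<comment> \<open>Linear independence concerns the set of columns and would not notice
    repetitions. Two equal columns give a null vector with entries 1 and - 1.\<close>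
  have "distinct (cols D)"
  proof (rule ccontr)
    assume "\<not> distinct (cols D)"
    then obtain i j where ij: "i < r" "j < r" "i \<noteq> j" "col D i = col D j"
      using D unfolding distinct_conv_nth by auto
    define y where "y = vec r (\<lambda>l. if l = i then 1 else if l = j then - 1 else (0 :: complex))"
    have "(D *\<^sub>v y) $ l = 0" if l: "l < n" for l
    proof -
      have "(D *\<^sub>v y) $ l = (\<Sum>s<r. D $$ (l, s) * y $ s)"
        using l D by (simp add: scalar_prod_def y_def atLeast0LessThan)
      also have "\<dots> = (\<Sum>s<r. (if s = i then D $$ (l, i) else 0) + (if s = j then - D $$ (l, j) else 0))"
        using ij by (intro sum.cong) (auto simp: y_def)
      also have "\<dots> = D $$ (l, i) - D $$ (l, j)" unfolding sum.distrib using ij by simp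
      also have "\<dots> = col D i $ l - col D j $ l" using l D ij(1,2) by simp
      finally show ?thesis unfolding ij(4) by simp
    qed
    then have "D *\<^sub>v y = 0\<^sub>v n" using D by (intro eq_vecI) auto
    then have "y = 0\<^sub>v r" using inj[of y] by (simp add: y_def)
    then have "y $ i = 0" using ij by simp
    then show False using ij by (simp add: y_def)
  qed
  moreover then have "lin_indpt (set (cols D))" using lin_depE[OF D] inj by metis
  ultimately show ?thesis using lin_indpt_full_rank[OF D] by blast
qed

lemma rank_eq_if_same_image:
  assumes A: "A \<in> carrier_mat n p" and B: "B \<in> carrier_mat n q"
    and 1: "\<And>x. x \<in> carrier_vec p \<Longrightarrow> \<exists>y \<in> carrier_vec q. A *\<^sub>v x = B *\<^sub>v (y :: complex vec)"
    and 2: "\<And>y. y \<in> carrier_vec q \<Longrightarrow> \<exists>x \<in> carrier_vec p. A *\<^sub>v x = B *\<^sub>v y"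
  shows "vec_space.rank n A = vec_space.rank n B"
proof -
  interpret vec_space "TYPE(complex)" n .
  have "col_space A = col_space B"
    unfolding col_space_eq[OF A] col_space_eq[OF B] using A B 1 2 by auto metis+
  then show ?thesis unfolding rank_def col_space_def by simp
qed

text \<open>At a null vector the positive semidefinite Hermitian part has the value 0, so it kills
  the vector too, and what it leaves there is a multiple of the adjoint applied to
  \<open>x\<close>.\<close>

lemma accretive_kernel:
  fixes \<theta> :: real
  assumes S: "S \<in> carrier_mat n n"
    and acc: "\<And>x. x \<in> carrier_vec n \<Longrightarrow> 0 \<le> Re (cis (- \<theta>) * qf S x)"
    and x: "x \<in> carrier_vec n" "S *\<^sub>v x = 0\<^sub>v n"
  shows "mat_adjoint S *\<^sub>v x = 0\<^sub>v n"
proof -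
  define H where "H = cis (- \<theta>) \<cdot>\<^sub>m S + cis \<theta> \<cdot>\<^sub>m mat_adjoint S"
  have H: "H \<in> carrier_mat n n" unfolding H_def using S by (intro carrier_matI) auto
  have adjH: "mat_adjoint H = H" unfolding H_def using S by (intro eq_matI) (auto simp: cis_cnj add.commute)
  have Hv: "H *\<^sub>v v = cis (- \<theta>) \<cdot>\<^sub>v (S *\<^sub>v v) + cis \<theta> \<cdot>\<^sub>v (mat_adjoint S *\<^sub>v v)" if v: "v \<in> carrier_vec n" for v
    unfolding H_def using S v
    by (subst add_mult_distrib_mat_vec[of _ n n]) (auto simp: smult_mat_mult_vec)
  have qH: "qf H v = of_real (2 * Re (cis (- \<theta>) * qf S v))" if v: "v \<in> carrier_vec n" for v
  proof -
    have "cprod v (mat_adjoint S *\<^sub>v v) = cprod (S *\<^sub>v v) v"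
      using cprod_adjoint[of v "mat_adjoint S" v] S v by simp
    also have "\<dots> = cnj (qf S v)" unfolding qf_def using cprod_commute[of "S *\<^sub>v v" v] S v by simp
    finally have "qf H v = cis (- \<theta>) * qf S v + cnj (cis (- \<theta>) * qf S v)"
      unfolding qf_def Hv[OF v] using S v by (simp add: cprod_linear cis_cnj)
    then show ?thesis by (simp only: complex_add_cnj)
  qed
  have "qf S x = 0" unfolding qf_def x(2) using x(1) by (simp add: scalar_prod_def)
  then have "qf H x = 0" unfolding qH[OF x(1)] by simp
  moreover have "0 \<le> Re (qf H v)" if "v \<in> carrier_vec n" for v
    unfolding qH[OF that] Re_complex_of_real using acc[OF that] by linarith
  ultimately have "H *\<^sub>v x = 0\<^sub>v n" using psd_null_vector[OF H adjH _ x(1)] by blast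
  moreover have "cis \<theta> \<cdot>\<^sub>v (mat_adjoint S *\<^sub>v x) \<in> carrier_vec n" using S by (intro carrier_vecI) simp
  ultimately have "cis \<theta> \<cdot>\<^sub>v (mat_adjoint S *\<^sub>v x) = 0\<^sub>v n"
    unfolding Hv[OF x(1)] x(2) by simp
  then have "cis (- \<theta>) \<cdot>\<^sub>v (cis \<theta> \<cdot>\<^sub>v (mat_adjoint S *\<^sub>v x)) = 0\<^sub>v n" by simp
  then show ?thesis by (simp add: smult_smult_assoc cis_mult)
qed

lemma mat_congruent_attains:
  assumes "mat_congruent n S B" "y \<in> carrier_vec n"
  obtains x where "x \<in> carrier_vec n" "qf S x = qf B y" "x = 0\<^sub>v n \<Longrightarrow> y = 0\<^sub>v n"
proof -
  obtain T R where T: "B \<in> carrier_mat n n" "T \<in> carrier_mat n n" "R \<in> carrier_mat n n" "T * R = 1\<^sub>m n"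
      "S = mat_adjoint T * B * T"
    using mat_congruentE[OF assms(1)] by metis
  have x: "R *\<^sub>v y \<in> carrier_vec n" using T by (intro carrier_vecI) auto
  have TRy: "T *\<^sub>v (R *\<^sub>v y) = y" using T(2-4) assms(2) by (simp add: mult_vec_assoc_dim[symmetric])
  have "qf S (R *\<^sub>v y) = qf B y" unfolding T(5) using T(1-3) x TRy by (subst qf_congruence) auto
  moreover have "y = 0\<^sub>v n" if "R *\<^sub>v y = 0\<^sub>v n" using TRy T(2) mult_mat_vec_zero[of T] unfolding that by simp
  ultimately show ?thesis using that x by blast
qed

lemma sorted_two_values:
  fixes xs :: "real list"
  assumes "sorted_wrt (\<ge>) xs" "set xs \<subseteq> {a, b}" "b < a"
  obtains p q where "xs = replicate p a @ replicate q b"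
proof -
  have "\<exists>p q. xs = replicate p a @ replicate q b"
    using assms(1,2)
  proof (induction xs)
    case (Cons x xs)
    then obtain p q where pq: "xs = replicate p a @ replicate q b" by auto
    show ?case
    proof (cases "x = a")
      case True
      then show ?thesis using pq by (intro exI[of _ "Suc p"] exI[of _ q]) simp
    next
      case False
      then have "x = b" "p = 0" using Cons.prems pq assms(3) by (auto simp: set_replicate_conv_if split: if_splits)
      then show ?thesis using pq by (intro exI[of _ 0] exI[of _ "Suc q"]) simp
    qed
  qed simp
  then show ?thesis using that by blast
qed

text \<open>The unitary reduction is recorded beside the congruence because the quasi-sectorial
  clause asks for the former and the other two clauses for the latter.\<close>

lemma accretive_decomposition:
  fixes \<theta> :: real
  assumes S: "S \<in> carrier_mat n n"
    and acc: "\<And>x. x \<in> carrier_vec n \<Longrightarrow> 0 \<le> Re (cis (- \<theta>) * qf S x)"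
  obtains U Cs r \<psi>s q where "r \<le> n" "mat_rank S = r" "U \<in> carrier_mat n n" "mat_adjoint U * U = 1\<^sub>m n"
    "Cs \<in> carrier_mat r r" "S = U * bdiag (0\<^sub>m (n - r) (n - r)) Cs * mat_adjoint U"
    "set \<psi>s \<subseteq> {\<theta> - pi / 2 .. \<theta> + pi / 2}" "sorted_wrt (\<ge>) \<psi>s" "length \<psi>s + 2 * q = r"
    "mat_congruent r Cs (bdiag (cis_diag \<psi>s) (E_blocks q \<theta>))"
    "mat_congruent n S (canonical_mat (n - r) \<psi>s q \<theta>)"
proof -
  obtain m X Z where Z: "m \<le> n" "X \<in> carrier_mat n m" "Z \<in> carrier_mat n (n - m)"
    "mat_adjoint Z * Z = 1\<^sub>m (n - m)"
    "hcat X Z * mat_adjoint (hcat X Z) = 1\<^sub>m n" "mat_adjoint (hcat X Z) * hcat X Z = 1\<^sub>m n"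
    "S = hcat X Z * bdiag (0\<^sub>m m m) (mat_adjoint Z * S * Z) * mat_adjoint (hcat X Z)"
    "\<And>c. c \<in> carrier_vec (n - m) \<Longrightarrow> (mat_adjoint Z * S * Z) *\<^sub>v c = 0\<^sub>v (n - m) \<Longrightarrow> c = 0\<^sub>v (n - m)"
    using kernel_decomposition[OF S accretive_kernel[OF S acc]] by metis
  define U where "U = hcat X Z"
  define Cs where "Cs = mat_adjoint Z * S * Z"
  define r where "r = n - m"
  have mr: "m + r = n" "n - r = m" using Z(1) by (auto simp: r_def)
  have U: "U \<in> carrier_mat n n" using hcat_carrier[OF Z(2,3)] Z(1) by (simp add: U_def)
  have UU: "mat_adjoint U * U = 1\<^sub>m n" "U * mat_adjoint U = 1\<^sub>m n" using Z(5,6) by (simp_all add: U_def)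
  have Cs: "Cs \<in> carrier_mat r r" unfolding Cs_def r_def using Z(3) S by (intro carrier_matI) auto
  have dec: "S = U * bdiag (0\<^sub>m m m) Cs * mat_adjoint U" using Z(7) by (simp add: U_def Cs_def)
  have injCs: "c = 0\<^sub>v r" if "c \<in> carrier_vec r" "Cs *\<^sub>v c = 0\<^sub>v r" for c
    using Z(8) that unfolding Cs_def r_def by blast
  have accCs: "0 \<le> Re (cis (- \<theta>) * qf Cs c)" if c: "c \<in> carrier_vec r" for c
  proof -
    have "Z *\<^sub>v c \<in> carrier_vec n" using Z(3) by (intro carrier_vecI) auto
    then show ?thesis using acc[of "Z *\<^sub>v c"] Z(3) S c unfolding Cs_def r_def by (subst qf_congruence) auto
  qed
  obtain \<psi>s q where \<psi>: "set \<psi>s \<subseteq> {\<theta> - pi / 2 .. \<theta> + pi / 2}" "sorted_wrt (\<ge>) \<psi>s" "length \<psi>s + 2 * q = r"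
      "mat_congruent r Cs (bdiag (cis_diag \<psi>s) (E_blocks q \<theta>))"
    using accretive_canonical_form[OF Cs accCs injCs] by blast
  let ?D = "bdiag (cis_diag \<psi>s) (E_blocks q \<theta>)"
  have cong1: "mat_congruent n S (bdiag (0\<^sub>m m m) Cs)"
    by (rule mat_congruentI[of _ _ _ "mat_adjoint U" U])
      (use S U Cs UU dec mr in \<open>auto intro!: carrier_matI\<close>)
  have "mat_congruent n (bdiag (0\<^sub>m m m) Cs) (bdiag (0\<^sub>m m m) ?D)"
    using mat_congruent_bdiag[OF mat_congruent_refl[of "0\<^sub>m m m" m] \<psi>(4)] mr by simp
  then have cong: "mat_congruent n S (bdiag (0\<^sub>m m m) ?D)" using cong1 mat_congruent_trans by blast
  have rank: "mat_rank S = r"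
  proof -
    have ZCs: "Z * Cs \<in> carrier_mat n r" using Z(3) Cs by (intro carrier_matI) auto
    have Ub: "U *\<^sub>v (0\<^sub>v m @\<^sub>v b) = Z *\<^sub>v b" if "b \<in> carrier_vec r" for b
      unfolding U_def using Z(2,3) that mult_mat_vec_zero[of X] r_def by (subst hcat_mult_append) auto
    have SU: "S *\<^sub>v (U *\<^sub>v (a @\<^sub>v b)) = (Z * Cs) *\<^sub>v b" if a: "a \<in> carrier_vec m" and b: "b \<in> carrier_vec r" for a b
    proof -
      have ab: "a @\<^sub>v b \<in> carrier_vec n" using a b mr by (intro carrier_vecI) auto
      have "S *\<^sub>v (U *\<^sub>v (a @\<^sub>v b)) = (U * bdiag (0\<^sub>m m m) Cs * mat_adjoint U) *\<^sub>v (U *\<^sub>v (a @\<^sub>v b))"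
        using dec by simp
      also have "\<dots> = U *\<^sub>v (bdiag (0\<^sub>m m m) Cs *\<^sub>v ((mat_adjoint U * U) *\<^sub>v (a @\<^sub>v b)))"
        using U Cs ab mr a b by (simp add: mult_vec_assoc_dim mult_assoc_dim)
      also have "\<dots> = U *\<^sub>v (bdiag (0\<^sub>m m m) Cs *\<^sub>v (a @\<^sub>v b))" using UU ab by simp
      also have "bdiag (0\<^sub>m m m) Cs *\<^sub>v (a @\<^sub>v b) = 0\<^sub>v m @\<^sub>v (Cs *\<^sub>v b)"
      proof -
        have "0\<^sub>m m m *\<^sub>v a = (0\<^sub>v m :: complex vec)" using a by (intro eq_vecI) auto
        then show ?thesis using Cs a b by (subst bdiag_mult_append) auto
      qed
      also have "U *\<^sub>v (0\<^sub>v m @\<^sub>v (Cs *\<^sub>v b)) = Z *\<^sub>v (Cs *\<^sub>v b)"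
        by (rule Ub) (use Cs in \<open>intro carrier_vecI, simp\<close>)
      finally show ?thesis using Z(3) Cs b r_def by (simp add: mult_vec_assoc_dim)
    qed
    \<comment> \<open>The unitary coordinates split off the kernel: \<open>S\<close> and the
      injective matrix \<open>Z * Cs\<close>, which has \<open>r\<close> columns, have the same
      image.\<close>
    have "vec_space.rank n S = vec_space.rank n (Z * Cs)"
    proof (rule rank_eq_if_same_image[OF S ZCs])
      fix x :: "complex vec" assume x: "x \<in> carrier_vec n"
      have "mat_adjoint U *\<^sub>v x \<in> carrier_vec (m + r)" using U mr by (intro carrier_vecI) auto
      then obtain a b where ab: "a \<in> carrier_vec m" "b \<in> carrier_vec r" "mat_adjoint U *\<^sub>v x = a @\<^sub>v b" by (rule split_vec)
      have "x = U *\<^sub>v (mat_adjoint U *\<^sub>v x)" using U UU(2) x by (simp add: mult_vec_assoc_dim[symmetric])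
      then have "S *\<^sub>v x = (Z * Cs) *\<^sub>v b" unfolding ab(3) using SU[OF ab(1,2)] by simp
      then show "\<exists>y \<in> carrier_vec r. S *\<^sub>v x = (Z * Cs) *\<^sub>v y" using ab(2) by blast
    next
      fix y :: "complex vec" assume y: "y \<in> carrier_vec r"
      have "U *\<^sub>v (0\<^sub>v m @\<^sub>v y) \<in> carrier_vec n" using U by (intro carrier_vecI) auto
      then show "\<exists>x \<in> carrier_vec n. S *\<^sub>v x = (Z * Cs) *\<^sub>v y" using SU[OF zero_carrier_vec y] by blast
    qed
    also have "\<dots> = r"
    proof (rule rank_injective[OF ZCs])
      fix y :: "complex vec" assume y: "y \<in> carrier_vec r" "(Z * Cs) *\<^sub>v y = 0\<^sub>v n"
      have "Cs *\<^sub>v y = (mat_adjoint Z * Z) *\<^sub>v (Cs *\<^sub>v y)" unfolding Z(4) using Cs r_def by (simp add: carrier_vecI)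
      also have "\<dots> = mat_adjoint Z *\<^sub>v ((Z * Cs) *\<^sub>v y)" using Z(3) Cs y(1) r_def by (simp add: mult_vec_assoc_dim)
      also have "\<dots> = 0\<^sub>v r" unfolding y(2) using Z(3) mult_mat_vec_zero[of "mat_adjoint Z"] r_def by simp
      finally show "y = 0\<^sub>v r" using injCs y(1) by blast
    qed
    finally show ?thesis using S by simp
  qed
  show ?thesis
    using that[of r U Cs \<psi>s q] mr rank U UU(1) Cs dec \<psi> cong by auto
qed

section \<open>Values attained by the canonical form\<close>

lemma canonical_form_attains:
  assumes cong: "mat_congruent n S (canonical_mat m \<psi>s q \<theta>)"
    and n: "m + (length \<psi>s + 2 * q) = n"
    and y: "y \<in> carrier_vec (length \<psi>s)" and z: "z \<in> carrier_vec (2 * q)"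
  shows "\<exists>x \<in> carrier_vec n. qf S x = qf (cis_diag \<psi>s) y + qf (E_blocks q \<theta>) z \<and>
    (x = 0\<^sub>v n \<longrightarrow> y = 0\<^sub>v (length \<psi>s) \<and> z = 0\<^sub>v (2 * q))"
proof -
  let ?E = "E_blocks q \<theta>"
  have E: "?E \<in> carrier_mat (2 * q) (2 * q)" by (rule E_blocks_carrier)
  have v: "0\<^sub>v m @\<^sub>v (y @\<^sub>v z) \<in> carrier_vec n" using y z n by (intro carrier_vecI) auto
  obtain x where x: "x \<in> carrier_vec n" "qf S x = qf (bdiag (0\<^sub>m m m) (bdiag (cis_diag \<psi>s) ?E)) (0\<^sub>v m @\<^sub>v (y @\<^sub>v z))"
      "x = 0\<^sub>v n \<Longrightarrow> 0\<^sub>v m @\<^sub>v (y @\<^sub>v z) = 0\<^sub>v n"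
    using mat_congruent_attains[OF cong v] by blast
  have "qf S x = qf (0\<^sub>m m m) (0\<^sub>v m) + (qf (cis_diag \<psi>s) y + qf ?E z)"
    unfolding x(2) using y z E by (subst qf_bdiag; simp)+
  moreover have "qf (0\<^sub>m m m) (0\<^sub>v m) = 0" using qf_zero[of "0\<^sub>m m m"] by simp
  moreover have "y = 0\<^sub>v (length \<psi>s) \<and> z = 0\<^sub>v (2 * q)" if "x = 0\<^sub>v n"
  proof -
    have "0\<^sub>v m @\<^sub>v (y @\<^sub>v z) = 0\<^sub>v (m + (length \<psi>s + 2 * q))" using x(3)[OF that] n by simp
    then show ?thesis
      using append_vec_eq_zero[of "0\<^sub>v m" m "y @\<^sub>v z" "length \<psi>s + 2 * q"] append_vec_eq_zero[of y "length \<psi>s" z "2 * q"] y z by simp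
  qed
  ultimately show ?thesis using x(1) by auto
qed

lemma canonical_form_attains_cis:
  assumes cong: "mat_congruent n S (canonical_mat m \<psi>s q \<theta>)"
    and n: "m + (length \<psi>s + 2 * q) = n" and \<psi>': "\<psi> \<in> set \<psi>s"
  shows "\<exists>x \<in> carrier_vec n. qf S x = cis \<psi> \<and> x \<noteq> 0\<^sub>v n"
proof -
  have qE0: "qf (E_blocks q \<theta>) (0\<^sub>v (2 * q)) = 0"
    using qf_zero[of "E_blocks q \<theta>"] E_blocks_carrier[of q \<theta>] by simp
  obtain i where i: "i < length \<psi>s" "\<psi>s ! i = \<psi>" using \<psi>' by (metis in_set_conv_nth)
  let ?y = "unit_vec (length \<psi>s) i :: complex vec"
  have "qf (cis_diag \<psi>s) ?y = (\<Sum>j<length \<psi>s. if j = i then cis \<psi> else 0)"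
    by (subst qf_cis_diag, simp, rule sum.cong) (use i in auto)
  then have "qf (cis_diag \<psi>s) ?y = cis \<psi>" using i by simp
  moreover have "?y \<noteq> 0\<^sub>v (length \<psi>s)" using i by simp
  ultimately show ?thesis using canonical_form_attains[OF cong n, of ?y "0\<^sub>v (2 * q)"] qE0 by fastforce
qed

text \<open>The coordinates \<open>1\<close> and \<open>cis t\<close> in the first E block. Their
  values have arguments approaching \<theta> + pi/2 and \<theta> - pi/2 as \<open>t\<close>
  approaches pi and - pi.\<close>

lemma canonical_form_attains_E:
  assumes cong: "mat_congruent n S (canonical_mat m \<psi>s q \<theta>)"
    and n: "m + (length \<psi>s + 2 * q) = n" and q: "q \<noteq> 0"
  shows "\<exists>x \<in> carrier_vec n. qf S x = cis \<theta> * (2 + 2 * cis t) \<and> x \<noteq> 0\<^sub>v n"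
proof -
  have qD0: "qf (cis_diag \<psi>s) (0\<^sub>v (length \<psi>s)) = 0" using qf_zero[of "cis_diag \<psi>s"] by simp
  obtain q' where q': "q = Suc q'" using q by (cases q) auto
  define e where "e = vec 2 (\<lambda>i. if i = 0 then 1 else cis t)"
  define z where "z = e @\<^sub>v 0\<^sub>v (2 * q')"
  have z: "z \<in> carrier_vec (2 * q)" unfolding z_def e_def q' by (intro carrier_vecI) simp
  have E': "E_blocks q' \<theta> \<in> carrier_mat (2 * q') (2 * q')" by (rule E_blocks_carrier)
  have "qf (E_blocks q \<theta>) z = qf (E_block \<theta>) e + qf (E_blocks q' \<theta>) (0\<^sub>v (2 * q'))"
    unfolding q' replicate_Suc diag_block_mat_Cons_bdiag z_def
    using E' by (intro qf_bdiag) (auto simp: e_def)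
  also have "qf (E_blocks q' \<theta>) (0\<^sub>v (2 * q')) = 0"
    using qf_zero[of "E_blocks q' \<theta>"] E' by simp
  also have "qf (E_block \<theta>) e = cis \<theta> * (2 + 2 * cis t)"
    by (simp add: qf_E_block e_def)
  finally have "qf (E_blocks q \<theta>) z = cis \<theta> * (2 + 2 * cis t)" by simp
  moreover have "z \<noteq> 0\<^sub>v (2 * q)"
  proof
    assume "z = 0\<^sub>v (2 * q)"
    then have "z $ 0 = 0" using q' by simp
    then show False by (simp add: z_def e_def)
  qed
  ultimately show ?thesis using canonical_form_attains[OF cong n zero_carrier_vec z] qD0 by fastforce
qed

text \<open>Shows the direction \<open>t / 2\<close> of the values of an E block; the real factor is
  positive for \<open>t\<close> strictly between - pi and pi.\<close>

lemma half_angle: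
  "2 + 2 * cis t = of_real (4 * cos (t / 2)) * cis (t / 2)"
proof -
  have "cis t = cis (t / 2) * cis (t / 2)" by (simp add: cis_mult)
  moreover have "1 = cis (- (t / 2)) * cis (t / 2)" by (simp add: cis_mult)
  ultimately have "2 + 2 * cis t = 2 * (cis (- (t / 2)) + cis (t / 2)) * cis (t / 2)"
    by (simp add: algebra_simps)
  also have "cis (- (t / 2)) + cis (t / 2) = of_real (2 * cos (t / 2))" by (simp add: complex_eq_iff)
  finally show ?thesis by simp
qed

section \<open>Recognizing the kind of phases\<close>

lemma quasi_sectorial_phasesI:
  assumes S: "S \<in> carrier_mat n n" and r: "r \<le> n" "mat_rank S = r"
    and U: "U \<in> carrier_mat n n" "mat_adjoint U * U = 1\<^sub>m n"
    and Cs: "Cs \<in> carrier_mat r r" and dec: "S = U * bdiag (0\<^sub>m (n - r) (n - r)) Cs * mat_adjoint U"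
    and cong: "mat_congruent r Cs (cis_diag \<psi>s)" and sorted: "sorted_wrt (\<ge>) \<psi>s"
    and w: "\<psi>s \<noteq> [] \<Longrightarrow> hd \<psi>s - last \<psi>s < pi"
  shows "quasi_sectorial_phases S \<psi>s"
proof -
  obtain T R where T: "T \<in> carrier_mat r r" "R \<in> carrier_mat r r" "R * T = 1\<^sub>m r" "Cs = mat_adjoint T * cis_diag \<psi>s * T"
    and "cis_diag \<psi>s \<in> carrier_mat r r"
    using mat_congruentE[OF cong] by metis
  then have len: "length \<psi>s = r" by (metis carrier_matD(1) dim_cis_diag(1))
  define c where "c = (hd \<psi>s + last \<psi>s) / 2"
  \<comment> \<open>Half the spread around the centre \<open>c\<close>. For the empty list
    \<open>hd\<close> and \<open>last\<close> are unspecified, so 0 is chosen.\<close>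
  define k where "k = (if \<psi>s = [] then 0 else (hd \<psi>s - last \<psi>s) / 2)"
  note in_range = sorted_descending_bounds[OF sorted]
  have dist: "\<bar>x - c\<bar> \<le> k" if "x \<in> set \<psi>s" for x
    using in_range[OF that] that by (auto simp: c_def k_def abs_le_iff field_simps)
  have k: "0 \<le> k" "k < pi / 2"
    using w in_range[of "hd \<psi>s"] by (auto simp: k_def)
  have Tx: "T *\<^sub>v x \<in> carrier_vec (length \<psi>s)" "qf Cs x = qf (cis_diag \<psi>s) (T *\<^sub>v x)" if x: "x \<in> carrier_vec r" for x
  proof -
    show "T *\<^sub>v x \<in> carrier_vec (length \<psi>s)" using T(1) len by (intro carrier_vecI) simp
    show "qf Cs x = qf (cis_diag \<psi>s) (T *\<^sub>v x)" unfolding T(4) using T(1) x len by (intro qf_congruence) auto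
  qed
  have "cis (- c) * qf S x \<in> cone_0 k" if x: "x \<in> carrier_vec n" for x
  proof -
    have "mat_adjoint U *\<^sub>v x \<in> carrier_vec ((n - r) + r)" using U r(1) by (intro carrier_vecI) auto
    then obtain a b where ab: "a \<in> carrier_vec (n - r)" "b \<in> carrier_vec r" "mat_adjoint U *\<^sub>v x = a @\<^sub>v b" by (rule split_vec)
    have "qf S x = qf (bdiag (0\<^sub>m (n - r) (n - r)) Cs) (mat_adjoint U *\<^sub>v x)"
      using qf_congruence[of "mat_adjoint U" "bdiag (0\<^sub>m (n - r) (n - r)) Cs" x] dec U Cs r(1) x by simp
    also have "\<dots> = qf (0\<^sub>m (n - r) (n - r)) a + qf Cs b" unfolding ab(3) using ab Cs by (intro qf_bdiag) auto
    also have "qf (0\<^sub>m (n - r) (n - r)) a = 0" using ab(1) by (simp add: qf_def scalar_prod_def)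
    finally have "qf S x = qf (cis_diag \<psi>s) (T *\<^sub>v b)" using Tx(2)[OF ab(2)] by simp
    then show ?thesis using qf_cis_diag_cone[OF k(1) _ dist Tx(1)[OF ab(2)]] k(2) by simp
  qed
  then have "quasi_sectorial S" unfolding quasi_sectorial_def using field_angle_less_pi[OF S k] S by auto
  moreover have "0 \<notin> numerical_range Cs"
  proof
    assume "0 \<in> numerical_range Cs"
    then obtain x where x: "x \<in> carrier_vec r" "cprod x x = 1" "qf Cs x = 0"
      unfolding numerical_range_qf[OF Cs] by auto
    let ?y = "T *\<^sub>v x"
    have "x = (R * T) *\<^sub>v x" using T(3) x by simp
    also have "\<dots> = R *\<^sub>v ?y" using T(1,2) x by (simp add: mult_vec_assoc_dim)
    finally have "x = R *\<^sub>v ?y" .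
    moreover have "x \<noteq> 0\<^sub>v r" using x(2) by (auto simp: scalar_prod_def)
    ultimately have "?y \<noteq> 0\<^sub>v r" using T(2) mult_mat_vec_zero[of R] by auto
    then obtain i where i: "i < r" "?y $ i \<noteq> 0" using Tx(1)[OF x(1)] len by (metis carrier_vecD eq_vecI index_zero_vec)
    \<comment> \<open>Rotated by the centre, all phases have modulus below pi/2, so the real part is
      a sum of nonnegative terms, positive at the nonzero coordinate \<open>i\<close>.\<close>
    have "0 = Re (cis (- c) * qf (cis_diag \<psi>s) ?y)" using Tx(2)[OF x(1)] x(3) by simp
    also have "\<dots> = (\<Sum>i<r. (cmod (?y $ i))\<^sup>2 * cos (\<psi>s ! i - c))"
      unfolding qf_cis_diag_rotate[OF Tx(1)[OF x(1)]] Re_sum len by (simp del: of_real_power index_mult_mat_vec)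
    also have "\<dots> > 0"
    proof (rule sum_pos2[of _ i])
      have pos: "0 < cos (\<psi>s ! i - c)" if "i < r" for i
      proof -
        have "\<bar>\<psi>s ! i - c\<bar> \<le> k" using dist len that by simp
        then show ?thesis using k by (intro cos_gt_zero_pi) (auto simp: abs_le_iff)
      qed
      show "0 < (cmod (?y $ i))\<^sup>2 * cos (\<psi>s ! i - c)" using i pos by (simp del: index_mult_mat_vec)
      show "0 \<le> (cmod (?y $ j))\<^sup>2 * cos (\<psi>s ! j - c)" if "j \<in> {..<r}" for j
        using pos[of j] that by simp
    qed (use i in auto)
    finally show False by simp
  qed
  then have "sectorial_phases Cs \<psi>s"
    unfolding sectorial_phases_def sectorial_def using len Cs sorted w cong unfolding mat_congruent_def by auto
  moreover have "S = U * diag_block_mat [0\<^sub>m (n - r) (n - r), Cs] * mat_adjoint U"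
    using dec by (simp add: diag_block_mat_Cons_bdiag del: diag_block_mat.simps(2))
  ultimately show ?thesis
    unfolding quasi_sectorial_phases_def Let_def r(2) using U Cs S by auto
qed

text \<open>Rotating by the upper end phase turns the diagonal entries into 1 and - 1, so the
  rotated matrix is Hermitian. The vectors \<open>x\<close> and \<open>y\<close> show that both
  signs occur.\<close>

lemma rotated_hermitian_congruent:
  assumes S: "S \<in> carrier_mat n n" and n: "m + length \<psi>s = n"
    and cong: "mat_congruent n S (bdiag (0\<^sub>m m m) (cis_diag \<psi>s))"
    and \<psi>s: "set \<psi>s \<subseteq> {\<theta> + pi / 2, \<theta> - pi / 2}"
    and x: "x \<in> carrier_vec n" "qf S x = cis (\<theta> + pi / 2)" and y: "y \<in> carrier_vec n" "qf S y = cis (\<theta> - pi / 2)"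
  shows "rotated_hermitian S"
proof -
  obtain T where T: "T \<in> carrier_mat n n" "S = mat_adjoint T * bdiag (0\<^sub>m m m) (cis_diag \<psi>s) * T"
    using cong unfolding mat_congruent_def by blast
  define e where "e = cis (\<theta> + pi / 2)"
  define G where "G = cis (- (\<theta> + pi / 2)) \<cdot>\<^sub>m S"
  have G: "G \<in> carrier_mat n n" using S by (simp add: G_def)
  have adjD: "cis (- (\<theta> + pi / 2)) \<cdot>\<^sub>m bdiag (0\<^sub>m m m) (cis_diag \<psi>s) = mat_adjoint (cis (- (\<theta> + pi / 2)) \<cdot>\<^sub>m bdiag (0\<^sub>m m m) (cis_diag \<psi>s))"
  proof -
    have "cis (- (\<theta> + pi / 2)) * cis (\<psi>s ! i) = cnj (cis (- (\<theta> + pi / 2)) * cis (\<psi>s ! i))" if "i < length \<psi>s" for i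
    proof -
      have "\<psi>s ! i = \<theta> + pi / 2 \<or> \<psi>s ! i = \<theta> - pi / 2" using \<psi>s that nth_mem by blast
      then have "cis (- (\<theta> + pi / 2)) * cis (\<psi>s ! i) = 1 \<or> cis (- (\<theta> + pi / 2)) * cis (\<psi>s ! i) = - 1"
        unfolding cis_mult by (auto simp: complex_eq_iff)
      then show ?thesis by (elim disjE; simp only: complex_cnj_one complex_cnj_minus)
    qed
    then show ?thesis
      by (intro eq_matI) (auto simp: bdiag_def cis_diag_def mat_diag_def simp del: complex_cnj_mult)
  qed
  have G_eq: "G = mat_adjoint T * (cis (- (\<theta> + pi / 2)) \<cdot>\<^sub>m bdiag (0\<^sub>m m m) (cis_diag \<psi>s)) * T"
  proof -
    let ?B = "bdiag (0\<^sub>m m m) (cis_diag \<psi>s)"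
    have B: "?B \<in> carrier_mat n n" using n by (intro carrier_matI) auto
    have aT: "mat_adjoint T \<in> carrier_mat n n" using T(1) by simp
    have "G = cis (- (\<theta> + pi / 2)) \<cdot>\<^sub>m (mat_adjoint T * ?B * T)" using T(2) by (simp add: G_def)
    then show ?thesis
      unfolding mult_smult_distrib[OF aT B] using mult_smult_assoc_mat[OF mult_carrier_mat[OF aT B] T(1)] by simp
  qed
  have "mat_adjoint G = G"
  proof -
    let ?B = "cis (- (\<theta> + pi / 2)) \<cdot>\<^sub>m bdiag (0\<^sub>m m m) (cis_diag \<psi>s)"
    have "dim_row ?B = n" "dim_col ?B = n" using n by auto
    then have "mat_adjoint (mat_adjoint T * ?B * T) = mat_adjoint T * mat_adjoint ?B * T"
      using T(1) by (simp add: mat_adjoint_mult mult_assoc_dim)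
    then show ?thesis unfolding G_eq adjD[symmetric] .
  qed
  moreover have qG: "qf G x = cis (- (\<theta> + pi / 2)) * qf S x" if "x \<in> carrier_vec n" for x
    unfolding G_def using S that by (intro qf_smult) auto
  moreover have "qf S x = e * qf G x" if "x \<in> carrier_vec n" for x
    unfolding qG[OF that] e_def by (simp add: mult.assoc[symmetric] cis_mult)
  moreover have "qf G x = 1" "qf G y = - 1"
    unfolding qG[OF x(1)] qG[OF y(1)] x(2) y(2) cis_mult by (simp_all add: complex_eq_iff)
  ultimately show ?thesis
    using rotated_hermitianI[OF S _ G, of e x y] x(1) y(1) by (simp add: e_def)
qed

text \<open>The canonical form relative to \<theta> decides which clause of \<open>phases\<close>
  applies. No E blocks and a spread below pi give the quasi-sectorial kind. Otherwise the field
  angle is pi, and the matrix is rotated Hermitian precisely if there are no E blocks and only the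
  two end phases occur. The sector bounds the diagonal phases because each \<open>cis \<psi>\<close>
  is itself a value of the form.\<close>

lemma phases_exist:
  assumes S: "S \<in> carrier_mat n n" and h: "0 \<le> h" "h \<le> pi / 2"
    and cone: "\<And>x. x \<in> carrier_vec n \<Longrightarrow> cis (- \<theta>) * qf S x \<in> cone_0 h"
  obtains \<psi>s where "phases S \<psi>s" "set \<psi>s \<subseteq> {\<theta> - h .. \<theta> + h}"
proof -
  have sq: "square_mat S" using S by simp
  have acc: "0 \<le> Re (cis (- \<theta>) * qf S x)" if "x \<in> carrier_vec n" for x
    using cone[OF that] unfolding cone_0_def by blast
  obtain U Cs r \<psi>s q where r: "r \<le> n" "mat_rank S = r" and U: "U \<in> carrier_mat n n" "mat_adjoint U * U = 1\<^sub>m n"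
    and Cs: "Cs \<in> carrier_mat r r" and dec: "S = U * bdiag (0\<^sub>m (n - r) (n - r)) Cs * mat_adjoint U"
    and \<psi>: "set \<psi>s \<subseteq> {\<theta> - pi / 2 .. \<theta> + pi / 2}" "sorted_wrt (\<ge>) \<psi>s" "length \<psi>s + 2 * q = r"
      "mat_congruent r Cs (bdiag (cis_diag \<psi>s) (E_blocks q \<theta>))"
    and cong: "mat_congruent n S (canonical_mat (n - r) \<psi>s q \<theta>)"
    using accretive_decomposition[OF S acc] by metis
  let ?D = "bdiag (cis_diag \<psi>s) (E_blocks q \<theta>)"
  have n: "(n - r) + (length \<psi>s + 2 * q) = n" using \<psi>(3) r(1) by simp
  note cis_attained = canonical_form_attains_cis[OF cong n]
  note E_attained = canonical_form_attains_E[OF cong n]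
  have W: "angular_numerical_range S = {qf S x | x. x \<in> carrier_vec n \<and> x \<noteq> 0\<^sub>v n}"
    by (rule angular_numerical_range_qf[OF S])
  have bound: "\<bar>\<psi> - \<theta>\<bar> \<le> h" if \<psi>': "\<psi> \<in> set \<psi>s" for \<psi>
  proof -
    obtain x where "x \<in> carrier_vec n" "qf S x = cis \<psi>" using cis_attained[OF \<psi>'] by blast
    then have "cis (\<psi> - \<theta>) \<in> cone_0 h" using cone[of x] by (simp add: cis_mult)
    moreover have "\<psi> \<in> {\<theta> - pi / 2 .. \<theta> + pi / 2}" using \<psi>(1) \<psi>' by blast
    then have "\<bar>\<psi> - \<theta>\<bar> \<le> pi / 2" unfolding abs_le_iff atLeastAtMost_iff by linarith
    ultimately show ?thesis using cis_in_cone_0[OF h] by blast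
  qed
  have within: "set \<psi>s \<subseteq> {\<theta> - h .. \<theta> + h}"
  proof
    fix \<psi> assume "\<psi> \<in> set \<psi>s"
    then show "\<psi> \<in> {\<theta> - h .. \<theta> + h}" using bound[of \<psi>] unfolding abs_le_iff atLeastAtMost_iff by linarith
  qed
  \<comment> \<open>The values of an E block, rotated by \<theta>, have all arguments strictly below
    pi/2, so a closed sector around them is the half-plane.\<close>
  have h_E: "h = pi / 2" if q: "q \<noteq> 0"
  proof -
    have "t \<le> h" if t: "0 < t" "t < pi / 2" for t
    proof -
      obtain x where "x \<in> carrier_vec n" "qf S x = cis \<theta> * (of_real (4 * cos t) * cis t)"
        using E_attained[OF q, of "2 * t"] half_angle[of "2 * t"] by auto
      then have "of_real (4 * cos t) * cis t \<in> cone_0 h"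
        using cone[of x] by (simp add: mult.assoc[symmetric] cis_mult)
      moreover have "0 < 4 * cos t" using t by (simp add: cos_gt_zero)
      ultimately have "cis t \<in> cone_0 h" using cone_0_scale_iff by blast
      then show ?thesis using cis_in_cone_0[OF h, of t] t by simp
    qed
    then have "pi / 2 \<le> h" by (intro dense_le_bounded[of 0 "pi / 2"]) auto
    then show ?thesis using h by simp
  qed
  \<comment> \<open>The value \<open>- cis \<theta>\<close> would have real part - 1 after the
    rotation.\<close>
  have not_UNIV: "angular_numerical_range S \<noteq> UNIV"
  proof
    assume "angular_numerical_range S = UNIV"
    then have "- cis \<theta> \<in> angular_numerical_range S" by simp
    then have "\<exists>x. - cis \<theta> = qf S x \<and> x \<in> carrier_vec n \<and> x \<noteq> 0\<^sub>v n" unfolding W mem_Collect_eq .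
    then obtain x where "x \<in> carrier_vec n" "- cis \<theta> = qf S x" by (elim exE conjE)
    moreover from this(2)[symmetric] have "cis (- \<theta>) * qf S x = - 1" by (simp add: cis_mult)
    ultimately show False using acc[of x] by (simp del: times_complex.sel)
  qed
  let ?blocks = "[0\<^sub>m (n - r) (n - r), cis_diag \<psi>s] @ replicate q (E_block \<theta>)"
  have blocks: "diag_block_mat ?blocks = bdiag (0\<^sub>m (n - r) (n - r)) ?D"
    unfolding append.simps diag_block_mat_Cons_bdiag ..
  obtain T where T: "T \<in> carrier_mat n n" "invertible_mat T" "S = mat_adjoint T * bdiag (0\<^sub>m (n - r) (n - r)) ?D * T"
    using cong unfolding mat_congruent_def by blast
  show ?thesis
  proof (cases "q = 0 \<and> (\<psi>s \<noteq> [] \<longrightarrow> hd \<psi>s - last \<psi>s < pi)")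
    case True
    then have "mat_congruent r Cs (cis_diag \<psi>s)" using \<psi>(4) by simp
    then have "quasi_sectorial_phases S \<psi>s"
      using quasi_sectorial_phasesI[OF S r U Cs dec _ \<psi>(2)] True by blast
    then show ?thesis using that within unfolding phases_def by blast
  next
    case False
    \<comment> \<open>Inside a window of length pi, a spread of at least pi puts both end points of
      the window among the phases.\<close>
    have ends: "hd \<psi>s = \<theta> + pi / 2 \<and> last \<psi>s = \<theta> - pi / 2 \<and> \<psi>s \<noteq> []" if "q = 0"
    proof -
      have ne: "\<psi>s \<noteq> []" and "pi \<le> hd \<psi>s - last \<psi>s" using False that by auto
      moreover have "hd \<psi>s \<le> \<theta> + pi / 2" "\<theta> - pi / 2 \<le> last \<psi>s"
        using \<psi>(1) hd_in_set[OF ne] last_in_set[OF ne] by auto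
      ultimately show ?thesis by auto
    qed
    have angle: "field_angle S = pi"
    proof (rule field_angle_eq_pi[OF not_UNIV])
      fix t assume t: "0 < t" "t < pi"
      show "\<exists>z \<in> angular_numerical_range S. \<exists>w \<in> angular_numerical_range S. z \<noteq> 0 \<and> w \<noteq> 0 \<and> t \<le> \<bar>Arg (z / w)\<bar>"
      proof (cases "q = 0")
        case True
        obtain x y where xy: "x \<in> carrier_vec n" "qf S x = cis (\<theta> + pi / 2)" "x \<noteq> 0\<^sub>v n"
            "y \<in> carrier_vec n" "qf S y = cis (\<theta> - pi / 2)" "y \<noteq> 0\<^sub>v n"
          using cis_attained ends[OF True] hd_in_set[of \<psi>s] last_in_set[of \<psi>s] by metis
        have "cis (\<theta> + pi / 2) / cis (\<theta> - pi / 2) = - 1" by (simp add: cis_divide)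
        moreover have "Arg (- 1) = pi" by (rule cis_Arg_unique) (auto simp: sgn_eq)
        ultimately have "t \<le> \<bar>Arg (qf S x / qf S y)\<bar>" using xy t by simp
        then show ?thesis unfolding W using xy by (intro bexI[of _ "qf S x"] bexI[of _ "qf S y"]) auto
      next
        case q: False
        obtain x y where xy: "x \<in> carrier_vec n" "qf S x = cis \<theta> * (of_real (4 * cos (t / 2)) * cis (t / 2))" "x \<noteq> 0\<^sub>v n"
            "y \<in> carrier_vec n" "qf S y = cis \<theta> * (of_real (4 * cos (t / 2)) * cis (- (t / 2)))" "y \<noteq> 0\<^sub>v n"
          using E_attained[OF q, of t] E_attained[OF q, of "- t"] half_angle[of t] half_angle[of "- t"] by auto
        have cos: "cos (t / 2) \<noteq> 0" using t cos_gt_zero[of "t / 2"] by auto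
        have "qf S x / qf S y = cis (t / 2) / cis (- (t / 2))" unfolding xy using cos by simp
        also have "\<dots> = cis t" by (simp add: cis_divide)
        finally have "Arg (qf S x / qf S y) = t" using t by (intro cis_Arg_unique) (auto simp: sgn_eq)
        then show ?thesis unfolding W using xy t cos by (intro bexI[of _ "qf S x"] bexI[of _ "qf S y"]) auto
      qed
    qed
    show ?thesis
    proof (cases "q = 0 \<and> set \<psi>s \<subseteq> {\<theta> + pi / 2, \<theta> - pi / 2}")
      case True
      then have q: "q = 0" by simp
      have D_eq: "?D = cis_diag \<psi>s" using q by simp
      obtain a b where \<psi>s: "\<psi>s = replicate a (\<theta> + pi / 2) @ replicate b (\<theta> - pi / 2)"
        using sorted_two_values[OF \<psi>(2), of "\<theta> + pi / 2" "\<theta> - pi / 2"] True by auto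
      have "a + b = r" using \<psi>(3) q unfolding \<psi>s by simp
      moreover have "S = mat_adjoint T * diag_block_mat [0\<^sub>m (n - r) (n - r), cis_diag \<psi>s] * T"
        using T(3) blocks q by simp
      moreover have "rotated_hermitian S"
      proof -
        obtain x y where "x \<in> carrier_vec n" "qf S x = cis (\<theta> + pi / 2)" "y \<in> carrier_vec n" "qf S y = cis (\<theta> - pi / 2)"
          using cis_attained ends[OF q] hd_in_set[of \<psi>s] last_in_set[of \<psi>s] by metis
        then show ?thesis
          using rotated_hermitian_congruent[OF S _ cong[unfolded D_eq], of \<theta> x y] n True by simp
      qed
      ultimately have "rotated_hermitian_phases S \<psi>s"
        unfolding rotated_hermitian_phases_def Let_def r(2) unfolding carrier_matD(1)[OF S]
        using sq angle T(1,2) \<psi>s by blast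
      then show ?thesis using that within unfolding phases_def by blast
    next
      case nRH: False
      \<comment> \<open>Two values that are not collinear with the origin: an interior phase and an
        end phase, or the directions of 1 and 1 + i, relative to \<theta>, from an E block.\<close>
      have "\<not> rotated_hermitian S"
      proof
        assume rh: "rotated_hermitian S"
        show False
        proof (cases "q = 0")
          case True
          then obtain \<psi> where \<psi>': "\<psi> \<in> set \<psi>s" "\<psi> \<noteq> \<theta> + pi / 2" "\<psi> \<noteq> \<theta> - pi / 2" using nRH by blast
          obtain x y where xy: "x \<in> carrier_vec n" "qf S x = cis (\<theta> - pi / 2)" "y \<in> carrier_vec n" "qf S y = cis \<psi>"
            using cis_attained \<psi>'(1) ends[OF True] last_in_set[of \<psi>s] by metis
          have "- (\<theta> - pi / 2) + \<psi> = \<psi> - (\<theta> - pi / 2)" by simp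
          then have "sin (\<psi> - (\<theta> - pi / 2)) = 0"
            using rotated_hermitian_collinear[OF S rh xy(1,3)] unfolding xy cis_cnj cis_mult by (metis cis.sel(2))
          moreover have "\<psi> \<in> {\<theta> - pi / 2 .. \<theta> + pi / 2}" using \<psi>(1) \<psi>'(1) by blast
          then have "0 < \<psi> - (\<theta> - pi / 2)" "\<psi> - (\<theta> - pi / 2) < pi" using \<psi>'(2,3) by auto
          ultimately show False using sin_gt_zero by force
        next
          case q: False
          obtain x y where xy: "x \<in> carrier_vec n" "qf S x = cis \<theta> * (2 + 2 * cis 0)" "y \<in> carrier_vec n" "qf S y = cis \<theta> * (2 + 2 * cis (pi / 2))"
            using E_attained[OF q] by metis
          have "cnj (qf S x) * qf S y = (cnj (cis \<theta>) * cis \<theta>) * (4 * (2 + 2 * \<i>))" unfolding xy by simp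
          also have "\<dots> = 8 + 8 * \<i>" by (simp add: cis_cnj cis_mult)
          finally show False using rotated_hermitian_collinear[OF S rh xy(1,3)] by simp
        qed
      qed
      moreover define \<psi>s' where "\<psi>s' = replicate q (\<theta> + pi / 2) @ \<psi>s @ replicate q (\<theta> - pi / 2)"
      moreover have "S = mat_adjoint T * diag_block_mat ?blocks * T" unfolding blocks by (rule T(3))
      ultimately have "non_rotated_hermitian_phases S \<psi>s'"
        unfolding non_rotated_hermitian_phases_def Let_def r(2) unfolding carrier_matD(1)[OF S]
        using sq angle T(1,2) \<psi>(1-3) by blast
      moreover have "set \<psi>s' \<subseteq> {\<theta> - h .. \<theta> + h}"
      proof (cases "q = 0")
        case False
        show ?thesis unfolding \<psi>s'_def h_E[OF False] using \<psi>(1) pi_ge_zero by auto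
      qed (use within in \<open>simp add: \<psi>s'_def\<close>)
      ultimately show ?thesis using that unfolding phases_def by blast
    qed
  qed
qed

section \<open>Phases of a semi-sectorial matrix and of its Schur complement\<close>

theorem lemma4p4:
  fixes n k r r' :: nat
    and C C11 C12 C21 C22 S :: "complex mat"
  assumes k: "k \<le> n"
    and C11: "C11 \<in> carrier_mat k k"
    and C12: "C12 \<in> carrier_mat k (n - k)"
    and C21: "C21 \<in> carrier_mat (n - k) k"
    and C22: "C22 \<in> carrier_mat (n - k) (n - k)"
    and C: "C = four_block_mat C11 C12 C21 C22"
    and semi: "semi_sectorial C"
    and S: "S = schur_complement C11 C12 C21 C22"
    and r: "r = mat_rank C"
    and r': "r' = mat_rank S"
    and range12: "mat_range C12 \<subseteq> mat_range C11"
    and range21: "mat_range (mat_adjoint C21) \<subseteq> mat_range (mat_adjoint C11)"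
  shows "semi_sectorial S \<and>
    (\<forall>\<phi>s. phases C \<phi>s \<longrightarrow>
      (\<exists>\<psi>s. compatible_phases \<phi>s S \<psi>s) \<and>
      (\<forall>\<psi>s. compatible_phases \<phi>s S \<psi>s \<longrightarrow>
        (\<forall>j \<in> {1..r'}. \<phi>s ! (j - 1) \<ge> \<psi>s ! (j - 1) \<and>
                        \<psi>s ! (j - 1) \<ge> \<phi>s ! (r - r' + j - 1))))"
proof -
  let ?p = "n - k"
  have Cn: "C \<in> carrier_mat n n" unfolding C using C11 C22 k by (intro carrier_matI) auto
  obtain V where "V \<in> carrier_mat (k + ?p) ?p"
      and inj: "\<And>x. x \<in> carrier_vec ?p \<Longrightarrow> V *\<^sub>v x = 0\<^sub>v (k + ?p) \<Longrightarrow> x = 0\<^sub>v ?p"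
      and SV: "S = mat_adjoint V * C * V"
    using schur_complement_compression[OF C11 C12 C21 C22 range12 range21] unfolding S C by metis
  then have V: "V \<in> carrier_mat n ?p" using k by simp
  have Sp: "S \<in> carrier_mat ?p ?p" unfolding SV using V Cn by (intro carrier_matI) auto
  have Vx: "V *\<^sub>v x \<in> carrier_vec n" "qf S x = qf C (V *\<^sub>v x)" if "x \<in> carrier_vec ?p" for x
  proof -
    show "V *\<^sub>v x \<in> carrier_vec n" using V by (intro carrier_vecI) simp
    show "qf S x = qf C (V *\<^sub>v x)" unfolding SV by (rule qf_congruence) (use that V Cn in simp_all)
  qed
  have "angular_numerical_range S \<subseteq> angular_numerical_range C"
    unfolding angular_numerical_range_qf[OF Sp] angular_numerical_range_qf[OF Cn]
    using Vx inj k by fastforce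
  moreover have "angular_numerical_range C \<noteq> UNIV"
    using semi unfolding semi_sectorial_def field_angle_le_pi_iff by blast
  ultimately have semiS: "semi_sectorial S"
    unfolding semi_sectorial_def field_angle_le_pi_iff using Sp by auto
  have "(\<exists>\<psi>s. compatible_phases \<phi>s S \<psi>s)" if ph: "phases C \<phi>s" for \<phi>s
  proof -
    obtain len: "length \<phi>s = mat_rank C" and sorted: "sorted_wrt (\<ge>) \<phi>s"
      and width: "\<And>\<phi> \<phi>'. \<phi> \<in> set \<phi>s \<Longrightarrow> \<phi>' \<in> set \<phi>s \<Longrightarrow> \<phi> - \<phi>' \<le> pi"
      using phases_congruence[OF ph Cn] by metis
    show ?thesis
    proof (cases "\<phi>s = []")
      case True
      \<comment> \<open>An empty selection means \<open>C = 0\<close>, and compatibility then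
        demands an empty selection for \<open>S\<close>. Any selection for \<open>S\<close> is
        empty, since its length is the rank of the zero matrix.\<close>
      have cone: "cis (- \<theta>) * qf S x \<in> cone_0 0" if x: "x \<in> carrier_vec ?p" for \<theta> x
        using phases_cone[OF ph Cn _ _ _ Vx(1)[OF x], of \<theta> 0] True Vx(2)[OF x] by simp
      obtain \<psi>s where \<psi>s: "phases S \<psi>s" by (rule phases_exist[OF Sp _ _ cone[of _ 0]]) auto
      obtain T m \<theta>' \<theta>s q where T: "T \<in> carrier_mat n n" "m + length \<theta>s + 2 * q = n"
        "C = mat_adjoint T * canonical_mat m \<theta>s q \<theta>' * T"
        "\<phi>s = replicate q (\<theta>' + pi / 2) @ \<theta>s @ replicate q (\<theta>' - pi / 2)"
        using phases_congruence[OF ph Cn] by metis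
      have "q = 0" "\<theta>s = []" "m = n" using T(2,4) True by auto
      then have "C = 0\<^sub>m n n" using T(1,3) by simp
      then have "S = 0\<^sub>m ?p ?p" using V unfolding SV by simp
      \<comment> \<open>The zero matrix has the same image as a matrix without columns, which is
        trivially injective and so has rank 0.\<close>
      moreover have "vec_space.rank ?p (0\<^sub>m ?p ?p :: complex mat) = vec_space.rank ?p (0\<^sub>m ?p 0 :: complex mat)"
      proof (rule rank_eq_if_same_image)
        fix x :: "complex vec" assume "x \<in> carrier_vec ?p"
        then have "0\<^sub>m ?p ?p *\<^sub>v x = 0\<^sub>m ?p 0 *\<^sub>v 0\<^sub>v 0" by (intro eq_vecI) auto
        then show "\<exists>y \<in> carrier_vec 0. 0\<^sub>m ?p ?p *\<^sub>v x = 0\<^sub>m ?p 0 *\<^sub>v y" by (rule bexI) simp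
      next
        fix y :: "complex vec" assume "y \<in> carrier_vec 0"
        then have "0\<^sub>m ?p ?p *\<^sub>v 0\<^sub>v ?p = 0\<^sub>m ?p 0 *\<^sub>v y" by (intro eq_vecI) (auto simp: scalar_prod_def)
        then show "\<exists>x \<in> carrier_vec ?p. 0\<^sub>m ?p ?p *\<^sub>v x = 0\<^sub>m ?p 0 *\<^sub>v y" by (rule bexI) simp
      qed auto
      moreover have "vec_space.rank ?p (0\<^sub>m ?p 0 :: complex mat) = 0" by (rule rank_injective) auto
      ultimately have "mat_rank S = 0" by simp
      moreover have "length \<psi>s = mat_rank S" using phases_congruence[OF \<psi>s Sp] by metis
      ultimately have "\<psi>s = []" by simp
      then show ?thesis using \<psi>s unfolding compatible_phases_def by auto
    next
      case False
      \<comment> \<open>The phase center and half the spread of \<phi>s: the window of half-width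
        \<open>h\<close> around \<theta> is exactly the interval that compatibility
        prescribes.\<close>
      define \<theta> where "\<theta> = (hd \<phi>s + last \<phi>s) / 2"
      define h where "h = (hd \<phi>s - last \<phi>s) / 2"
      note in_range = sorted_descending_bounds[OF sorted]
      have h: "0 \<le> h" "h \<le> pi / 2"
        using in_range[of "hd \<phi>s"] width[of "hd \<phi>s" "last \<phi>s"] False by (auto simp: h_def)
      have dist: "\<bar>\<phi> - \<theta>\<bar> \<le> h" if "\<phi> \<in> set \<phi>s" for \<phi>
        using in_range[OF that] by (auto simp: \<theta>_def h_def abs_le_iff field_simps)
      have "cis (- \<theta>) * qf S x \<in> cone_0 h" if "x \<in> carrier_vec ?p" for x
        using phases_cone[OF ph Cn dist h Vx(1)[OF that]] Vx(2)[OF that] by simp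
      then obtain \<psi>s where "phases S \<psi>s" "set \<psi>s \<subseteq> {\<theta> - h .. \<theta> + h}"
        using phases_exist[OF Sp h] by blast
      moreover have "\<theta> - h = last \<phi>s" "\<theta> + h = hd \<phi>s" by (simp_all add: \<theta>_def h_def field_simps)
      ultimately have "compatible_phases \<phi>s S \<psi>s" using False unfolding compatible_phases_def by auto
      then show ?thesis by blast
    qed
  qed
  moreover have "\<phi>s ! (j - 1) \<ge> \<psi>s ! (j - 1) \<and> \<psi>s ! (j - 1) \<ge> \<phi>s ! (r - r' + j - 1)"
    if ph: "phases C \<phi>s" and comp: "compatible_phases \<phi>s S \<psi>s" and j: "j \<in> {1..r'}" for \<phi>s \<psi>s j
  proof -
    have "phases S \<psi>s" using comp unfolding compatible_phases_def by blast
    then have len: "length \<psi>s = r'" "length \<phi>s = r"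
      using phases_congruence[OF _ Sp] phases_congruence[OF ph Cn] r r' by metis+
    \<comment> \<open>Lists are indexed from 0. As \<open>j\<close> is at least 1, the truncated
      subtraction in \<open>r - r' + j - 1\<close> is harmless.\<close>
    have "j - 1 < length \<psi>s" "r - r' + j - 1 = r - r' + (j - 1)" using j len by auto
    then show ?thesis
      using phase_interlacing(2,3)[OF Cn V SV ph comp, of "j - 1"] len by simp
  qed
  ultimately show ?thesis using semiS by blast
qed

end
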